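(* Let $(X_i)_{i\in\mathbb Z}$ be the stationary sequence described in the context and let $p>2$. There exists a numerical constant $C$, not depending on $n$, such that for all positive integers $n$, $$\|W_1(\mu_n,\mu)\|_p^p\le C\left(\frac{s_{\alpha,n}^p}{n^{p/2}}+\frac1{n^{p-1}}\int_0^1\left(\alpha_{2,\mathbf X}^{-1}(u)\wedge n\right)^{p-1}Q^p(u)\,du\right),$$ where $$s_{\alpha,n}=\int_0^\infty\sqrt{S_{\alpha,n}(t)}\,dt,\qquad S_{\alpha,n}(t)=\sum_{k=0}^n\min\{\alpha_{1,\mathbf X}(k),H(t)\}.$$
   Context: Setting. $(\Omega,\mathcal A,\mathbb P)$ is a probability space, $T:\Omega\to\Omega$ is a bijective bi-measurable transformation preserving $\mathbb P$, and $\mathcal F_0\subseteq\mathcal A$ is a sub-$\sigma$-algebra with $\mathcal F_0\subseteq T^{-1}(\mathcal F_0)$. $X_0$ is an $\mathcal F_0$-measurable integrable real-valued random variable with distribution $\mu$ and distribution function $F$, and $\mathbf X=(X_i)_{i\in\mathbb Z}$ with $X_i=X_0\circ T^i$. Notation. $\mu_n=\frac1n\sum_{k=1}^n\delta_{X_k}$ is the empirical measure. $W_1(\mu_1,\mu_2)=\inf_\pi\int|x-y|\,\pi(dx,dy)$, the infimum being over probability measures $\pi$ on $\mathbb R^2$ with marginals $\mu_1,\mu_2$. $H(t)=\mathbb P(|X_0|>t)$ for $t\ge0$ and $Q(u)=\inf\{t\ge0:H(t)\le u\}$ for $u\in[0,1]$. $\|\cdot\|_p$ is the norm of $\mathbb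 L^p(\mathbb P)$ and $a\wedge b=\min\{a,b\}$. Dependency coefficients. For an integrable random variable $Z$, $Z^{(0)}=Z-\mathbb E(Z)$. For a random vector $Y=(Y_1,\dots,Y_k)$ in $\mathbb R^k$ and a $\sigma$-algebra $\mathcal F$, $$\alpha(\mathcal F,Y)=\sup_{(x_1,\dots,x_k)\in\mathbb R^k}\left\|\mathbb E\left(\prod_{j=1}^k(\mathbf 1_{Y_j\le x_j})^{(0)}\Big|\mathcal F\right)-\mathbb E\left(\prod_{j=1}^k(\mathbf 1_{Y_j\le x_j})^{(0)}\right)\right\|_1 .$$ For $k\ge1$ and $n\ge0$, $\alpha_{k,\mathbf X}(n)=\max_{1\le l\le k}\ \sup_{n\le i_1\le\dots\le i_l}\alpha(\mathcal F_0,(X_{i_1},\dots,X_{i_l}))$. In particular $\alpha_{1,\mathbf X}(n)=\sup_x\|\mathbb E(\mathbf 1_{X_n\le x}|\mathcal F_0)-F(x)\|_1$. For $u\in(0,1)$, $\alpha_{2,\mathbf X}^{-1}(u)=\sum_{k=0}^\infty\mathbf 1_{u\le\alpha_{2,\mathbf X}(k)}$. The right-hand side of the inequality may be infinite. *)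

theory Defs
  imports "HOL-Probability.Probability"
begin

section \<open>The stationary sequence\<close>

text \<open>
  The \<open>\<sigma>\<close>-algebra \<open>\<F>\<^sub>0\<close> is represented by a measure \<open>F0\<close> of which only the underlying
  measurable space matters.
\<close>

locale stationary_setting = prob_space M
  for M :: "'a measure" and T :: "'a \<Rightarrow> 'a" and F0 :: "'a measure" and X0 :: "'a \<Rightarrow> real" +
  assumes T_bij: "bij_betw T (space M) (space M)"
    and T_measurable: "T \<in> measurable M M"
    and T_inv_measurable: "inv_into (space M) T \<in> measurable M M"
    and T_preserves: "distr M M T = M"
    and F0_subalgebra: "subalgebra M F0"
    and F0_incr: "sets F0 \<subseteq> {T -` A \<inter> space M | A. A \<in> sets F0}"
    and X0_measurable: "X0 \<in> borel_measurable F0"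
    and X0_integrable: "integrable M X0"

definition iter_int :: "'a measure \<Rightarrow> ('a \<Rightarrow> 'a) \<Rightarrow> int \<Rightarrow> 'a \<Rightarrow> 'a" where
  "iter_int M T i =
     (if 0 \<le> i then T ^^ nat i else inv_into (space M) T ^^ nat (- i))"

definition stat_seq :: "'a measure \<Rightarrow> ('a \<Rightarrow> 'a) \<Rightarrow> ('a \<Rightarrow> real) \<Rightarrow> int \<Rightarrow> 'a \<Rightarrow> real" where
  "stat_seq M T X0 i = X0 \<circ> iter_int M T i"

section \<open>Powers and norms with values in \<open>[0,\<infinity>]\<close>\<close>

text \<open>Meant for exponents \<open>p > 0\<close>.\<close>

definition ennpowr :: "ennreal \<Rightarrow> real \<Rightarrow> ennreal" where
  "ennpowr x p = (if x = \<infinity> then \<infinity> else ennreal (enn2real x powr p))"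

definition Lp_norm :: "'a measure \<Rightarrow> real \<Rightarrow> ('a \<Rightarrow> ennreal) \<Rightarrow> ennreal" where
  "Lp_norm M p f = ennpowr (\<integral>\<^sup>+\<omega>. ennpowr (f \<omega>) p \<partial>M) (1 / p)"

section \<open>Empirical measure and Wasserstein distance\<close>

definition empirical_measure :: "(int \<Rightarrow> 'a \<Rightarrow> real) \<Rightarrow> nat \<Rightarrow> 'a \<Rightarrow> real measure" where
  "empirical_measure X n \<omega> =
     measure_of UNIV (sets borel)
       (\<lambda>A. (\<Sum>k=1..n. emeasure (return borel (X (int k) \<omega>)) A) / of_nat n)"

text \<open>
  The function in the preceding definition is countably additive, so \<open>measure_of\<close> does not
  fall back to the zero measure.
\<close>

lemma emeasure_empirical_measure:
  assumes "A \<in> sets borel"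
  shows "emeasure (empirical_measure X n \<omega>) A =
           (\<Sum>k=1..n. emeasure (return borel (X (int k) \<omega>)) A) / of_nat n"
proof (rule emeasure_measure_of[OF empirical_measure_def])
  let ?f = "\<lambda>A. (\<Sum>k=1..n. emeasure (return borel (X (int k) \<omega>)) A) / (of_nat n :: ennreal)"
  show "positive (sets (empirical_measure X n \<omega>)) ?f"
    by (simp add: positive_def)
  show "countably_additive (sets (empirical_measure X n \<omega>)) ?f"
  proof (rule countably_additiveI)
    fix B :: "nat \<Rightarrow> real set"
    assume "range B \<subseteq> sets (empirical_measure X n \<omega>)" and d: "disjoint_family B"
    then have B: "range B \<subseteq> sets borel"
      by (simp add: empirical_measure_def sets.sigma_sets_eq[of borel, simplified])
    have "(\<Sum>i. ?f (B i)) =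
        (\<Sum>i. \<Sum>k=1..n. emeasure (return borel (X (int k) \<omega>)) (B i)) / of_nat n"
      by (simp add: divide_ennreal_def)
    also have "(\<Sum>i. \<Sum>k=1..n. emeasure (return borel (X (int k) \<omega>)) (B i)) =
        (\<Sum>k=1..n. \<Sum>i. emeasure (return borel (X (int k) \<omega>)) (B i))"
      by (rule suminf_sum) simp
    also have "\<dots> = (\<Sum>k=1..n. emeasure (return borel (X (int k) \<omega>)) (\<Union>i. B i))"
      using B d by (intro sum.cong refl suminf_emeasure) auto
    finally show "(\<Sum>i. ?f (B i)) = ?f (\<Union>i. B i)" .
  qed
qed (use assms in \<open>auto simp: empirical_measure_def sets.sigma_sets_eq[of borel, simplified]\<close>)

definition couplings :: "real measure \<Rightarrow> real measure \<Rightarrow> (real \<times> real) measure set" where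
  "couplings \<mu>1 \<mu>2 =
     {\<pi>. prob_space \<pi> \<and> sets \<pi> = sets (borel \<Otimes>\<^sub>M borel) \<and>
         distr \<pi> borel fst = \<mu>1 \<and> distr \<pi> borel snd = \<mu>2}"

definition W1 :: "real measure \<Rightarrow> real measure \<Rightarrow> ennreal" where
  "W1 \<mu>1 \<mu>2 = (INF \<pi>\<in>couplings \<mu>1 \<mu>2. \<integral>\<^sup>+(x, y). ennreal \<bar>x - y\<bar> \<partial>\<pi>)"

section \<open>Tail and quantile functions\<close>

definition tail_fun :: "'a measure \<Rightarrow> ('a \<Rightarrow> real) \<Rightarrow> real \<Rightarrow> real" where
  "tail_fun M Z t = measure M {\<omega> \<in> space M. \<bar>Z \<omega>\<bar> > t}"

text \<open>Valued in \<open>[0,\<infinity>]\<close>, so that the value at \<open>0\<close> is \<open>\<infinity>\<close> for unbounded \<open>Z\<close>.\<close>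

definition quantile_fun :: "'a measure \<Rightarrow> ('a \<Rightarrow> real) \<Rightarrow> real \<Rightarrow> ennreal" where
  "quantile_fun M Z u = (INF t\<in>{t. 0 \<le> t \<and> tail_fun M Z t \<le> u}. ennreal t)"

section \<open>Dependency coefficients\<close>

definition centered :: "'a measure \<Rightarrow> ('a \<Rightarrow> real) \<Rightarrow> 'a \<Rightarrow> real" where
  "centered M Z \<omega> = Z \<omega> - (\<integral>\<omega>'. Z \<omega>' \<partial>M)"

definition centered_ind_prod ::
  "'a measure \<Rightarrow> nat \<Rightarrow> (nat \<Rightarrow> 'a \<Rightarrow> real) \<Rightarrow> (nat \<Rightarrow> real) \<Rightarrow> 'a \<Rightarrow> real" where
  "centered_ind_prod M k Y x \<omega> =
     (\<Prod>j=1..k. centered M (\<lambda>\<omega>'. indicator {..x j} (Y j \<omega>')) \<omega>)"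

text \<open>
  A vector of length \<open>k\<close> is a function on \<open>nat\<close> of which only the entries \<open>1, \<dots>, k\<close> are used.
  On a probability space the products above are bounded by \<open>1\<close> in absolute value, so the real
  suprema below are taken over nonempty sets of numbers in \<open>[0,2]\<close>.
\<close>

definition alpha_dep ::
  "'a measure \<Rightarrow> 'a measure \<Rightarrow> nat \<Rightarrow> (nat \<Rightarrow> 'a \<Rightarrow> real) \<Rightarrow> real" where
  "alpha_dep M F k Y =
     (SUP x. \<integral>\<omega>. \<bar>real_cond_exp M F (centered_ind_prod M k Y x) \<omega>
                    - (\<integral>\<omega>'. centered_ind_prod M k Y x \<omega>' \<partial>M)\<bar> \<partial>M)"

definition alpha_coef ::
  "'a measure \<Rightarrow> 'a measure \<Rightarrow> (int \<Rightarrow> 'a \<Rightarrow> real) \<Rightarrow> nat \<Rightarrow> nat \<Rightarrow> real" where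
  "alpha_coef M F X k n =
     (MAX l\<in>{1..k}. SUP i\<in>{i :: nat \<Rightarrow> int. int n \<le> i 1 \<and> mono_on {1..l} i}.
        alpha_dep M F l (\<lambda>j. X (i j)))"

definition alpha_inv :: "(nat \<Rightarrow> real) \<Rightarrow> real \<Rightarrow> ennreal" where
  "alpha_inv a u = (\<Sum>k. if u \<le> a k then 1 else 0)"

definition S_alpha ::
  "'a measure \<Rightarrow> 'a measure \<Rightarrow> (int \<Rightarrow> 'a \<Rightarrow> real) \<Rightarrow> nat \<Rightarrow> real \<Rightarrow> real" where
  "S_alpha M F X n t = (\<Sum>k=0..n. min (alpha_coef M F X 1 k) (tail_fun M (X 0) t))"

definition s_alpha ::
  "'a measure \<Rightarrow> 'a measure \<Rightarrow> (int \<Rightarrow> 'a \<Rightarrow> real) \<Rightarrow> nat \<Rightarrow> ennreal" where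
  "s_alpha M F X n = (\<integral>\<^sup>+t\<in>{0..}. ennreal (sqrt (S_alpha M F X n t)) \<partial>lborel)"

end

theory Submission
  imports Defs
begin

text \<open>
  On the line, \<open>n W\<^sub>1(\<mu>\<^sub>n, \<mu>)\<close> is at most the integral over \<open>t\<close> of \<open>\<bar>Z t\<bar>\<close>, where \<open>Z t = n (F\<^sub>n t - F t)\<close>.
  Fix \<open>t\<close>, write \<open>h\<close> for the tail \<open>H \<bar>t\<bar>\<close> and \<open>\<sigma>\<close> for the sum \<open>S\<^bsub>\<alpha>,n\<^esub>\<close> at \<open>\<bar>t\<bar>\<close>, and let \<open>2m \<ge> p + 2\<close>.
  Cut \<open>Z t\<close> into blocks of length \<open>q\<close> and centre each by its conditional expectation given the past
  \<open>q\<close> steps before it; the blocks of each parity are then martingale differences. Stopping them when their conditional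
  variance, which \<open>\<alpha>\<^sub>2\<close> controls in mean, becomes large, Rosenthal's inequality gives \<open>Z t = A + B\<close>
  with \<open>E \<bar>B\<bar> \<le> C n min(\<alpha>\<^sub>2(q), h)\<close> and the moment of order \<open>2m\<close> of \<open>A\<close> bounded by a Gaussian part
  \<open>(n \<sigma>)^m\<close> and the moments of the blocks. Taken with \<open>q\<close> proportional to \<open>n\<close>, this yields by
  induction \<open>E (Z t)^(2m) \<le> C ((n \<sigma>)^m + n^2 \<Sum>k<n. (k+1)^(2m-3) min(\<alpha>\<^sub>2(k), h))\<close>,
  which is then inserted for the blocks. The superfluous factor \<open>n\<close>
  does no harm because only moments of order larger than \<open>p\<close> are used.

  For the tail of the integral of \<open>\<bar>Z t\<bar>\<close> at level \<open>l\<close> choose \<open>R\<close> and \<open>q\<close> with \<open>q R \<le> l\<close> such that \<open>\<alpha>\<^sub>2(q)\<close> and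
  \<open>H(R)\<close> cross. The range \<open>t > R\<close> and the parts \<open>B\<close> are estimated in mean, the parts \<open>A\<close> in the moment
  of order \<open>2m\<close>. Since \<open>1 < p < 2m\<close>, integrating these bounds against \<open>p l^(p-1)\<close> loses only constants.
\<close>

section \<open>Wasserstein distance and distribution functions\<close>

text \<open>\<open>\<alpha>\<^sub>2\<close> constrains only pairs of future variables and yields
  only mean deviations: no conditional moment above the second is under control, and even the
  conditional variance is so merely in L1. Hence the high moment has to come from martingale
  structure, and whatever exceeds the stopping level is paid for by a first moment. Taking the norm
  of order \<open>p\<close> inside the integral over \<open>t\<close> would leave the
  \<open>p\<close>-th root of the non-Gaussian part under the integral, which the quantile integral
  does not bound. With tails, the cut \<open>(R, q)\<close> may depend on the level
  \<open>l\<close>, and the weight in Hoelder's inequality on \<open>(0, R)\<close> can be chosen so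
  that it costs just one factor \<open>R\<close>. Integrating in \<open>l\<close> turns
  \<open>(k+1)^(2m-3) t^(2m-2)\<close> into \<open>(k+1)^(p-2) t^(p-1)\<close>, the weights from
  which the powers \<open>p-1\<close> of the inverse coefficient and \<open>p\<close> of the
  quantile arise.\<close>

lemma real_distribution_empirical_measure:
  assumes "n \<ge> 1"
  shows "real_distribution (empirical_measure X n \<omega>)"
proof -
  have 1: "(of_nat n :: ennreal) / of_nat n = 1"
    using assms by (intro ennreal_divide_self) (auto simp: of_nat_less_top)
  have "prob_space (empirical_measure X n \<omega>)"
  proof (rule prob_spaceI)
    have "space (empirical_measure X n \<omega>) = UNIV"
      by (simp add: empirical_measure_def)
    then show "emeasure (empirical_measure X n \<omega>) (space (empirical_measure X n \<omega>)) = 1"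
      using 1 by (simp add: emeasure_empirical_measure)
  qed
  then show ?thesis
    unfolding real_distribution_def real_distribution_axioms_def
    by (simp add: empirical_measure_def sets.sigma_sets_eq[of borel, simplified])
qed

lemma cdf_empirical_measure:
  "cdf (empirical_measure X n \<omega>) t = (\<Sum>k=1..n. indicator {..t} (X (int k) \<omega>)) / real n"
proof (cases "n = 0")
  case True
  then show ?thesis
    by (simp add: cdf_def measure_def emeasure_empirical_measure)
next
  case False
  have "emeasure (empirical_measure X n \<omega>) {..t}
      = (\<Sum>k=1..n. ennreal (indicator {..t} (X (int k) \<omega>))) / ennreal (real n)"
    by (simp add: emeasure_empirical_measure ennreal_indicator ennreal_of_nat_eq_real_of_nat)
  also have "\<dots> = ennreal ((\<Sum>k=1..n. indicator {..t} (X (int k) \<omega>)) / real n)"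
    using False by (simp add: sum_ennreal divide_ennreal sum_nonneg)
  finally show ?thesis
    by (simp add: cdf_def measure_def sum_nonneg)
qed

text \<open>The indicators differ exactly when \<open>t\<close> lies between the two points, left
  end included and right end excluded. A transport cost thereby becomes an integral over
  thresholds.\<close>

lemma nn_integral_threshold_diff:
  fixes x y :: real
  shows "(\<integral>\<^sup>+t. ennreal \<bar>indicator {..t} x - indicator {..t} y\<bar> \<partial>lborel) = ennreal \<bar>x - y\<bar>"
proof -
  have "(\<integral>\<^sup>+t. ennreal \<bar>indicator {..t} x - indicator {..t} y\<bar> \<partial>lborel)
      = (\<integral>\<^sup>+t. indicator {min x y..<max x y} t \<partial>lborel)"
    by (intro nn_integral_cong) (auto simp: indicator_def min_def max_def)
  also have "\<dots> = ennreal \<bar>x - y\<bar>"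
    by (auto simp: min_def max_def)
  finally show ?thesis .
qed

text \<open>The bound is attained by the quantile coupling.\<close>

lemma W1_le_nn_integral_cdf_diff:
  assumes "real_distribution \<mu>1" "real_distribution \<mu>2"
  shows "W1 \<mu>1 \<mu>2 \<le> (\<integral>\<^sup>+t. ennreal \<bar>cdf \<mu>1 t - cdf \<mu>2 t\<bar> \<partial>lborel)"
proof -
  interpret A: cdf_distribution \<mu>1 unfolding cdf_distribution_def by fact
  interpret B: cdf_distribution \<mu>2 unfolding cdf_distribution_def by fact
  let ?O = "restrict_space lborel {0<..<1::real}"
  interpret O: prob_space ?O
    by (auto simp: space_restrict_space emeasure_restrict_space intro!: prob_spaceI)
  have mA: "A.I \<in> borel_measurable ?O" and mB: "B.I \<in> borel_measurable ?O"
    using A.measurable_CI B.measurable_CI by (auto simp: measurable_def sets_restrict_space space_restrict_space)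
  note [measurable] = mA mB
  define \<pi> where "\<pi> = distr ?O (borel \<Otimes>\<^sub>M borel) (\<lambda>u. (A.I u, B.I u))"
  have pm: "(\<lambda>u. (A.I u, B.I u)) \<in> measurable ?O (borel \<Otimes>\<^sub>M borel)"
    by measurable
  have "distr \<pi> borel fst = \<mu>1"
    unfolding \<pi>_def using A.distr_I_eq_M
    by (subst distr_distr[OF _ pm]) (auto simp: comp_def)
  moreover have "distr \<pi> borel snd = \<mu>2"
    unfolding \<pi>_def using B.distr_I_eq_M
    by (subst distr_distr[OF _ pm]) (auto simp: comp_def)
  moreover have "prob_space \<pi>"
    unfolding \<pi>_def using pm by (rule O.prob_space_distr)
  ultimately have "\<pi> \<in> couplings \<mu>1 \<mu>2"
    by (simp add: couplings_def \<pi>_def)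
  then have "W1 \<mu>1 \<mu>2 \<le> (\<integral>\<^sup>+(x, y). ennreal \<bar>x - y\<bar> \<partial>\<pi>)"
    unfolding W1_def by (rule INF_lower)
  also have "\<dots> = (\<integral>\<^sup>+u. ennreal \<bar>A.I u - B.I u\<bar> \<partial>?O)"
    unfolding \<pi>_def by (subst nn_integral_distr[OF pm]) auto
  also have "\<dots> = (\<integral>\<^sup>+u. (\<integral>\<^sup>+t. ennreal \<bar>indicator {..t} (A.I u) - indicator {..t} (B.I u)\<bar> \<partial>lborel) \<partial>?O)"
    by (simp add: nn_integral_threshold_diff)
  also have "\<dots> = (\<integral>\<^sup>+t. (\<integral>\<^sup>+u. ennreal \<bar>indicator {..t} (A.I u) - indicator {..t} (B.I u)\<bar> \<partial>?O) \<partial>lborel)"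
  proof -
    interpret pair_sigma_finite ?O lborel
      by (simp add: pair_sigma_finite_def O.sigma_finite_measure_axioms sigma_finite_lborel)
    have "(\<lambda>(u, t). ennreal \<bar>indicator {..t} (A.I u) - indicator {..t} (B.I u)\<bar>)
          \<in> borel_measurable (?O \<Otimes>\<^sub>M lborel)"
      unfolding indicator_def atMost_iff by measurable
    from Fubini[OF this] show ?thesis by simp
  qed
  also have "\<dots> \<le> (\<integral>\<^sup>+t. ennreal \<bar>cdf \<mu>1 t - cdf \<mu>2 t\<bar> \<partial>lborel)"
  proof (rule nn_integral_mono)
    fix t :: real
    let ?a = "cdf \<mu>1 t" and ?b = "cdf \<mu>2 t"
    have "(\<integral>\<^sup>+u. ennreal \<bar>indicator {..t} (A.I u) - indicator {..t} (B.I u)\<bar> \<partial>?O)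
       \<le> (\<integral>\<^sup>+u. indicator {min ?a ?b .. max ?a ?b} u \<partial>?O)"
    proof (rule nn_integral_mono)
      \<comment> \<open>By the Galois connection between quantile and distribution function,
        \<open>A.I u \<le> t\<close> holds iff \<open>u \<le> ?a\<close>. For fixed \<open>t\<close>
        the indicators can therefore differ only for \<open>u\<close> between \<open>?a\<close> and
        \<open>?b\<close>.\<close>
      fix u assume "u \<in> space ?O"
      then have u: "0 < u" "u < 1" by (auto simp: space_restrict_space)
      show "ennreal \<bar>indicator {..t} (A.I u) - indicator {..t} (B.I u)\<bar> \<le> indicator {min ?a ?b .. max ?a ?b} u"
        using A.pseudoinverse[OF u, of t] B.pseudoinverse[OF u, of t]
        by (cases "A.I u \<le> t"; cases "B.I u \<le> t") (simp_all add: min_le_iff_disj le_max_iff_disj)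
    qed
    also have "\<dots> \<le> (\<integral>\<^sup>+u. indicator {min ?a ?b .. max ?a ?b} u \<partial>lborel)"
      by (subst nn_integral_restrict_space)
         (auto intro!: nn_integral_mono split: split_indicator simp del: nn_integral_indicator)
    also have "\<dots> = ennreal \<bar>?a - ?b\<bar>"
      by (auto simp: min_def max_def)
    finally show "(\<integral>\<^sup>+u. ennreal \<bar>indicator {..t} (A.I u) - indicator {..t} (B.I u)\<bar> \<partial>?O) \<le> ennreal \<bar>?a - ?b\<bar>" .
  qed
  finally show ?thesis .
qed

section \<open>Rosenthal inequality for martingale differences\<close>

text \<open>The class of test functions in which all conditional statements are phrased. The bound
  holds at every point, not almost everywhere, so the class is closed under algebraic operations and
  every product formed in it is integrable on a probability space.\<close>

definition bmeas :: "'a measure \<Rightarrow> ('a \<Rightarrow> real) \<Rightarrow> bool" where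
  "bmeas F f \<longleftrightarrow> f \<in> borel_measurable F \<and> (\<exists>B. \<forall>x. \<bar>f x\<bar> \<le> B)"

lemma bmeasI: "f \<in> borel_measurable F \<Longrightarrow> (\<And>x. \<bar>f x\<bar> \<le> B) \<Longrightarrow> bmeas F f"
  unfolding bmeas_def by blast

lemma bmeas_measurable: "bmeas F f \<Longrightarrow> f \<in> borel_measurable F"
  by (simp add: bmeas_def)

lemma bmeasE:
  assumes "bmeas F f" obtains B where "B \<ge> 0" "\<And>x. \<bar>f x\<bar> \<le> B"
proof -
  from assms obtain B where "\<And>x. \<bar>f x\<bar> \<le> B" by (auto simp: bmeas_def)
  then show ?thesis by (intro that[of "max 0 B"]) (auto simp: le_max_iff_disj)
qed

lemma bmeas_const [intro, simp]: "bmeas F (\<lambda>_. c)"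
  by (rule bmeasI[of _ _ "\<bar>c\<bar>"]) auto

lemma bmeas_add [intro]:
  assumes "bmeas F f" "bmeas F g" shows "bmeas F (\<lambda>x. f x + g x)"
proof -
  obtain A where A: "\<And>x. \<bar>f x\<bar> \<le> A" by (metis bmeasE assms(1))
  obtain B where B: "\<And>x. \<bar>g x\<bar> \<le> B" by (metis bmeasE assms(2))
  show ?thesis
    by (rule bmeasI[of _ _ "A + B"])
       (use assms A B in \<open>auto dest!: bmeas_measurable intro!: order_trans[OF abs_triangle_ineq] add_mono\<close>)
qed

lemma bmeas_mult [intro]:
  assumes "bmeas F f" "bmeas F g" shows "bmeas F (\<lambda>x. f x * g x)"
proof -
  obtain A where A: "A \<ge> 0" "\<And>x. \<bar>f x\<bar> \<le> A" by (metis bmeasE assms(1))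
  obtain B where B: "\<And>x. \<bar>g x\<bar> \<le> B" by (metis bmeasE assms(2))
  show ?thesis
    by (rule bmeasI[of _ _ "A * B"])
       (use assms A B in \<open>auto dest!: bmeas_measurable simp: abs_mult intro!: mult_mono\<close>)
qed

lemma bmeas_uminus [intro]: "bmeas F f \<Longrightarrow> bmeas F (\<lambda>x. - f x)"
  using bmeas_mult[of F "\<lambda>_. -1" f] by simp

lemma bmeas_diff [intro]: "bmeas F f \<Longrightarrow> bmeas F g \<Longrightarrow> bmeas F (\<lambda>x. f x - g x)"
  using bmeas_add[of F f "\<lambda>x. - g x"] bmeas_uminus[of F g] by simp

lemma bmeas_power [intro]: "bmeas F f \<Longrightarrow> bmeas F (\<lambda>x. f x ^ k)"
  by (induction k) auto

lemma bmeas_sum [intro]: "(\<And>i. i \<in> I \<Longrightarrow> bmeas F (f i)) \<Longrightarrow> bmeas F (\<lambda>x. \<Sum>i\<in>I. f i x)"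
  by (induction I rule: infinite_finite_induct) auto

lemma bmeas_abs [intro]: "bmeas F f \<Longrightarrow> bmeas F (\<lambda>x. \<bar>f x\<bar>)"
  by (auto simp: bmeas_def)

lemma bmeas_max [intro]:
  assumes "bmeas F f" "bmeas F g" shows "bmeas F (\<lambda>x. max (f x) (g x))"
proof -
  have "(\<lambda>x. max (f x) (g x)) = (\<lambda>x. (1/2) * (f x + g x + \<bar>f x - g x\<bar>))"
    by (auto simp: fun_eq_iff max_def)
  then show ?thesis using assms by (simp only:) (intro bmeas_const bmeas_add bmeas_diff bmeas_mult bmeas_abs)
qed

lemma bmeas_min [intro]:
  assumes "bmeas F f" "bmeas F g" shows "bmeas F (\<lambda>x. min (f x) (g x))"
proof -
  have "(\<lambda>x. min (f x) (g x)) = (\<lambda>x. (1/2) * (f x + g x - \<bar>f x - g x\<bar>))"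
    by (auto simp: fun_eq_iff min_def)
  then show ?thesis using assms by (simp only:) (intro bmeas_const bmeas_add bmeas_diff bmeas_mult bmeas_abs)
qed

lemma bmeas_if_le [intro]:
  assumes "bmeas F f" "bmeas F g"
  shows "bmeas F (\<lambda>x. if f x \<le> c then g x else (0::real))"
proof -
  obtain B where B: "B \<ge> 0" "\<And>x. \<bar>g x\<bar> \<le> B" by (metis bmeasE assms(2))
  have [measurable]: "f \<in> borel_measurable F" "g \<in> borel_measurable F"
    using assms by (auto simp: bmeas_measurable)
  show ?thesis by (rule bmeasI[of _ _ B]) (use B in auto)
qed

lemmas bmeas_intros = bmeas_const bmeas_add bmeas_mult bmeas_uminus bmeas_diff bmeas_power bmeas_sum
  bmeas_abs bmeas_max bmeas_min bmeas_if_le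

lemma bmeas_subalgebra: "subalgebra G F \<Longrightarrow> bmeas F f \<Longrightarrow> bmeas G f"
  unfolding bmeas_def using measurable_from_subalg by blast

lemma (in prob_space) bmeas_integrable [intro]:
  assumes "bmeas M f" shows "integrable M f"
proof -
  obtain B where "\<And>x. \<bar>f x\<bar> \<le> B" by (metis bmeasE assms)
  then show ?thesis using assms
    by (intro integrable_const_bound[of _ B]) (auto simp: bmeas_measurable)
qed

section \<open>Elementary inequalities for even powers\<close>

text \<open>The linear term is kept exactly, because it will vanish by orthogonality. Every term of
  higher degree in \<open>y\<close> is at most \<open>?E\<close>, according to which of
  \<open>\<bar>x\<bar>\<close> and \<open>\<bar>y\<bar>\<close> is larger, and the binomial
  coefficients add up to \<open>2 ^ (2*m)\<close>.\<close>

lemma power_add_even_le: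
  fixes x y :: real
  assumes "m \<ge> 1"
  shows "(x + y) ^ (2*m) \<le> x ^ (2*m) + real (2*m) * (x ^ (2*m-1) * y)
      + 2 ^ (2*m) * (x ^ (2*m-2) * y\<^sup>2 + y ^ (2*m))"
proof -
  let ?r = "2*m" and ?E = "x ^ (2*m-2) * y\<^sup>2 + y ^ (2*m)"
  have E0: "?E \<ge> 0" using assms by (auto intro!: add_nonneg_nonneg mult_nonneg_nonneg zero_le_even_power)
  have *: "x ^ (?r - j) * y ^ j \<le> ?E" if j: "2 \<le> j" "j \<le> ?r" for j
  proof -
    have "x ^ (?r - j) * y ^ j \<le> \<bar>x\<bar> ^ (?r - j) * \<bar>y\<bar> ^ j"
      by (metis abs_ge_self abs_mult power_abs)
    also have "\<dots> \<le> \<bar>x\<bar> ^ (?r - 2) * \<bar>y\<bar> ^ 2 + \<bar>y\<bar> ^ ?r"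
    proof (cases "\<bar>y\<bar> \<le> \<bar>x\<bar>")
      case True
      have "\<bar>x\<bar> ^ (?r - j) * \<bar>y\<bar> ^ j = \<bar>x\<bar> ^ (?r - j) * (\<bar>y\<bar> ^ (j-2) * \<bar>y\<bar> ^ 2)"
        using j(1) by (metis le_add_diff_inverse2 power_add)
      also have "\<dots> \<le> \<bar>x\<bar> ^ (?r - j) * (\<bar>x\<bar> ^ (j-2) * \<bar>y\<bar> ^ 2)"
        using True by (intro mult_left_mono mult_right_mono power_mono) auto
      also have "\<dots> = \<bar>x\<bar> ^ (?r - 2) * \<bar>y\<bar> ^ 2"
      proof -
        have "(?r - j) + (j - 2) = ?r - 2" using j by simp
        then show ?thesis by (metis power_add mult.assoc)
      qed
      finally show ?thesis by (simp add: add_increasing2)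
    next
      case False
      have "\<bar>x\<bar> ^ (?r - j) * \<bar>y\<bar> ^ j \<le> \<bar>y\<bar> ^ (?r - j) * \<bar>y\<bar> ^ j"
        using False by (intro mult_right_mono power_mono) auto
      also have "\<dots> = \<bar>y\<bar> ^ ?r" using j by (simp flip: power_add)
      finally show ?thesis by (simp add: add_increasing)
    qed
    also have "\<dots> = ?E" using assms by (simp add: power_even_abs)
    finally show ?thesis .
  qed
  have "(x + y) ^ ?r = (\<Sum>j\<le>?r. real (?r choose j) * (y ^ j * x ^ (?r - j)))"
    using binomial_ring[of y x ?r] by (simp add: add.commute mult.assoc)
  also have "{..?r} = insert 0 (insert 1 {2..?r})" using assms by auto
  also have "(\<Sum>j\<in>insert 0 (insert 1 {2..?r}). real (?r choose j) * (y ^ j * x ^ (?r - j)))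
     = x ^ ?r + (real ?r * (x ^ (?r-1) * y) + (\<Sum>j\<in>{2..?r}. real (?r choose j) * (y ^ j * x ^ (?r - j))))"
    by (simp add: mult_ac)
  also have "(\<Sum>j\<in>{2..?r}. real (?r choose j) * (y ^ j * x ^ (?r - j)))
      \<le> (\<Sum>j\<in>{2..?r}. real (?r choose j) * ?E)"
    using * by (intro sum_mono mult_left_mono) (auto simp: mult.commute)
  also have "\<dots> \<le> (\<Sum>j\<le>?r. real (?r choose j) * ?E)"
    using E0 by (intro sum_mono2) auto
  also have "\<dots> = 2 ^ ?r * ?E"
    using choose_row_sum[of ?r] by (simp flip: sum_distrib_right of_nat_sum)
  finally show ?thesis by simp
qed

text \<open>Convexity of the even power: its graph lies above the tangent at \<open>y\<close>.
  Bernoulli's inequality for \<open>x / y\<close> gives it, whence the separate case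
  \<open>y = 0\<close>.\<close>

lemma power_even_tangent:
  fixes x y :: real
  shows "y ^ (2 * s) + real (2 * s) * (y ^ (2 * s-1) * (x - y)) \<le> x ^ (2 * s)"
proof (cases "s = 0 \<or> y = 0")
  case True then show ?thesis by (cases "s = 0") (auto simp: power_0_left)
next
  case False
  have "1 + real (2 * s) * (x / y - 1) \<le> (1 + (x / y - 1)) ^ (2 * s)"
    by (rule Bernoulli_inequality_even) simp
  then have "y ^ (2 * s) * (1 + real (2 * s) * (x / y - 1)) \<le> y ^ (2 * s) * (x / y) ^ (2 * s)"
    by (intro mult_left_mono) auto
  moreover have "y ^ (2 * s) = y * y ^ (2 * s-1)"
    using False by (metis mult_is_0 power_eq_if zero_neq_numeral)
  moreover have "y ^ (2 * s) * (x / y) ^ (2 * s) = x ^ (2 * s)"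
    using False by (simp add: power_divide)
  moreover have "y * y ^ (2 * s-1) * (1 + real (2 * s) * (x / y - 1))
       = y * y ^ (2 * s-1) + real (2 * s) * (y ^ (2 * s-1) * (x - y))"
    using False by (simp add: field_simps)
  ultimately show ?thesis by simp
qed

text \<open>Whichever of \<open>b\<close> and \<open>\<delta> * a\<close> is larger absorbs the
  other. A small \<open>\<delta>\<close> lets the first term be moved to the other side of an
  estimate.\<close>

lemma power_young:
  fixes a b \<delta> :: real
  assumes "a \<ge> 0" "b \<ge> 0" "\<delta> > 0"
  shows "a ^ k * b \<le> \<delta> * a ^ Suc k + (1/\<delta>) ^ k * b ^ Suc k"
proof (cases "b \<le> \<delta> * a")
  case True
  then have "a ^ k * b \<le> a ^ k * (\<delta> * a)" using assms by (intro mult_left_mono) auto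
  then show ?thesis using assms by (simp add: mult_ac add_increasing2)
next
  case False
  then have "a \<le> (1/\<delta>) * b" using assms by (simp add: field_simps)
  then have "a ^ k * b \<le> ((1/\<delta>) * b) ^ k * b"
    using assms by (intro mult_right_mono power_mono) auto
  also have "\<dots> = (1/\<delta>) ^ k * b ^ Suc k" by (simp add: power_mult_distrib power_divide)
  finally show ?thesis using assms by (simp add: add_increasing)
qed

section \<open>Moments of martingales\<close>

text \<open>Conditional expectations enter through test functions: \<open>D_orth\<close> says that
  \<open>D j\<close> has conditional mean zero given \<open>Fs j\<close>, and \<open>D_var\<close>
  that \<open>v j\<close> dominates its conditional second moment. Only domination is asked, so that
  a convenient predictable majorant can be inserted.\<close>

locale martingale_differences = prob_space M for M :: "'a measure" +
  fixes Fs :: "nat \<Rightarrow> 'a measure" and D v :: "nat \<Rightarrow> 'a \<Rightarrow> real"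
  assumes sub: "\<And>j. subalgebra M (Fs j)"
    and mono: "\<And>i j. i \<le> j \<Longrightarrow> subalgebra (Fs j) (Fs i)"
    and D_meas: "\<And>j. bmeas (Fs (Suc j)) (D j)"
    and v_meas: "\<And>j. bmeas (Fs j) (v j)"
    and v_nonneg: "\<And>j x. 0 \<le> v j x"
    and D_orth: "\<And>j Z. bmeas (Fs j) Z \<Longrightarrow> expectation (\<lambda>x. Z x * D j x) = 0"
    and D_var: "\<And>j Z. bmeas (Fs j) Z \<Longrightarrow> (\<And>x. 0 \<le> Z x) \<Longrightarrow>
        expectation (\<lambda>x. Z x * (D j x)\<^sup>2) \<le> expectation (\<lambda>x. Z x * v j x)"
begin

definition psum :: "nat \<Rightarrow> 'a \<Rightarrow> real" where "psum k x = (\<Sum>j<k. D j x)"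

lemma psum_Suc: "psum (Suc k) x = psum k x + D k x"
  by (simp add: psum_def)

lemma psum_bmeas: "bmeas (Fs k) (psum k)"
proof -
  have "bmeas (Fs k) (\<lambda>x. \<Sum>j<k. D j x)"
  proof (rule bmeas_sum)
    fix j assume "j \<in> {..<k}"
    then show "bmeas (Fs k) (D j)"
      using D_meas[of j] mono[of "Suc j" k] bmeas_subalgebra by auto
  qed
  then show ?thesis by (simp add: psum_def[abs_def])
qed

lemma bmeas_Fs_M: "bmeas (Fs j) Z \<Longrightarrow> bmeas M Z"
  using sub bmeas_subalgebra by blast

lemmas bmeas_M = bmeas_Fs_M[OF psum_bmeas] bmeas_Fs_M[OF D_meas] bmeas_Fs_M[OF v_meas]

text \<open>Even powers of a martingale form a submartingale: the linear term of
  \<open>power_even_tangent\<close> integrates to zero, because \<open>Z\<close> and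
  \<open>psum l\<close> are both measurable for \<open>Fs l\<close>.\<close>

lemma psum_submartingale:
  assumes Z: "bmeas (Fs k) Z" "\<And>x. 0 \<le> Z x" and "k \<le> l"
  shows "expectation (\<lambda>x. Z x * psum k x ^ (2 * s)) \<le> expectation (\<lambda>x. Z x * psum l x ^ (2 * s))"
  using \<open>k \<le> l\<close>
proof (induction l rule: dec_induct)
  case (step l)
  have Zl: "bmeas (Fs l) Z" using Z(1) mono[OF step(1)] bmeas_subalgebra by blast
  have ZM: "bmeas M Z" using bmeas_Fs_M Z by blast
  have o: "expectation (\<lambda>x. (Z x * psum l x ^ (2 * s-1)) * D l x) = 0"
    by (rule D_orth) (intro bmeas_intros Zl psum_bmeas)
  have "expectation (\<lambda>x. Z x * psum l x ^ (2 * s))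
      = expectation (\<lambda>x. Z x * psum l x ^ (2 * s) + real (2 * s) * ((Z x * psum l x ^ (2 * s-1)) * D l x))"
    using o by (subst Bochner_Integration.integral_add, (intro bmeas_integrable bmeas_intros bmeas_M ZM; fail)+) (simp del: mult_Suc_right One_nat_def)
  also have "\<dots> \<le> expectation (\<lambda>x. Z x * psum (Suc l) x ^ (2 * s))"
  proof (rule integral_mono)
    fix x
    have "Z x * (psum l x ^ (2 * s) + real (2 * s) * (psum l x ^ (2 * s-1) * (psum (Suc l) x - psum l x)))
        \<le> Z x * psum (Suc l) x ^ (2 * s)"
      using Z(2) by (intro mult_left_mono power_even_tangent)
    then show "Z x * psum l x ^ (2 * s) + real (2 * s) * ((Z x * psum l x ^ (2 * s-1)) * D l x)
        \<le> Z x * psum (Suc l) x ^ (2 * s)"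
      by (simp add: psum_Suc algebra_simps)
  qed (intro bmeas_integrable bmeas_intros bmeas_M ZM)+
  finally show ?case using step by linarith
qed auto

lemma second_moment: "expectation (\<lambda>x. (psum N x)\<^sup>2) \<le> expectation (\<lambda>x. \<Sum>j<N. v j x)"
proof (induction N)
  case 0 then show ?case by (simp add: psum_def)
next
  case (Suc N)
  have o: "expectation (\<lambda>x. psum N x * D N x) = 0"
    by (rule D_orth) (rule psum_bmeas)
  have w: "expectation (\<lambda>x. 1 * (D N x)\<^sup>2) \<le> expectation (\<lambda>x. 1 * v N x)"
    by (rule D_var) auto
  have "expectation (\<lambda>x. (psum (Suc N) x)\<^sup>2)
      = expectation (\<lambda>x. (psum N x)\<^sup>2 + (2 * (psum N x * D N x) + (D N x)\<^sup>2))"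
    by (intro Bochner_Integration.integral_cong refl) (simp add: psum_Suc power2_sum)
  also have "\<dots> = expectation (\<lambda>x. (psum N x)\<^sup>2) + (2 * expectation (\<lambda>x. psum N x * D N x) + expectation (\<lambda>x. (D N x)\<^sup>2))"
    by (subst Bochner_Integration.integral_add Bochner_Integration.integral_mult_right, (intro bmeas_integrable bmeas_intros bmeas_M; fail)+)+ simp
  also have "\<dots> \<le> expectation (\<lambda>x. \<Sum>j<N. v j x) + expectation (v N)"
    using Suc o w by simp
  also have "\<dots> = expectation (\<lambda>x. \<Sum>j<Suc N. v j x)"
    by (simp, rule Bochner_Integration.integral_add[symmetric]) (intro bmeas_integrable bmeas_intros bmeas_M)+
  finally show ?case .
qed

text \<open>When \<open>psum (Suc k)\<close> is expanded around \<open>psum k\<close>, the linear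
  term vanishes and the quadratic one is governed by \<open>v k\<close>. The submartingale property
  replaces \<open>psum k\<close> there by \<open>psum N\<close>, so the sum over \<open>k\<close>
  becomes the total variance times a power of \<open>psum N\<close>, and \<open>power_young\<close>
  absorbs that power.\<close>

theorem rosenthal:
  assumes m: "m \<ge> 1"
  shows "expectation (\<lambda>x. psum N x ^ (2*m)) \<le>
     2 ^ ((2*m+1)*m) * (expectation (\<lambda>x. (\<Sum>j<N. v j x) ^ m) + (\<Sum>j<N. expectation (\<lambda>x. D j x ^ (2*m))))"
proof -
  let ?r = "2*m" let ?E = expectation
  let ?V = "\<lambda>x. \<Sum>j<N. v j x"
  have step: "?E (\<lambda>x. psum k x ^ ?r) \<le> 2 ^ ?r * (\<Sum>j<k. ?E (\<lambda>x. v j x * psum N x ^ (2*(m-1))) + ?E (\<lambda>x. D j x ^ ?r))"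
    if "k \<le> N" for k
    using that
  proof (induction k)
    case 0 then show ?case using m by (simp add: psum_def power_0_left)
  next
    case (Suc k)
    have o: "?E (\<lambda>x. psum k x ^ (?r-1) * D k x) = 0"
      by (rule D_orth) (intro bmeas_intros psum_bmeas)
    have w: "?E (\<lambda>x. psum k x ^ (2*(m-1)) * (D k x)\<^sup>2) \<le> ?E (\<lambda>x. psum k x ^ (2*(m-1)) * v k x)"
      by (rule D_var) (intro bmeas_intros psum_bmeas, simp add: zero_le_even_power)
    have s: "?E (\<lambda>x. v k x * psum k x ^ (2*(m-1))) \<le> ?E (\<lambda>x. v k x * psum N x ^ (2*(m-1)))"
      using Suc(2) by (intro psum_submartingale) (use v_meas v_nonneg in auto)
    have "?E (\<lambda>x. psum (Suc k) x ^ ?r) \<le> ?E (\<lambda>x. psum k x ^ ?r + (real ?r * (psum k x ^ (?r-1) * D k x)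
        + 2 ^ ?r * (psum k x ^ (2*(m-1)) * (D k x)\<^sup>2 + D k x ^ ?r)))"
    proof (rule integral_mono)
      fix x
      have "2*m - 2 = 2*(m-1)" by simp
      then show "psum (Suc k) x ^ ?r \<le> psum k x ^ ?r + (real ?r * (psum k x ^ (?r-1) * D k x)
        + 2 ^ ?r * (psum k x ^ (2*(m-1)) * (D k x)\<^sup>2 + D k x ^ ?r))"
        using power_add_even_le[OF m, of "psum k x" "D k x"] by (simp add: psum_Suc)
    qed (intro bmeas_integrable bmeas_intros bmeas_M)+
    also have "\<dots> = ?E (\<lambda>x. psum k x ^ ?r) + (real ?r * ?E (\<lambda>x. psum k x ^ (?r-1) * D k x)
        + 2 ^ ?r * (?E (\<lambda>x. psum k x ^ (2*(m-1)) * (D k x)\<^sup>2) + ?E (\<lambda>x. D k x ^ ?r)))"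
      by (subst Bochner_Integration.integral_add Bochner_Integration.integral_mult_right, (intro bmeas_integrable bmeas_intros bmeas_M; fail)+)+ simp
    also have "\<dots> \<le> ?E (\<lambda>x. psum k x ^ ?r) + 2 ^ ?r * (?E (\<lambda>x. v k x * psum N x ^ (2*(m-1))) + ?E (\<lambda>x. D k x ^ ?r))"
      using o w s by (simp add: mult.commute)
    finally show ?case using Suc by (simp add: algebra_simps)
  qed
  \<comment> \<open>With this \<open>\<delta>\<close> the factor \<open>2 ^ ?r\<close> turns the
    first term of \<open>power_young\<close> into half of the moment to be bounded, and that moment
    is finite because the increments are bounded. The other term brings the factor
    \<open>2 ^ ((2*m+1)*(m-1))\<close>.\<close>
  let ?\<delta> = "(1/2) ^ (?r + 1) :: real"
  have "(\<Sum>j<N. ?E (\<lambda>x. v j x * psum N x ^ (2*(m-1)))) = ?E (\<lambda>x. (psum N x)\<^sup>2 ^ (m-1) * ?V x)"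
    by (subst Bochner_Integration.integral_sum[symmetric])
       ((intro bmeas_integrable bmeas_intros bmeas_M; fail) | (intro Bochner_Integration.integral_cong refl, simp add: sum_distrib_right mult.commute flip: power_mult))+
  also have "\<dots> \<le> ?E (\<lambda>x. ?\<delta> * psum N x ^ ?r + (1/?\<delta>) ^ (m-1) * ?V x ^ m)"
  proof (rule integral_mono)
    fix x
    show "(psum N x)\<^sup>2 ^ (m-1) * ?V x \<le> ?\<delta> * psum N x ^ ?r + (1/?\<delta>) ^ (m-1) * ?V x ^ m"
      using power_young[of "(psum N x)\<^sup>2" "?V x" ?\<delta> "m-1"] m
      by (simp add: v_nonneg sum_nonneg power_mult del: power_Suc)
  qed (intro bmeas_integrable bmeas_intros bmeas_M)+
  also have "\<dots> = ?\<delta> * ?E (\<lambda>x. psum N x ^ ?r) + (1/?\<delta>) ^ (m-1) * ?E (\<lambda>x. ?V x ^ m)"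
    by (subst Bochner_Integration.integral_add Bochner_Integration.integral_mult_right, (intro bmeas_integrable bmeas_intros bmeas_M; fail)+)+ simp
  finally have A: "(\<Sum>j<N. ?E (\<lambda>x. v j x * psum N x ^ (2*(m-1)))) \<le> \<dots>" .
  have D0: "(\<Sum>j<N. ?E (\<lambda>x. D j x ^ ?r)) \<ge> 0"
    by (intro sum_nonneg integral_nonneg_AE AE_I2) (auto simp: zero_le_even_power)
  let ?\<phi> = "?E (\<lambda>x. psum N x ^ ?r)" and ?d = "\<Sum>j<N. ?E (\<lambda>x. D j x ^ ?r)"
  have "?\<phi> \<le> 2 ^ ?r * (?\<delta> * ?\<phi> + (1/?\<delta>) ^ (m-1) * ?E (\<lambda>x. ?V x ^ m) + ?d)"
    using step[of N] A by (simp add: sum.distrib) (smt (verit) mult_left_mono zero_le_power)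
  also have "\<dots> = ?\<phi> / 2 + 2 ^ ?r * ((1/?\<delta>) ^ (m-1) * ?E (\<lambda>x. ?V x ^ m) + ?d)"
    by (simp add: algebra_simps power_divide)
  finally have calc: "?\<phi> \<le> ?\<phi> / 2 + 2 ^ ?r * ((1/?\<delta>) ^ (m-1) * ?E (\<lambda>x. ?V x ^ m) + ?d)" .
  have one: "1 \<le> (1/?\<delta>) ^ (m-1)"
  proof (rule one_le_power)
    have "1/?\<delta> = 2 ^ (?r + 1)" by (simp add: power_divide)
    then show "1 \<le> 1/?\<delta>" by (simp only: one_le_power one_le_numeral)
  qed
  from calc have "?\<phi> \<le> 2 * 2 ^ ?r * ((1/?\<delta>) ^ (m-1) * ?E (\<lambda>x. ?V x ^ m) + ?d)" by simp
  also have "\<dots> \<le> 2 * 2 ^ ?r * ((1/?\<delta>) ^ (m-1) * ?E (\<lambda>x. ?V x ^ m) + (1/?\<delta>) ^ (m-1) * ?d)"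
    using mult_right_mono[OF one D0] by simp
  also have "\<dots> = (2 * 2 ^ ?r * (1/?\<delta>) ^ (m-1)) * (?E (\<lambda>x. ?V x ^ m) + ?d)"
    by (simp add: algebra_simps)
  also have "2 * 2 ^ ?r * (1/?\<delta>) ^ (m-1) = (2::real) ^ ((2*m+1) + (2*m+1)*(m-1))"
    by (simp add: power_add power_mult power_divide)
  also have "(2*m+1) + (2*m+1)*(m-1) = (2*m+1)*m" using m by (cases m) auto
  finally show ?thesis .
qed

end

section \<open>Dependent sequences and blocks\<close>

lemma bmeas_sgn [intro]:
  assumes "bmeas F f" shows "bmeas F (\<lambda>x. sgn (f x) :: real)"
proof -
  have [measurable]: "f \<in> borel_measurable F" using assms by (rule bmeas_measurable)
  show ?thesis by (rule bmeasI[of _ _ 1]) (auto simp: sgn_real_def)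
qed

text \<open>A conditional expectation inherits the bound \<open>K\<close> only almost everywhere.
  Clipping it to the interval from \<open>-K\<close> to \<open>K\<close> changes no integral and
  gives a version bounded everywhere, as \<open>bmeas\<close> demands.\<close>

lemma (in prob_space) bounded_cond_exp:
  assumes F: "subalgebra M F" and f: "bmeas M f" and K: "\<And>x. \<bar>f x\<bar> \<le> K"
  obtains g where "bmeas F g" "\<And>x. \<bar>g x\<bar> \<le> K"
    "\<And>Z. bmeas F Z \<Longrightarrow> expectation (\<lambda>x. Z x * g x) = expectation (\<lambda>x. Z x * f x)"
    "AE x in M. real_cond_exp M F f x = g x"
proof -
  interpret finite_measure_subalgebra M F
    by (simp add: F finite_measure_axioms finite_measure_subalgebra_axioms_def finite_measure_subalgebra_def)
  define g where "g x = max (- K) (min K (real_cond_exp M F f x))" for x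
  have K0: "K \<ge> 0" using K[of undefined] by linarith
  have g: "bmeas F g"
    unfolding g_def[abs_def] by (rule bmeasI[of _ _ K]) (use K0 in auto)
  have int: "integrable M f" using f by (rule bmeas_integrable)
  have u: "AE x in M. real_cond_exp M F f x \<le> K"
    by (rule real_cond_exp_le_c[OF int]) (use K in \<open>auto simp: abs_le_iff\<close>)
  have l: "AE x in M. - K \<le> real_cond_exp M F f x"
    by (rule real_cond_exp_ge_c[OF int]) (use K in \<open>auto simp: abs_le_iff minus_le_iff\<close>)
  have ae: "AE x in M. real_cond_exp M F f x = g x"
    using u l by eventually_elim (auto simp: g_def)
  have [measurable]: "f \<in> borel_measurable M" "g \<in> borel_measurable M"
    using f g F by (auto intro: bmeas_measurable bmeas_subalgebra)
  have "expectation (\<lambda>x. Z x * g x) = expectation (\<lambda>x. Z x * f x)" if Z: "bmeas F Z" for Z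
  proof -
    have ZM: "bmeas M Z" using Z F bmeas_subalgebra by blast
    have [measurable]: "Z \<in> borel_measurable M" "Z \<in> borel_measurable F"
      using Z ZM by (auto intro: bmeas_measurable)
    have [measurable]: "real_cond_exp M F f \<in> borel_measurable M"
      by (rule borel_measurable_cond_exp2)
    have "expectation (\<lambda>x. Z x * g x) = expectation (\<lambda>x. Z x * real_cond_exp M F f x)"
      by (rule integral_cong_AE) (use ae in auto)
    also have "\<dots> = expectation (\<lambda>x. Z x * f x)"
      by (rule real_cond_exp_intg) (auto intro!: bmeas_integrable bmeas_mult ZM f)
    finally show ?thesis .
  qed
  then show ?thesis using that[OF g _ _ ae] K0 by (auto simp: g_def)
qed

lemma power_add_le:
  fixes a b :: real
  assumes "a \<ge> 0" "b \<ge> 0" shows "(a + b) ^ k \<le> 2 ^ k * (a ^ k + b ^ k)"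
proof -
  have "(a + b) ^ k \<le> (2 * max a b) ^ k" using assms by (intro power_mono) auto
  also have "\<dots> = 2 ^ k * max a b ^ k" by (simp add: power_mult_distrib)
  also have "max a b ^ k \<le> a ^ k + b ^ k"
    using assms by (cases "a \<le> b") (auto simp: max_def)
  finally show ?thesis by simp
qed

lemma power_add_even_le2:
  fixes a b :: real
  shows "(a + b) ^ (2*m) \<le> 2 ^ (2*m) * (a ^ (2*m) + b ^ (2*m))"
proof -
  have "(a + b) ^ (2*m) = \<bar>a + b\<bar> ^ (2*m)" by (simp add: power_even_abs)
  also have "\<dots> \<le> (\<bar>a\<bar> + \<bar>b\<bar>) ^ (2*m)" by (intro power_mono) auto
  also have "\<dots> \<le> 2 ^ (2*m) * (\<bar>a\<bar> ^ (2*m) + \<bar>b\<bar> ^ (2*m))" by (rule power_add_le) auto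
  finally show ?thesis by (simp add: power_even_abs)
qed

text \<open>The coefficients \<open>g1\<close> and \<open>g2\<close> stand for \<open>min \<alpha>\<^sub>1 h\<close> and \<open>min \<alpha>\<^sub>2 h\<close>.\<close>

locale dependent_sequence = prob_space M for M :: "'a measure" +
  fixes Fk :: "nat \<Rightarrow> 'a measure" and Y :: "nat \<Rightarrow> 'a \<Rightarrow> real" and g1 g2 :: "nat \<Rightarrow> real"
  assumes sub: "\<And>k. subalgebra M (Fk k)"
    and mono: "\<And>i j. i \<le> j \<Longrightarrow> subalgebra (Fk j) (Fk i)"
    and Y_bmeas: "\<And>k. bmeas (Fk k) (Y k)"
    and Y_le: "\<And>k x. \<bar>Y k x\<bar> \<le> 1"
    and g1_nonneg: "\<And>k. 0 \<le> g1 k"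
    and g2_nonneg: "\<And>k. 0 \<le> g2 k"
    and g2_antimono: "\<And>i j. i \<le> j \<Longrightarrow> g2 j \<le> g2 i"
    and cov: "\<And>k d. \<bar>expectation (\<lambda>x. Y k x * Y (k + d) x)\<bar> \<le> 2 * g1 d"
    and coef1: "\<And>k a Z. bmeas (Fk k) Z \<Longrightarrow> (\<And>x. \<bar>Z x\<bar> \<le> 1) \<Longrightarrow>
        expectation (\<lambda>x. Z x * Y (k + a) x) \<le> 2 * g2 a"
    and coef2: "\<And>k q a b Z. bmeas (Fk k) Z \<Longrightarrow> (\<And>x. \<bar>Z x\<bar> \<le> 1) \<Longrightarrow> q \<le> a \<Longrightarrow> a \<le> b \<Longrightarrow>
        expectation (\<lambda>x. Z x * (Y (k + a) x * Y (k + b) x - expectation (\<lambda>x. Y (k + a) x * Y (k + b) x))) \<le> 4 * g2 q"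
    and stationary_moments: "\<And>s l r. expectation (\<lambda>x. (\<Sum>k<l. Y (s + k) x) ^ r) = expectation (\<lambda>x. (\<Sum>k<l. Y k x) ^ r)"
begin

lemma Y_bmeas_M: "bmeas M (Y k)"
  using sub Y_bmeas bmeas_subalgebra by blast

lemma bmeas_mono: "bmeas (Fk i) Z \<Longrightarrow> i \<le> j \<Longrightarrow> bmeas (Fk j) Z"
  using mono bmeas_subalgebra by blast

definition psums :: "nat \<Rightarrow> nat \<Rightarrow> 'a \<Rightarrow> real" where
  "psums s l x = (\<Sum>k<l. Y (s + k) x)"

definition moment :: "nat \<Rightarrow> nat \<Rightarrow> real" where
  "moment r l = expectation (\<lambda>x. (\<Sum>k<l. Y k x) ^ r)"

lemma psums_add: "psums s a x + psums (s + a) b x = psums s (a + b) x"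
  by (induction b) (simp_all add: psums_def add.assoc)

lemma psums_bmeas: "s + l \<le> Suc t \<Longrightarrow> bmeas (Fk t) (psums s l)"
  unfolding psums_def[abs_def] by (intro bmeas_sum bmeas_mono[OF Y_bmeas]) auto

lemma psums_bmeas_M: "bmeas M (psums s l)"
  unfolding psums_def[abs_def] by (intro bmeas_sum Y_bmeas_M)

lemma psums_le: "\<bar>psums s l x\<bar> \<le> real l"
proof -
  have "\<bar>psums s l x\<bar> \<le> (\<Sum>k<l. 1)"
    unfolding psums_def by (intro order_trans[OF sum_abs] sum_mono Y_le)
  then show ?thesis by simp
qed

lemma moment_psums: "expectation (\<lambda>x. psums s l x ^ r) = moment r l"
  unfolding moment_def psums_def by (rule stationary_moments)

lemma moment_even_nonneg: "moment (2*m) l \<ge> 0"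
  unfolding moment_def by (intro integral_nonneg_AE AE_I2) (simp add: zero_le_even_power)

lemma cov': "\<bar>expectation (\<lambda>x. Y i x * Y j x)\<bar> \<le> 2 * g1 (if i \<le> j then j - i else i - j)"
  using cov[of i "j - i"] cov[of j "i - j"] by (auto simp: mult.commute)

text \<open>Each distance \<open>d < l\<close> is attained by at most one \<open>j\<close> on either
  side of \<open>i\<close>.\<close>

lemma sum_g1_le: "i < l \<Longrightarrow> (\<Sum>j<l. g1 (if i \<le> j then j - i else i - j)) \<le> 2 * (\<Sum>d<l. g1 d)"
proof -
  assume i: "i < l"
  have "(\<Sum>j<l. g1 (if i \<le> j then j - i else i - j))
      = (\<Sum>j\<in>{i..<l}. g1 (j - i)) + (\<Sum>j\<in>{..<i}. g1 (i - j))"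
  proof -
    let ?f = "\<lambda>j. g1 (if i \<le> j then j - i else i - j)"
    have "sum ?f {0..<i} + sum ?f {i..<l} = sum ?f {0..<l}"
      using i by (intro sum.atLeastLessThan_concat) auto
    moreover have "sum ?f {0..<i} = (\<Sum>j\<in>{..<i}. g1 (i - j))"
      unfolding lessThan_atLeast0 by (intro sum.cong) auto
    moreover have "sum ?f {i..<l} = (\<Sum>j\<in>{i..<l}. g1 (j - i))"
      by (intro sum.cong) auto
    ultimately show ?thesis by (simp only: lessThan_atLeast0)
  qed
  also have "(\<Sum>j\<in>{i..<l}. g1 (j - i)) = (\<Sum>d\<in>(\<lambda>j. j - i) ` {i..<l}. g1 d)"
    by (subst sum.reindex) (auto simp: inj_on_def)
  also have "\<dots> \<le> (\<Sum>d<l. g1 d)"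
    by (intro sum_mono2) (auto simp: g1_nonneg)
  also have "(\<Sum>j\<in>{..<i}. g1 (i - j)) = (\<Sum>d\<in>(\<lambda>j. i - j) ` {..<i}. g1 d)"
    by (subst sum.reindex) (auto simp: inj_on_def)
  also have "\<dots> \<le> (\<Sum>d<l. g1 d)"
    using i by (intro sum_mono2) (auto simp: g1_nonneg)
  finally show ?thesis by simp
qed

lemma second_moment_le: "moment 2 l \<le> 4 * real l * (\<Sum>d<l. g1 d)"
proof -
  have "moment 2 l = expectation (\<lambda>x. \<Sum>i<l. \<Sum>j<l. Y i x * Y j x)"
    unfolding moment_def by (simp add: power2_eq_square sum_product)
  also have "\<dots> = (\<Sum>i<l. \<Sum>j<l. expectation (\<lambda>x. Y i x * Y j x))"
    by (subst Bochner_Integration.integral_sum | (intro bmeas_integrable bmeas_intros Y_bmeas_M; fail) | rule sum.cong refl)+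
  also have "\<dots> \<le> (\<Sum>i<l. \<Sum>j<l. 2 * g1 (if i \<le> j then j - i else i - j))"
    by (intro sum_mono order_trans[OF abs_ge_self cov'])
  also have "\<dots> = (\<Sum>i<l. 2 * (\<Sum>j<l. g1 (if i \<le> j then j - i else i - j)))"
    by (simp only: sum_distrib_left)
  also have "\<dots> \<le> (\<Sum>i<l. 2 * (2 * (\<Sum>d<l. g1 d)))"
    by (intro sum_mono mult_left_mono sum_g1_le) auto
  finally show ?thesis by simp
qed

text \<open>\<open>coef1\<close> at lag 0, tested against the sign of \<open>Y k\<close> itself,
  which is measurable at time \<open>k\<close>.\<close>

lemma abs_expectation_Y_le: "expectation (\<lambda>x. \<bar>Y k x\<bar>) \<le> 2 * g2 0"
proof -
  have "expectation (\<lambda>x. sgn (Y k x) * Y (k + 0) x) \<le> 2 * g2 0"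
    by (rule coef1) (intro bmeas_sgn Y_bmeas, simp add: sgn_real_def)
  then show ?thesis by (simp add: linordered_idom_class.abs_sgn mult.commute)
qed

lemma abs_expectation_psums_le: "expectation (\<lambda>x. \<bar>psums s l x\<bar>) \<le> 2 * real l * g2 0"
proof -
  have "expectation (\<lambda>x. \<bar>psums s l x\<bar>) \<le> expectation (\<lambda>x. \<Sum>k<l. \<bar>Y (s + k) x\<bar>)"
    by (intro integral_mono bmeas_integrable bmeas_intros psums_bmeas_M Y_bmeas_M)
       (simp add: psums_def sum_abs)
  also have "\<dots> = (\<Sum>k<l. expectation (\<lambda>x. \<bar>Y (s + k) x\<bar>))"
    by (intro Bochner_Integration.integral_sum bmeas_integrable bmeas_intros Y_bmeas_M)
  also have "\<dots> \<le> (\<Sum>k<l. 2 * g2 0)" by (intro sum_mono abs_expectation_Y_le)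
  finally show ?thesis by simp
qed

end

text \<open>The outer power comes from adding the two parities, the next one from
  \<open>rosenthal\<close>. The three summands in the bracket belong to the deterministic variance,
  to the stopped random variance and to the moments of the centred blocks.\<close>

definition block_const :: "nat \<Rightarrow> real" where
  "block_const m = 2 ^ (2*m+1) * (2 ^ ((2*m+1)*m) * (2 ^ m * 2 * 4 ^ m + 2 ^ m * 8 + 2 ^ (4*m+2)))"

lemma block_const_pos: "block_const m > 0"
  unfolding block_const_def by (intro mult_pos_pos add_pos_pos) auto

section \<open>Blocks and their conditional moments\<close>

text \<open>The \<open>n\<close> terms starting at time \<open>s\<close> are cut into blocks of
  length \<open>q\<close>; truncated subtraction in \<open>len\<close> makes the last block shorter
  and all later ones empty. The time of \<open>G i\<close> lies \<open>q\<close> steps before the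
  start of block \<open>i\<close>, and \<open>q \<le> s\<close> keeps it from being truncated at
  0.\<close>

locale block_decomposition = dependent_sequence +
  fixes m n q s :: nat
  assumes m: "m \<ge> 1" and q: "1 \<le> q" "q \<le> n" and s: "q \<le> s"
begin

definition len :: "nat \<Rightarrow> nat" where "len i = min q (n - i * q)"
definition U :: "nat \<Rightarrow> 'a \<Rightarrow> real" where "U i = psums (s + i * q) (len i)"
definition G :: "nat \<Rightarrow> 'a measure" where "G i = Fk (s - q + i * q)"

lemma len_le: "len i \<le> q" by (simp add: len_def)

lemma sum_len: "(\<Sum>i<K. len i) = min n (K * q)"
  by (induction K) (auto simp: len_def min_def)

lemma sum_U: "(\<Sum>i<K. U i x) = psums s (min n (K * q)) x"
proof (induction K)
  case 0 then show ?case by (simp add: psums_def)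
next
  case (Suc K)
  have "psums s (min n (K * q)) x + U K x = psums s (min n (K * q) + len K) x"
  proof (cases "K * q \<le> n")
    case True
    then show ?thesis by (simp add: U_def min_absorb2 psums_add)
  next
    case False then show ?thesis by (simp add: U_def len_def psums_def)
  qed
  moreover have "min n (K * q) + len K = min n (Suc K * q)" by (auto simp: len_def)
  ultimately show ?case using Suc by simp
qed

lemma G_sub: "subalgebra M (G i)" unfolding G_def by (rule sub)
lemma G_mono: "i \<le> j \<Longrightarrow> subalgebra (G j) (G i)" unfolding G_def by (intro mono) simp
text \<open>Block \<open>i\<close> ends before time \<open>s + (i + 1) * q\<close>, which is the
  time of \<open>G (i + 2)\<close>. It is thus adapted two steps after \<open>G i\<close> and not
  one, which is why the parities have to be separated.\<close>

lemma U_bmeas: "bmeas (G (i + 2)) (U i)"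
proof -
  have "s - q + (i + 2) * q = s + i * q + q" using s by simp
  then show ?thesis unfolding U_def G_def using len_le[of i] by (intro psums_bmeas) simp
qed
lemma U_bmeas_M: "bmeas M (U i)" unfolding U_def by (rule psums_bmeas_M)
lemma U_le: "\<bar>U i x\<bar> \<le> real q"
  unfolding U_def using psums_le[of "s + i*q" "len i" x] len_le[of i] by linarith

lemma U_eq: "U i x = (\<Sum>k<len i. Y ((s - q + i * q) + (q + k)) x)"
  unfolding U_def psums_def using s by (intro sum.cong refl arg_cong[where f="\<lambda>j. Y j x"]) simp

lemma U_second_moment: "expectation (\<lambda>x. (U i x)\<^sup>2) \<le> 4 * real (len i) * (\<Sum>d<n. g1 d)"
proof -
  have "expectation (\<lambda>x. (U i x)\<^sup>2) \<le> 4 * real (len i) * (\<Sum>d<len i. g1 d)"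
    unfolding U_def using second_moment_le moment_psums by simp
  also have "\<dots> \<le> 4 * real (len i) * (\<Sum>d<n. g1 d)"
    using len_le[of i] q by (intro mult_left_mono sum_mono2) (auto simp: g1_nonneg)
  finally show ?thesis .
qed

lemma U_coef1:
  assumes "bmeas (G i) Z" "\<And>x. \<bar>Z x\<bar> \<le> 1"
  shows "expectation (\<lambda>x. Z x * U i x) \<le> 2 * real q * g2 q"
proof -
  have ZM: "bmeas M Z" using assms(1) G_sub bmeas_subalgebra by blast
  have "expectation (\<lambda>x. Z x * U i x) = (\<Sum>k<len i. expectation (\<lambda>x. Z x * Y ((s - q + i * q) + (q + k)) x))"
    unfolding U_eq sum_distrib_left
    by (intro Bochner_Integration.integral_sum bmeas_integrable bmeas_intros Y_bmeas_M ZM)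
  also have "\<dots> \<le> (\<Sum>k<len i. 2 * g2 q)"
  proof (rule sum_mono)
    fix k
    have "expectation (\<lambda>x. Z x * Y ((s - q + i * q) + (q + k)) x) \<le> 2 * g2 (q + k)"
      using assms by (intro coef1) (auto simp: G_def)
    also have "\<dots> \<le> 2 * g2 q" using g2_antimono[of q "q + k"] by simp
    finally show "expectation (\<lambda>x. Z x * Y ((s - q + i * q) + (q + k)) x) \<le> 2 * g2 q" .
  qed
  also have "\<dots> = 2 * real (len i) * g2 q" by simp
  also have "\<dots> \<le> 2 * real q * g2 q"
    using len_le[of i] by (intro mult_right_mono g2_nonneg) auto
  finally show ?thesis .
qed

text \<open>Squaring the block produces at most \<open>q * q\<close> products, each of two variables
  at lag at least \<open>q\<close> from the time of \<open>G i\<close>. For \<open>k > l\<close> the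
  factors are exchanged to fit the order required by \<open>coef2\<close>.\<close>

lemma U_coef2:
  assumes "bmeas (G i) Z" "\<And>x. \<bar>Z x\<bar> \<le> 1"
  shows "expectation (\<lambda>x. Z x * ((U i x)\<^sup>2 - expectation (\<lambda>x. (U i x)\<^sup>2))) \<le> 4 * (real q)\<^sup>2 * g2 q"
proof -
  have ZM: "bmeas M Z" using assms(1) G_sub bmeas_subalgebra by blast
  let ?y = "\<lambda>k. Y ((s - q + i * q) + (q + k))"
  let ?c = "\<lambda>k l. expectation (\<lambda>x. ?y k x * ?y l x)"
  have sq: "(U i x)\<^sup>2 = (\<Sum>k<len i. \<Sum>l<len i. ?y k x * ?y l x)" for x
    unfolding U_eq by (simp add: power2_eq_square sum_product)
  have "expectation (\<lambda>x. (U i x)\<^sup>2) = (\<Sum>k<len i. \<Sum>l<len i. ?c k l)"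
    unfolding sq
    by (subst Bochner_Integration.integral_sum | (intro bmeas_integrable bmeas_intros Y_bmeas_M; fail) | rule sum.cong refl)+
  then have "expectation (\<lambda>x. Z x * ((U i x)\<^sup>2 - expectation (\<lambda>x. (U i x)\<^sup>2)))
      = expectation (\<lambda>x. \<Sum>k<len i. \<Sum>l<len i. Z x * (?y k x * ?y l x - ?c k l))"
    unfolding sq by (simp add: sum_distrib_left sum_subtractf right_diff_distrib)
  also have "\<dots> = (\<Sum>k<len i. \<Sum>l<len i. expectation (\<lambda>x. Z x * (?y k x * ?y l x - ?c k l)))"
    by (subst Bochner_Integration.integral_sum | (intro bmeas_integrable bmeas_intros Y_bmeas_M ZM; fail) | rule sum.cong refl)+
  also have "\<dots> \<le> (\<Sum>k<len i. \<Sum>l<len i. 4 * g2 q)"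
  proof (intro sum_mono)
    fix k l
    show "expectation (\<lambda>x. Z x * (?y k x * ?y l x - ?c k l)) \<le> 4 * g2 q"
    proof (cases "k \<le> l")
      case True
      then show ?thesis using assms by (intro coef2) (auto simp: G_def)
    next
      case False
      have "expectation (\<lambda>x. Z x * (?y l x * ?y k x - ?c l k)) \<le> 4 * g2 q"
        using False assms by (intro coef2) (auto simp: G_def)
      then show ?thesis by (simp add: mult.commute[of "?y k _"])
    qed
  qed
  also have "\<dots> = 4 * (real (len i) * real (len i)) * g2 q" by simp
  also have "\<dots> \<le> 4 * (real q)\<^sup>2 * g2 q"
    unfolding power2_eq_square
    using len_le[of i] by (intro mult_right_mono mult_left_mono mult_mono g2_nonneg) auto
  finally show ?thesis .
qed

end

context block_decomposition
begin

text \<open>\<open>c i\<close> and \<open>w i\<close> are bounded versions of the conditional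
  expectations given \<open>G i\<close> of the block and of its centred square. So
  \<open>w i\<close> is the random part of the conditional second moment.\<close>

lemma predictable_parts:
  obtains c w where "\<And>i. bmeas (G i) (c i)" "\<And>i x. \<bar>c i x\<bar> \<le> real q"
    "\<And>i Z. bmeas (G i) Z \<Longrightarrow> expectation (\<lambda>x. Z x * c i x) = expectation (\<lambda>x. Z x * U i x)"
    "\<And>i. bmeas (G i) (w i)"
    "\<And>i Z. bmeas (G i) Z \<Longrightarrow> expectation (\<lambda>x. Z x * w i x)
        = expectation (\<lambda>x. Z x * ((U i x)\<^sup>2 - expectation (\<lambda>x. (U i x)\<^sup>2)))"
proof -
  have "\<exists>g. bmeas (G i) g \<and> (\<forall>x. \<bar>g x\<bar> \<le> real q) \<and>
    (\<forall>Z. bmeas (G i) Z \<longrightarrow> expectation (\<lambda>x. Z x * g x) = expectation (\<lambda>x. Z x * U i x))" for i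
  proof (rule bounded_cond_exp[OF G_sub[of i] U_bmeas_M[of i] U_le[of i]])
    fix g assume "bmeas (G i) g" "\<And>x. \<bar>g x\<bar> \<le> real q"
      "\<And>Z. bmeas (G i) Z \<Longrightarrow> expectation (\<lambda>x. Z x * g x) = expectation (\<lambda>x. Z x * U i x)"
    then show ?thesis by (intro exI[of _ g]) simp
  qed
  then obtain c where c: "\<And>i. bmeas (G i) (c i) \<and> (\<forall>x. \<bar>c i x\<bar> \<le> real q) \<and>
    (\<forall>Z. bmeas (G i) Z \<longrightarrow> expectation (\<lambda>x. Z x * c i x) = expectation (\<lambda>x. Z x * U i x))"
    by metis
  have "\<exists>g. bmeas (G i) g \<and>
    (\<forall>Z. bmeas (G i) Z \<longrightarrow> expectation (\<lambda>x. Z x * g x)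
       = expectation (\<lambda>x. Z x * ((U i x)\<^sup>2 - expectation (\<lambda>x. (U i x)\<^sup>2))))" for i
  proof -
    have b: "bmeas M (\<lambda>x. (U i x)\<^sup>2 - expectation (\<lambda>x. (U i x)\<^sup>2))"
      by (intro bmeas_intros U_bmeas_M)
    obtain K where K: "\<And>x. \<bar>(U i x)\<^sup>2 - expectation (\<lambda>x. (U i x)\<^sup>2)\<bar> \<le> K"
      using b by (metis bmeasE)
    show ?thesis
    proof (rule bounded_cond_exp[OF G_sub[of i] b K])
      fix g assume "bmeas (G i) g" "\<And>Z. bmeas (G i) Z \<Longrightarrow> expectation (\<lambda>x. Z x * g x)
         = expectation (\<lambda>x. Z x * ((U i x)\<^sup>2 - expectation (\<lambda>x. (U i x)\<^sup>2)))"
      then show ?thesis by (intro exI[of _ g]) simp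
    qed
  qed
  then have "\<exists>w. \<forall>i. bmeas (G i) (w i) \<and>
    (\<forall>Z. bmeas (G i) Z \<longrightarrow> expectation (\<lambda>x. Z x * w i x)
       = expectation (\<lambda>x. Z x * ((U i x)\<^sup>2 - expectation (\<lambda>x. (U i x)\<^sup>2))))"
    by (intro choice allI)
  then obtain w where w': "\<forall>i. bmeas (G i) (w i) \<and>
    (\<forall>Z. bmeas (G i) Z \<longrightarrow> expectation (\<lambda>x. Z x * w i x)
       = expectation (\<lambda>x. Z x * ((U i x)\<^sup>2 - expectation (\<lambda>x. (U i x)\<^sup>2))))"
    by (elim exE)
  show ?thesis
    by (rule that[OF c[THEN conjunct1] c[THEN conjunct2, THEN conjunct1, rule_format]
          c[THEN conjunct2, THEN conjunct2, rule_format] w'[THEN spec, THEN conjunct1] w'[THEN spec, THEN conjunct2, rule_format]])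
qed

lemma bmeas_G_M: "bmeas (G i) Z \<Longrightarrow> bmeas M Z"
  using G_sub bmeas_subalgebra by blast

lemma bmeas_G_mono: "bmeas (G i) Z \<Longrightarrow> i \<le> j \<Longrightarrow> bmeas (G j) Z"
  using G_mono bmeas_subalgebra by blast

end

section \<open>Stopping at a level of the conditional variance\<close>

text \<open>The test at index \<open>j\<close> already includes \<open>w j\<close>, so the stopped
  sum never overshoots \<open>\<kappa>\<close>.\<close>

lemma sum_stopped_le:
  fixes w :: "nat \<Rightarrow> real"
  assumes "\<And>i. 0 \<le> w i" "0 \<le> \<kappa>"
  shows "(\<Sum>j<N. if (\<Sum>i\<le>j. w i) \<le> \<kappa> then w j else 0) \<le> min \<kappa> (\<Sum>j<N. w j)"
proof (induction N)
  case 0 then show ?case using assms by simp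
next
  case (Suc N)
  show ?case
  proof (cases "(\<Sum>i\<le>N. w i) \<le> \<kappa>")
    case True
    have "(\<Sum>j<N. if (\<Sum>i\<le>j. w i) \<le> \<kappa> then w j else 0) \<le> (\<Sum>j<N. w j)" using Suc by simp
    then show ?thesis using True by (simp add: lessThan_Suc_atMost[symmetric])
  next
    case False
    then show ?thesis using Suc assms(1)[of N] by simp
  qed
qed

text \<open>Blocks of one parity, centred by their conditional expectations, are martingale differences
  whose conditional variances are \<open>v\<close>. Stopping them when the random part \<open>\<Sum>w\<close> of the total
  conditional variance exceeds \<open>\<kappa>\<close> separates a term controlled in a high moment from one controlled in mean.\<close>

lemma (in prob_space) stopped_martingale:
  fixes D w :: "nat \<Rightarrow> 'a \<Rightarrow> real" and e :: "nat \<Rightarrow> real"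
  assumes "\<And>j. subalgebra M (Fs j)"
    and "\<And>i j. i \<le> j \<Longrightarrow> subalgebra (Fs j) (Fs i)"
    and D: "\<And>j. bmeas (Fs (Suc j)) (D j)"
    and w: "\<And>j. bmeas (Fs j) (w j)" and w0: "\<And>j x. 0 \<le> w j x" and e0: "\<And>j. 0 \<le> e j"
    and orth: "\<And>j Z. bmeas (Fs j) Z \<Longrightarrow> expectation (\<lambda>x. Z x * D j x) = 0"
    and var: "\<And>j Z. bmeas (Fs j) Z \<Longrightarrow> (\<And>x. 0 \<le> Z x) \<Longrightarrow>
        expectation (\<lambda>x. Z x * (D j x)\<^sup>2) \<le> expectation (\<lambda>x. Z x * (e j + w j x))"
    and V: "(\<Sum>j<N. e j) \<le> V" "V \<ge> 0" and W: "expectation (\<lambda>x. \<Sum>j<N. w j x) \<le> W"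
    and m: "m \<ge> 1" and qpos: "q > (0::real)"
    and Dm: "(\<Sum>j<N. expectation (\<lambda>x. D j x ^ (2*m))) \<le> \<Delta>"
  obtains A B where "bmeas M A" "bmeas M B" "\<And>x. (\<Sum>j<N. D j x) = A x + B x"
    "expectation (\<lambda>x. A x ^ (2*m)) \<le> 2 ^ ((2*m+1)*m) * (2 ^ m * (2 * V ^ m + q ^ (2*m-2) * W) + \<Delta>)"
    "expectation (\<lambda>x. \<bar>B x\<bar>) \<le> 3/2 * W / q"
proof -
  \<comment> \<open>Both entries of the maximum are used. \<open>V \<le> \<kappa>\<close> makes the
    deterministic variance smaller than \<open>Q\<close> wherever stopping occurs, and
    \<open>q ^ 2 \<le> \<kappa>\<close> makes \<open>Q / q\<close> at least \<open>q\<close> there,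
    so that a second moment of the stopped-off part yields a first moment.\<close>
  define \<kappa> where "\<kappa> = max (q\<^sup>2) V"
  define P where "P j x = (\<Sum>i\<le>j. w i x)" for j x
  define \<theta> where "\<theta> j x = (if P j x \<le> \<kappa> then 1 else (0::real))" for j x
  define \<theta>' where "\<theta>' j x = 1 - \<theta> j x" for j x
  define Q where "Q x = (\<Sum>j<N. w j x)" for x
  note sub = assms(1) and mono = assms(2)
  have DM: "bmeas M (D j)" for j using D sub bmeas_subalgebra by blast
  have wM: "bmeas M (w j)" for j using w sub bmeas_subalgebra by blast
  have "bmeas (Fs j) (P j)" for j
    unfolding P_def[abs_def]
    by (intro bmeas_sum bmeas_subalgebra[OF mono w]) auto
  then have \<theta>: "bmeas (Fs j) (\<theta> j)" for j
    unfolding \<theta>_def[abs_def] by (intro bmeas_intros)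
  have \<theta>': "bmeas (Fs j) (\<theta>' j)" for j
    unfolding \<theta>'_def[abs_def] by (intro bmeas_intros \<theta>)
  have \<theta>M: "bmeas M (\<theta> j)" and \<theta>'M: "bmeas M (\<theta>' j)" for j
    using \<theta> \<theta>' sub bmeas_subalgebra by blast+
  have QM: "bmeas M Q" unfolding Q_def[abs_def] by (intro bmeas_sum wM)
  have Q0: "0 \<le> Q x" for x unfolding Q_def by (intro sum_nonneg w0)
  have \<kappa>: "\<kappa> > 0" "q\<^sup>2 \<le> \<kappa>" "V \<le> \<kappa>" using qpos by (auto simp: \<kappa>_def less_max_iff_disj)
  \<comment> \<open>A predictable factor with values 0 and 1 preserves martingale differences. This
    is applied to the part before stopping, \<open>\<theta>\<close>, and to the part after it,
    \<open>\<theta>'\<close>.\<close>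
  have md: "martingale_differences M Fs (\<lambda>j x. h j x * D j x) (\<lambda>j x. h j x * (e j + w j x))"
    if h: "\<And>j. bmeas (Fs j) (h j)" "\<And>j x. h j x = 0 \<or> h j x = 1" for h :: "nat \<Rightarrow> 'a \<Rightarrow> real"
  proof
    fix j Z
    show "bmeas (Fs (Suc j)) (\<lambda>x. h j x * D j x)"
      using bmeas_subalgebra[OF mono h(1)[of j], of "Suc j"] D by (intro bmeas_mult) auto
    show "bmeas (Fs j) (\<lambda>x. h j x * (e j + w j x))"
      by (intro bmeas_intros h w)
    assume Z: "bmeas (Fs j) Z"
    have "expectation (\<lambda>x. (Z x * h j x) * D j x) = 0"
      by (rule orth) (intro bmeas_intros h Z)
    then show "expectation (\<lambda>x. Z x * (h j x * D j x)) = 0" by (simp add: mult.assoc)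
    assume Z0: "\<And>x. 0 \<le> Z x"
    have "expectation (\<lambda>x. (Z x * h j x) * (D j x)\<^sup>2) \<le> expectation (\<lambda>x. (Z x * h j x) * (e j + w j x))"
    proof (rule var)
      fix x show "0 \<le> Z x * h j x" using Z0[of x] h(2)[of j x] by auto
    qed (intro bmeas_intros h Z)
    moreover have "(h j x * D j x)\<^sup>2 = h j x * (D j x)\<^sup>2" for x
      using h(2)[of j x] by auto
    ultimately show "expectation (\<lambda>x. Z x * (h j x * D j x)\<^sup>2) \<le> expectation (\<lambda>x. Z x * (h j x * (e j + w j x)))"
      by (simp add: mult.assoc)
  next
    fix j x show "0 \<le> h j x * (e j + w j x)" using h(2)[of j x] e0[of j] w0[of j x] by auto
  qed (rule sub mono; assumption?)+
  interpret A: martingale_differences M Fs "\<lambda>j x. \<theta> j x * D j x" "\<lambda>j x. \<theta> j x * (e j + w j x)"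
    by (rule md) (rule \<theta>, simp add: \<theta>_def)
  interpret B: martingale_differences M Fs "\<lambda>j x. \<theta>' j x * D j x" "\<lambda>j x. \<theta>' j x * (e j + w j x)"
    by (rule md) (rule \<theta>', simp add: \<theta>'_def \<theta>_def)
  have eq: "(\<Sum>j<N. D j x) = A.psum N x + B.psum N x" for x
    unfolding A.psum_def B.psum_def by (simp add: \<theta>'_def algebra_simps flip: sum.distrib)
  have AM: "bmeas M (A.psum N)" and BM: "bmeas M (B.psum N)"
    by (rule A.bmeas_M B.bmeas_M)+
  have "expectation (\<lambda>x. A.psum N x ^ (2*m)) \<le> 2 ^ ((2*m+1)*m) *
      (expectation (\<lambda>x. (\<Sum>j<N. \<theta> j x * (e j + w j x)) ^ m) + (\<Sum>j<N. expectation (\<lambda>x. (\<theta> j x * D j x) ^ (2*m))))"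
    by (rule A.rosenthal[OF m])
  also have "\<dots> \<le> 2 ^ ((2*m+1)*m) * (2 ^ m * (2 * V ^ m + q ^ (2*m-2) * W) + \<Delta>)"
  proof (intro mult_left_mono add_mono)
    have pt: "(\<Sum>j<N. \<theta> j x * (e j + w j x)) ^ m \<le> 2 ^ m * (2 * V ^ m + q ^ (2*m-2) * Q x)" for x
    proof -
      have "(\<Sum>j<N. \<theta> j x * (e j + w j x)) \<le> (\<Sum>j<N. e j + (if P j x \<le> \<kappa> then w j x else 0))"
        by (intro sum_mono) (auto simp: \<theta>_def e0)
      also have "\<dots> \<le> V + min \<kappa> (Q x)"
        using V(1) sum_stopped_le[of "\<lambda>j. w j x" \<kappa> N] w0 \<kappa>(1)
        by (simp add: sum.distrib P_def Q_def add_mono)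
      finally have "(\<Sum>j<N. \<theta> j x * (e j + w j x)) ^ m \<le> (V + min \<kappa> (Q x)) ^ m"
        by (intro power_mono sum_nonneg) (auto simp: \<theta>_def e0 w0)
      also have "\<dots> \<le> 2 ^ m * (V ^ m + min \<kappa> (Q x) ^ m)"
        using V(2) \<kappa>(1) Q0[of x] by (intro power_add_le) auto
      \<comment> \<open>If \<open>\<kappa>\<close> is \<open>q ^ 2\<close>, one factor
        \<open>Q x\<close> is kept and the other \<open>m - 1\<close> factors are bounded by
        \<open>\<kappa>\<close>. If it is \<open>V\<close>, the whole power goes into
        \<open>V ^ m\<close>.\<close>
      also have "min \<kappa> (Q x) ^ m \<le> V ^ m + q ^ (2*m-2) * Q x"
      proof (cases "V \<le> q\<^sup>2")
        case True
        then have k: "\<kappa> = q\<^sup>2" by (simp add: \<kappa>_def max_def)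
        have "min \<kappa> (Q x) ^ m = min \<kappa> (Q x) ^ (m-1) * min \<kappa> (Q x)"
          using m by (metis power_minus_mult zero_less_one less_le_trans)
        also have "\<dots> \<le> \<kappa> ^ (m-1) * Q x"
          using \<kappa>(1) Q0[of x] by (intro mult_mono power_mono) auto
        also have "\<kappa> ^ (m-1) = q ^ (2*m-2)"
          unfolding k by (simp add: right_diff_distrib' flip: power_mult)
        finally show ?thesis using V(2) by (simp add: add_increasing)
      next
        case False
        then have k: "\<kappa> = V" by (simp add: \<kappa>_def max_def)
        have "min \<kappa> (Q x) ^ m \<le> V ^ m"
          unfolding k using V(2) Q0[of x] by (intro power_mono) auto
        then show ?thesis using qpos Q0[of x] by (simp add: add_increasing2)
      qed
      finally show ?thesis by (simp add: algebra_simps)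
    qed
    have "expectation (\<lambda>x. (\<Sum>j<N. \<theta> j x * (e j + w j x)) ^ m)
        \<le> expectation (\<lambda>x. 2 ^ m * (2 * V ^ m + q ^ (2*m-2) * Q x))"
      by (intro integral_mono pt bmeas_integrable bmeas_intros QM \<theta>M wM)
    also have "\<dots> = 2 ^ m * (2 * V ^ m + q ^ (2*m-2) * expectation Q)"
    proof -
      have "integrable M Q" by (rule bmeas_integrable[OF QM])
      then show ?thesis by (simp add: prob_space)
    qed
    also have "\<dots> \<le> 2 ^ m * (2 * V ^ m + q ^ (2*m-2) * W)"
      using W qpos by (intro mult_left_mono add_left_mono) (auto simp: Q_def[abs_def])
    finally show "expectation (\<lambda>x. (\<Sum>j<N. \<theta> j x * (e j + w j x)) ^ m) \<le> 2 ^ m * (2 * V ^ m + q ^ (2*m-2) * W)" .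
    have "(\<Sum>j<N. expectation (\<lambda>x. (\<theta> j x * D j x) ^ (2*m))) \<le> (\<Sum>j<N. expectation (\<lambda>x. D j x ^ (2*m)))"
    proof (intro sum_mono integral_mono bmeas_integrable bmeas_intros DM \<theta>M)
      fix j x show "(\<theta> j x * D j x) ^ (2*m) \<le> D j x ^ (2*m)"
        using m by (auto simp: \<theta>_def zero_le_even_power power_0_left)
    qed
    then show "(\<Sum>j<N. expectation (\<lambda>x. (\<theta> j x * D j x) ^ (2*m))) \<le> \<Delta>" using Dm by linarith
  qed auto
  finally have A: "expectation (\<lambda>x. A.psum N x ^ (2*m)) \<le> \<dots>" .
  have PQ: "P j x \<le> Q x" if "j < N" for j x
    unfolding P_def Q_def using that by (intro sum_mono2) (auto simp: w0)
  have "expectation (\<lambda>x. (B.psum N x)\<^sup>2) \<le> expectation (\<lambda>x. \<Sum>j<N. \<theta>' j x * (e j + w j x))"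
    by (rule B.second_moment)
  also have "\<dots> \<le> expectation (\<lambda>x. 2 * Q x)"
  proof (intro integral_mono bmeas_integrable bmeas_intros \<theta>'M wM QM)
    fix x
    show "(\<Sum>j<N. \<theta>' j x * (e j + w j x)) \<le> 2 * Q x"
    proof (cases "Q x \<le> \<kappa>")
      case True
      then have "\<theta>' j x = 0" if "j < N" for j
        using PQ[OF that, of x] by (simp add: \<theta>'_def \<theta>_def)
      then show ?thesis using Q0[of x] by simp
    next
      case False
      have "(\<Sum>j<N. \<theta>' j x * (e j + w j x)) \<le> (\<Sum>j<N. e j + w j x)"
        by (intro sum_mono) (auto simp: \<theta>'_def \<theta>_def e0 w0 add_nonneg_nonneg)
      also have "\<dots> \<le> 2 * Q x" using False \<kappa>(3) V(1) by (simp add: sum.distrib Q_def)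
      finally show ?thesis .
    qed
  qed
  also have "\<dots> = 2 * expectation Q" by simp
  finally have B2: "expectation (\<lambda>x. (B.psum N x)\<^sup>2) \<le> 2 * expectation Q" .
  have "expectation (\<lambda>x. \<bar>B.psum N x\<bar>) \<le> expectation (\<lambda>x. (1/(2*q)) * (B.psum N x)\<^sup>2 + (1/(2*q)) * Q x)"
  proof (intro integral_mono bmeas_integrable bmeas_intros BM QM)
    fix x
    show "\<bar>B.psum N x\<bar> \<le> (1/(2*q)) * (B.psum N x)\<^sup>2 + (1/(2*q)) * Q x"
    proof (cases "Q x \<le> \<kappa>")
      case True
      then have "\<theta>' j x = 0" if "j < N" for j
        using PQ[OF that, of x] by (simp add: \<theta>'_def \<theta>_def)
      then have "B.psum N x = 0" unfolding B.psum_def by simp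
      then show ?thesis using Q0[of x] qpos by simp
    next
      case False
      \<comment> \<open>Wherever the second part is nonzero, \<open>Q x\<close> exceeds
        \<open>q ^ 2\<close>; the square completed here therefore costs no more than
        \<open>Q x\<close>.\<close>
      let ?b = "\<bar>B.psum N x\<bar>"
      have "0 \<le> (?b - q)\<^sup>2" by simp
      then have "2 * q * ?b \<le> ?b\<^sup>2 + q\<^sup>2" by (simp add: power2_diff mult_ac)
      also have "\<dots> \<le> (B.psum N x)\<^sup>2 + Q x" using False \<kappa>(2) by simp
      finally show ?thesis using qpos by (simp add: field_simps)
    qed
  qed
  also have "\<dots> = (1/(2*q)) * expectation (\<lambda>x. (B.psum N x)\<^sup>2) + (1/(2*q)) * expectation Q"
  proof -
    have "integrable M Q" "integrable M (\<lambda>x. (B.psum N x)\<^sup>2)"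
      by (intro bmeas_integrable bmeas_intros QM BM)+
    then show ?thesis by simp
  qed
  also have "\<dots> \<le> (1/(2*q)) * (2 * expectation Q) + (1/(2*q)) * expectation Q"
    using B2 qpos by (intro add_right_mono mult_left_mono) auto
  also have "\<dots> = 3/2 * expectation Q / q" using qpos by (simp add: field_simps)
  also have "\<dots> \<le> 3/2 * W / q"
    using W qpos by (intro divide_right_mono mult_left_mono) (auto simp: Q_def[abs_def])
  finally have B: "expectation (\<lambda>x. \<bar>B.psum N x\<bar>) \<le> 3/2 * W / q" .
  show ?thesis by (rule that[OF AM BM eq A B])
qed

lemma sum_parity: "(\<Sum>i<2*(N::nat). f i) = (\<Sum>j<N. f (2*j)) + (\<Sum>j<N. f (2*j+1) :: real)"
  by (induction N) (simp_all add: numeral_2_eq_2)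

context block_decomposition
begin

text \<open>For blocks of one parity the conditional variance is at most the mean square of
  \<open>U i\<close> plus the positive part of \<open>w i\<close>. The mean squares add up to order
  \<open>n\<close> times the sum of \<open>g1\<close>, while each positive part has mean of order
  \<open>q ^ 2 * g2 q\<close>; this fixes \<open>V\<close> and \<open>W\<close> in
  \<open>stopped_martingale\<close>. The conditional means \<open>c i\<close> are of size
  \<open>q * g2 q\<close> in mean and join \<open>B\<close>.\<close>

theorem block_approximation:
  assumes \<Phi>: "\<And>l. l \<le> q \<Longrightarrow> moment (2*m) l \<le> \<Phi>"
  obtains A B where "bmeas M A" "bmeas M B" "\<And>x. psums s n x = A x + B x"
    "expectation (\<lambda>x. A x ^ (2*m)) \<le> block_const m *
       ((real n * (\<Sum>d<n. g1 d)) ^ m + real n * real q ^ (2*m-1) * g2 q + real n / real q * \<Phi>)"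
    "expectation (\<lambda>x. \<bar>B x\<bar>) \<le> 32 * real n * g2 q"
proof -
  obtain c w where c: "\<And>i. bmeas (G i) (c i)" "\<And>i x. \<bar>c i x\<bar> \<le> real q"
    "\<And>i Z. bmeas (G i) Z \<Longrightarrow> expectation (\<lambda>x. Z x * c i x) = expectation (\<lambda>x. Z x * U i x)"
    and w: "\<And>i. bmeas (G i) (w i)"
    "\<And>i Z. bmeas (G i) Z \<Longrightarrow> expectation (\<lambda>x. Z x * w i x)
        = expectation (\<lambda>x. Z x * ((U i x)\<^sup>2 - expectation (\<lambda>x. (U i x)\<^sup>2)))"
    using predictable_parts by blast
  define S where "S = (\<Sum>d<n. g1 d)"
  \<comment> \<open>\<open>N\<close> blocks already cover all \<open>n\<close> indices. Taking
    \<open>2 * N\<close> of them gives each parity exactly \<open>N\<close>, the surplus blocks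
    being empty.\<close>
  define N where "N = n div q + 1"
  have S0: "0 \<le> S" unfolding S_def by (intro sum_nonneg g1_nonneg)
  have \<Phi>0: "0 \<le> \<Phi>" using \<Phi>[of 0] moment_even_nonneg[of m 0] by simp
  have Nq: "real N * real q \<le> 2 * real n"
  proof -
    have "N * q \<le> 2 * n" using q by (simp add: N_def) (metis add_mono div_times_less_eq_dividend mult_2)
    then show ?thesis by (metis of_nat_le_iff of_nat_mult of_nat_numeral)
  qed
  have qn: "real q > 0" using q by simp
  have cM: "bmeas M (c i)" and wM: "bmeas M (w i)" for i using c w bmeas_G_M by blast+
  have e0: "0 \<le> expectation (\<lambda>x. (U i x)\<^sup>2)" for i by (intro integral_nonneg_AE AE_I2) simp
  \<comment> \<open>Positive part and absolute value are reached by duality: \<open>w i\<close> is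
    tested against the indicator of \<open>w i > 0\<close>, and further below \<open>c i\<close>
    against its own sign.\<close>
  have wpos: "expectation (\<lambda>x. max 0 (w i x)) \<le> 4 * (real q)\<^sup>2 * g2 q" for i
  proof -
    let ?Z = "\<lambda>x. 1 - (if w i x \<le> 0 then 1 else (0::real))"
    have Z: "bmeas (G i) ?Z" by (intro bmeas_intros w)
    have "expectation (\<lambda>x. max 0 (w i x)) = expectation (\<lambda>x. ?Z x * w i x)"
      by (intro Bochner_Integration.integral_cong) auto
    also have "\<dots> \<le> 4 * (real q)\<^sup>2 * g2 q"
      unfolding w(2)[OF Z] by (rule U_coef2[OF Z]) auto
    finally show ?thesis .
  qed
  have cabs: "expectation (\<lambda>x. \<bar>c i x\<bar>) \<le> 2 * real q * g2 q" for i
  proof -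
    have Z: "bmeas (G i) (\<lambda>x. sgn (c i x))" by (intro bmeas_sgn c)
    have "expectation (\<lambda>x. \<bar>c i x\<bar>) = expectation (\<lambda>x. sgn (c i x) * c i x)"
      by (simp add: linordered_idom_class.abs_sgn mult.commute)
    also have "\<dots> \<le> 2 * real q * g2 q"
      unfolding c(3)[OF Z] by (rule U_coef1[OF Z]) (simp add: sgn_real_def)
    finally show ?thesis .
  qed
  have orth: "expectation (\<lambda>x. Z x * (U i x - c i x)) = 0" if Z: "bmeas (G i) Z" for i Z
  proof -
    have "integrable M (\<lambda>x. Z x * U i x)" "integrable M (\<lambda>x. Z x * c i x)"
      by (intro bmeas_integrable bmeas_intros U_bmeas_M cM bmeas_G_M[OF Z])+
    then show ?thesis using c(3)[OF Z] by (simp add: right_diff_distrib)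
  qed
  \<comment> \<open>The conditional variance is the conditional second moment minus the square of
    \<open>c i\<close>; the subtracted square is dropped.\<close>
  have var: "expectation (\<lambda>x. Z x * (U i x - c i x)\<^sup>2)
      \<le> expectation (\<lambda>x. Z x * (expectation (\<lambda>x. (U i x)\<^sup>2) + max 0 (w i x)))"
    if Z: "bmeas (G i) Z" and Z0: "\<And>x. 0 \<le> Z x" for i Z
  proof -
    let ?e = "expectation (\<lambda>x. (U i x)\<^sup>2)"
    note b = bmeas_integrable bmeas_intros U_bmeas_M cM wM bmeas_G_M[OF Z]
    have Zc: "bmeas (G i) (\<lambda>x. Z x * c i x)" by (intro bmeas_intros Z c)
    have "expectation (\<lambda>x. Z x * (U i x - c i x)\<^sup>2)
       = expectation (\<lambda>x. (Z x * ((U i x)\<^sup>2 - ?e) + Z x * ?e) + ((Z x * c i x) * c i x - 2 * ((Z x * c i x) * U i x)))"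
      by (intro Bochner_Integration.integral_cong) (auto simp: power2_eq_square algebra_simps)
    also have "\<dots> = (expectation (\<lambda>x. Z x * ((U i x)\<^sup>2 - ?e)) + expectation (\<lambda>x. Z x * ?e))
        + (expectation (\<lambda>x. (Z x * c i x) * c i x) - 2 * expectation (\<lambda>x. (Z x * c i x) * U i x))"
      by (subst Bochner_Integration.integral_add Bochner_Integration.integral_diff Bochner_Integration.integral_mult_right,
         (intro b; fail)+)+ simp
    also have "\<dots> = (expectation (\<lambda>x. Z x * w i x) + expectation (\<lambda>x. Z x * ?e))
        - expectation (\<lambda>x. (Z x * c i x) * c i x)"
      using c(3)[OF Zc] w(2)[OF Z] by simp
    also have "\<dots> \<le> expectation (\<lambda>x. Z x * w i x) + expectation (\<lambda>x. Z x * ?e)"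
    proof -
      have "0 \<le> expectation (\<lambda>x. (Z x * c i x) * c i x)"
        by (intro integral_nonneg_AE AE_I2) (simp add: Z0 mult.assoc)
      then show ?thesis by simp
    qed
    also have "\<dots> = expectation (\<lambda>x. Z x * w i x + Z x * ?e)"
      by (intro Bochner_Integration.integral_add[symmetric] b)
    also have "\<dots> \<le> expectation (\<lambda>x. Z x * (?e + max 0 (w i x)))"
    proof (intro integral_mono b)
      fix x
      have "Z x * w i x \<le> Z x * max 0 (w i x)" by (intro mult_left_mono Z0) simp
      then show "Z x * w i x + Z x * ?e \<le> Z x * (?e + max 0 (w i x))" by (simp add: algebra_simps)
    qed
    finally show ?thesis .
  qed
  have Um: "expectation (\<lambda>x. U i x ^ (2*m)) \<le> \<Phi>" for i
    unfolding U_def moment_psums by (rule \<Phi>[OF len_le])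
  \<comment> \<open>A weak form of the conditional Jensen inequality for \<open>c i\<close>: its
    power of order \<open>2*m\<close> is read as \<open>c i ^ (2*m-1)\<close> tested against
    \<open>U i\<close>, and \<open>power_young\<close> lets half of it be absorbed.\<close>
  have Dm: "expectation (\<lambda>x. (U i x - c i x) ^ (2*m)) \<le> 2 ^ (4*m+1) * \<Phi>" for i
  proof -
    let ?u = "expectation (\<lambda>x. U i x ^ (2*m))" and ?c = "expectation (\<lambda>x. c i x ^ (2*m))"
    note b = bmeas_integrable bmeas_intros U_bmeas_M cM
    have S: "Suc (2*m-1) = 2*m" using m by simp
    have Zc: "bmeas (G i) (\<lambda>x. c i x ^ (2*m-1))" by (intro bmeas_intros c)
    have "?c = expectation (\<lambda>x. c i x ^ (2*m-1) * c i x)"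
      by (metis S power_Suc2)
    also have "\<dots> = expectation (\<lambda>x. c i x ^ (2*m-1) * U i x)" by (rule c(3)[OF Zc])
    also have "\<dots> \<le> expectation (\<lambda>x. (1/2) * c i x ^ (2*m) + 2 ^ (2*m-1) * U i x ^ (2*m))"
    proof (intro integral_mono b)
      fix x
      have "c i x ^ (2*m-1) * U i x \<le> \<bar>c i x\<bar> ^ (2*m-1) * \<bar>U i x\<bar>"
        by (metis abs_ge_self abs_mult power_abs)
      also have "\<dots> \<le> (1/2) * \<bar>c i x\<bar> ^ Suc (2*m-1) + (1/(1/2)) ^ (2*m-1) * \<bar>U i x\<bar> ^ Suc (2*m-1)"
        by (rule power_young) auto
      finally show "c i x ^ (2*m-1) * U i x \<le> (1/2) * c i x ^ (2*m) + 2 ^ (2*m-1) * U i x ^ (2*m)"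
        unfolding S by (simp add: power_even_abs)
    qed
    also have "\<dots> = (1/2) * ?c + 2 ^ (2*m-1) * ?u"
      by (subst Bochner_Integration.integral_add Bochner_Integration.integral_mult_right, (intro b; fail)+)+ simp
    finally have "?c \<le> 2 * 2 ^ (2*m-1) * ?u" by simp
    also have "2 * 2 ^ (2*m-1) = (2::real) ^ (2*m)" by (metis S power_Suc)
    finally have cu: "?c \<le> 2 ^ (2*m) * ?u" .
    have u0: "0 \<le> ?u" by (intro integral_nonneg_AE AE_I2) (simp add: zero_le_even_power)
    have "expectation (\<lambda>x. (U i x - c i x) ^ (2*m)) \<le> expectation (\<lambda>x. 2 ^ (2*m) * (U i x ^ (2*m) + c i x ^ (2*m)))"
    proof (intro integral_mono b)
      fix x show "(U i x - c i x) ^ (2*m) \<le> 2 ^ (2*m) * (U i x ^ (2*m) + c i x ^ (2*m))"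
        using power_add_even_le2[of "U i x" "- c i x" m] by simp
    qed
    also have "\<dots> = 2 ^ (2*m) * (?u + ?c)"
      by (subst Bochner_Integration.integral_add Bochner_Integration.integral_mult_right, (intro b; fail)+)+ simp
    also have "\<dots> \<le> 2 ^ (2*m) * (2 ^ (2*m) * ?u + 2 ^ (2*m) * ?u)"
    proof -
      have "1 * ?u \<le> 2 ^ (2*m) * ?u" by (rule mult_right_mono[OF _ u0]) simp
      then show ?thesis using cu by (intro mult_left_mono add_mono) auto
    qed
    also have "\<dots> = 2 ^ (4*m+1) * ?u" by (simp add: power_add[symmetric] mult_2[symmetric] power_mult)
    also have "\<dots> \<le> 2 ^ (4*m+1) * \<Phi>" using Um by (intro mult_left_mono) auto
    finally show ?thesis .
  qed
  let ?V = "4 * real n * S" and ?W = "8 * real n * real q * g2 q" and ?\<Delta> = "2 ^ (4*m+2) * (real n / real q * \<Phi>)"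
  have parity: "\<exists>A B. bmeas M A \<and> bmeas M B \<and> (\<forall>x. (\<Sum>j<N. U (2*j+p) x - c (2*j+p) x) = A x + B x) \<and>
     expectation (\<lambda>x. A x ^ (2*m)) \<le> 2 ^ ((2*m+1)*m) * (2 ^ m * (2 * ?V ^ m + real q ^ (2*m-2) * ?W) + ?\<Delta>) \<and>
     expectation (\<lambda>x. \<bar>B x\<bar>) \<le> 3/2 * ?W / real q" if p: "p \<le> 1" for p
  proof (rule stopped_martingale[where D = "\<lambda>j x. U (2*j+p) x - c (2*j+p) x" and Fs = "\<lambda>j. G (2*j+p)"
        and w = "\<lambda>j x. max 0 (w (2*j+p) x)" and e = "\<lambda>j. expectation (\<lambda>x. (U (2*j+p) x)\<^sup>2)" and N = N
        and V = ?V and W = ?W and m = m and q = "real q" and \<Delta> = ?\<Delta>])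
    show "subalgebra M (G (2*j+p))" for j by (rule G_sub)
    show "subalgebra (G (2*j+p)) (G (2*i+p))" if "i \<le> j" for i j using that by (intro G_mono) simp
    show "bmeas (G (2 * Suc j + p)) (\<lambda>x. U (2*j+p) x - c (2*j+p) x)" for j
      using U_bmeas[of "2*j+p"] bmeas_G_mono[OF c(1), of "2*j+p" "2 * Suc j + p"] by (intro bmeas_diff) auto
    show "bmeas (G (2*j+p)) (\<lambda>x. max 0 (w (2*j+p) x))" for j by (intro bmeas_intros w)
    show "(\<Sum>j<N. expectation (\<lambda>x. (U (2*j+p) x)\<^sup>2)) \<le> ?V"
    proof -
      have "(\<Sum>j<N. expectation (\<lambda>x. (U (2*j+p) x)\<^sup>2)) \<le> (\<Sum>j<N. 4 * real (len (2*j+p)) * S)"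
        unfolding S_def by (intro sum_mono U_second_moment)
      also have "\<dots> = 4 * real (\<Sum>j<N. len (2*j+p)) * S"
        by (simp add: sum_distrib_left sum_distrib_right)
      also have "(\<Sum>j<N. len (2*j+p)) = (\<Sum>i\<in>(\<lambda>j. 2*j+p) ` {..<N}. len i)"
        by (subst sum.reindex) (auto simp: inj_on_def)
      also have "4 * real \<dots> * S \<le> 4 * real (\<Sum>i<2*N. len i) * S"
        using p S0 by (intro mult_right_mono mult_left_mono of_nat_mono sum_mono2) auto
      also have "\<dots> \<le> 4 * real n * S"
        unfolding sum_len using S0 by (intro mult_right_mono mult_left_mono) auto
      finally show ?thesis .
    qed
    show "expectation (\<lambda>x. \<Sum>j<N. max 0 (w (2*j+p) x)) \<le> ?W"
    proof -
      have "expectation (\<lambda>x. \<Sum>j<N. max 0 (w (2*j+p) x)) = (\<Sum>j<N. expectation (\<lambda>x. max 0 (w (2*j+p) x)))"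
        by (intro Bochner_Integration.integral_sum bmeas_integrable bmeas_intros wM)
      also have "\<dots> \<le> (\<Sum>j<N. 4 * (real q)\<^sup>2 * g2 q)" by (intro sum_mono wpos)
      also have "\<dots> = 4 * (real N * real q) * real q * g2 q" by (simp add: power2_eq_square)
      also have "\<dots> \<le> 4 * (2 * real n) * real q * g2 q"
        using Nq by (intro mult_right_mono mult_left_mono g2_nonneg) auto
      finally show ?thesis by simp
    qed
    show "(\<Sum>j<N. expectation (\<lambda>x. (U (2*j+p) x - c (2*j+p) x) ^ (2*m))) \<le> ?\<Delta>"
    proof -
      have "(\<Sum>j<N. expectation (\<lambda>x. (U (2*j+p) x - c (2*j+p) x) ^ (2*m))) \<le> (\<Sum>j<N. 2 ^ (4*m+1) * \<Phi>)"
        by (intro sum_mono Dm)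
      also have "\<dots> = real N * (2 ^ (4*m+1) * \<Phi>)" by simp
      also have "\<dots> \<le> (2 * real n / real q) * (2 ^ (4*m+1) * \<Phi>)"
        using Nq qn \<Phi>0 by (intro mult_right_mono) (auto simp: field_simps)
      finally show ?thesis by (simp add: power_add mult_ac)
    qed
    show "expectation (\<lambda>x. Z x * (U (2*j+p) x - c (2*j+p) x)) = 0" if "bmeas (G (2*j+p)) Z" for j Z
      by (rule orth[OF that])
    show "expectation (\<lambda>x. Z x * (U (2*j+p) x - c (2*j+p) x)\<^sup>2)
        \<le> expectation (\<lambda>x. Z x * (expectation (\<lambda>x. (U (2*j+p) x)\<^sup>2) + max 0 (w (2*j+p) x)))"
      if "bmeas (G (2*j+p)) Z" "\<And>x. 0 \<le> Z x" for j Z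
      by (rule var[OF that])
    show ?thesis
      if "bmeas M A" "bmeas M B" "\<And>x. (\<Sum>j<N. U (2*j+p) x - c (2*j+p) x) = A x + B x"
        "expectation (\<lambda>x. A x ^ (2*m)) \<le> 2 ^ ((2*m+1)*m) * (2 ^ m * (2 * ?V ^ m + real q ^ (2*m-2) * ?W) + ?\<Delta>)"
        "expectation (\<lambda>x. \<bar>B x\<bar>) \<le> 3/2 * ?W / real q" for A B
      by (intro exI[of _ A] exI[of _ B] conjI allI that)
  qed (use m qn S0 e0 in auto)
  obtain A0 B0 where A0: "bmeas M A0" "bmeas M B0" "\<And>x. (\<Sum>j<N. U (2*j) x - c (2*j) x) = A0 x + B0 x"
     "expectation (\<lambda>x. A0 x ^ (2*m)) \<le> 2 ^ ((2*m+1)*m) * (2 ^ m * (2 * ?V ^ m + real q ^ (2*m-2) * ?W) + ?\<Delta>)"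
     "expectation (\<lambda>x. \<bar>B0 x\<bar>) \<le> 3/2 * ?W / real q"
    using parity[of 0] by auto
  obtain A1 B1 where A1: "bmeas M A1" "bmeas M B1" "\<And>x. (\<Sum>j<N. U (2*j+1) x - c (2*j+1) x) = A1 x + B1 x"
     "expectation (\<lambda>x. A1 x ^ (2*m)) \<le> 2 ^ ((2*m+1)*m) * (2 ^ m * (2 * ?V ^ m + real q ^ (2*m-2) * ?W) + ?\<Delta>)"
     "expectation (\<lambda>x. \<bar>B1 x\<bar>) \<le> 3/2 * ?W / real q"
    using parity[of 1] by auto
  define C where "C x = (\<Sum>i<2*N. c i x)" for x
  have CM: "bmeas M C" unfolding C_def[abs_def] by (intro bmeas_sum cM)
  have C: "expectation (\<lambda>x. \<bar>C x\<bar>) \<le> 8 * real n * g2 q"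
  proof -
    have "expectation (\<lambda>x. \<bar>C x\<bar>) \<le> expectation (\<lambda>x. \<Sum>i<2*N. \<bar>c i x\<bar>)"
      by (intro integral_mono bmeas_integrable bmeas_intros CM cM) (simp add: C_def sum_abs)
    also have "\<dots> = (\<Sum>i<2*N. expectation (\<lambda>x. \<bar>c i x\<bar>))"
      by (intro Bochner_Integration.integral_sum bmeas_integrable bmeas_intros cM)
    also have "\<dots> \<le> (\<Sum>i<2*N. 2 * real q * g2 q)" by (intro sum_mono cabs)
    also have "\<dots> = 4 * (real N * real q) * g2 q" by simp
    also have "\<dots> \<le> 4 * (2 * real n) * g2 q"
      using Nq by (intro mult_right_mono mult_left_mono g2_nonneg) auto
    finally show ?thesis by simp
  qed
  let ?A = "\<lambda>x. A0 x + A1 x" and ?B = "\<lambda>x. (B0 x + B1 x) + C x"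
  have eq: "psums s n x = ?A x + ?B x" for x
  proof -
    have "n \<le> 2 * N * q"
    proof -
      have "n < q * (n div q) + q" using q by (metis mult_div_mod_eq add_less_cancel_left mod_less_divisor less_le_trans zero_less_one)
      also have "\<dots> = N * q" by (simp add: N_def algebra_simps)
      finally show ?thesis by simp
    qed
    then have "psums s n x = (\<Sum>i<2*N. U i x)" by (simp only: sum_U min_absorb1)
    also have "\<dots> = (\<Sum>i<2*N. (U i x - c i x)) + C x" by (simp add: C_def sum_subtractf)
    also have "(\<Sum>i<2*N. (U i x - c i x)) = (A0 x + B0 x) + (A1 x + B1 x)"
      unfolding sum_parity A0(3) A1(3) ..
    finally show ?thesis by simp
  qed
  let ?X = "(real n * S) ^ m + real n * real q ^ (2*m-1) * g2 q + real n / real q * \<Phi>"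
  let ?R = "2 ^ ((2*m+1)*m) * (2 ^ m * (2 * ?V ^ m + real q ^ (2*m-2) * ?W) + ?\<Delta>)"
  have R: "?R \<le> 2 ^ ((2*m+1)*m) * (2 ^ m * 2 * 4 ^ m + 2 ^ m * 8 + 2 ^ (4*m+2)) * ?X"
  proof -
    define a b d where "a = (real n * S) ^ m" and "b = real n * real q ^ (2*m-1) * g2 q" and "d = real n / real q * \<Phi>"
    have abd: "a \<ge> 0" "b \<ge> 0" "d \<ge> 0"
      using S0 \<Phi>0 g2_nonneg[of q] by (simp_all add: a_def b_def d_def)
    have V: "?V ^ m = 4 ^ m * a" by (simp add: a_def power_mult_distrib mult.assoc)
    have "Suc (2*m-2) = 2*m-1" using m by simp
    then have qq: "real q ^ (2*m-1) = real q ^ (2*m-2) * real q" by (metis power_Suc2)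
    have W: "real q ^ (2*m-2) * ?W = 8 * b" unfolding b_def qq by (simp only: mult_ac)
    have "2 ^ m * (2 * ?V ^ m + real q ^ (2*m-2) * ?W) + ?\<Delta>
        = (2 ^ m * 2 * 4 ^ m) * a + (2 ^ m * 8) * b + 2 ^ (4*m+2) * d"
      unfolding V W d_def[symmetric] by (simp add: algebra_simps)
    also have "\<dots> \<le> (2 ^ m * 2 * 4 ^ m) * (a + b + d) + (2 ^ m * 8) * (a + b + d) + 2 ^ (4*m+2) * (a + b + d)"
      using abd by (intro add_mono mult_left_mono) auto
    also have "\<dots> = (2 ^ m * 2 * 4 ^ m + 2 ^ m * 8 + 2 ^ (4*m+2)) * (a + b + d)" by (simp add: algebra_simps)
    finally show ?thesis unfolding a_def b_def d_def by (simp only: mult.assoc mult_left_mono zero_le_power zero_le_numeral)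
  qed
  have Abound: "expectation (\<lambda>x. ?A x ^ (2*m)) \<le> block_const m * ?X"
  proof -
    have "expectation (\<lambda>x. ?A x ^ (2*m)) \<le> expectation (\<lambda>x. 2 ^ (2*m) * (A0 x ^ (2*m) + A1 x ^ (2*m)))"
      by (intro integral_mono bmeas_integrable bmeas_intros A0 A1 power_add_even_le2)
    also have "\<dots> = 2 ^ (2*m) * (expectation (\<lambda>x. A0 x ^ (2*m)) + expectation (\<lambda>x. A1 x ^ (2*m)))"
      by (subst Bochner_Integration.integral_add Bochner_Integration.integral_mult_right,
         (intro bmeas_integrable bmeas_intros A0 A1; fail)+)+ simp
    also have "\<dots> \<le> 2 ^ (2*m) * (?R + ?R)" using A0(4) A1(4) by (intro mult_left_mono add_mono) auto
    also have "\<dots> = 2 ^ (2*m+1) * ?R" by simp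
    also have "\<dots> \<le> 2 ^ (2*m+1) * (2 ^ ((2*m+1)*m) * (2 ^ m * 2 * 4 ^ m + 2 ^ m * 8 + 2 ^ (4*m+2)) * ?X)"
      using R by (intro mult_left_mono) auto
    finally show ?thesis by (simp only: block_const_def mult.assoc)
  qed
  \<comment> \<open>The constant 32 is \<open>3/2 * 8\<close> for each of the two parities plus 8
    for the conditional means.\<close>
  have Bbound: "expectation (\<lambda>x. \<bar>?B x\<bar>) \<le> 32 * real n * g2 q"
  proof -
    have "expectation (\<lambda>x. \<bar>?B x\<bar>) \<le> expectation (\<lambda>x. (\<bar>B0 x\<bar> + \<bar>B1 x\<bar>) + \<bar>C x\<bar>)"
      by (intro integral_mono bmeas_integrable bmeas_intros A0 A1 CM) auto
    also have "\<dots> = (expectation (\<lambda>x. \<bar>B0 x\<bar>) + expectation (\<lambda>x. \<bar>B1 x\<bar>)) + expectation (\<lambda>x. \<bar>C x\<bar>)"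
      by (subst Bochner_Integration.integral_add,
         (intro bmeas_integrable bmeas_intros A0 A1 CM; fail)+)+ simp
    also have "\<dots> \<le> (12 * real n * g2 q + 12 * real n * g2 q) + 8 * real n * g2 q"
      using A0(5) A1(5) C qn by (intro add_mono) auto
    finally show ?thesis by simp
  qed
  show ?thesis
    by (rule that[of ?A ?B]) (use Abound Bbound eq in \<open>auto intro!: bmeas_intros A0 A1 CM simp: S_def\<close>)
qed

end

section \<open>Moments and truncation\<close>

text \<open>Discrete form of integrating \<open>x ^ s\<close>: by Bernoulli's inequality the left
  side grows from \<open>q\<close> to \<open>Suc q\<close> by at most
  \<open>real (s + 1) * real (Suc q) ^ s\<close>.\<close>

lemma power_le_sum_powers:
  assumes "s \<ge> 1" shows "real q ^ (s + 1) \<le> real (s + 1) * (\<Sum>k<q. (real k + 1) ^ s)"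
proof (induction q)
  case (Suc q)
  have "real q ^ (s+1) \<ge> real (Suc q) ^ (s+1) - real (s+1) * real (Suc q) ^ s"
  proof -
    have "1 + real (s+1) * (- (1 / real (Suc q))) \<le> (1 + - (1 / real (Suc q))) ^ (s+1)"
      by (rule Bernoulli_inequality) simp
    also have "1 + - (1 / real (Suc q)) = real q / real (Suc q)" by (simp add: field_simps)
    finally have "real (Suc q) ^ (s+1) * (1 + real (s+1) * (- (1 / real (Suc q))))
        \<le> real (Suc q) ^ (s+1) * (real q / real (Suc q)) ^ (s+1)"
      by (intro mult_left_mono) auto
    also have "\<dots> = real q ^ (s+1)"
      by (simp only: power_mult_distrib[symmetric]) simp
    also have "real (Suc q) ^ (s+1) * (1 + real (s+1) * (- (1 / real (Suc q))))
        = real (Suc q) ^ (s+1) - real (s+1) * real (Suc q) ^ s"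
      by (simp add: field_simps del: of_nat_Suc)
    finally show ?thesis by simp
  qed
  then show ?case using Suc by (simp add: algebra_simps)
qed simp

context dependent_sequence
begin

text \<open>A bound of Rosenthal type would carry the exponent \<open>2*m-2\<close> together with
  one length factor. One power of \<open>k + 1\<close> is traded here for a second length factor,
  which the induction in \<open>moment_le\<close> requires.\<close>

definition weighted_sum :: "nat \<Rightarrow> nat \<Rightarrow> real" where
  "weighted_sum m l = (\<Sum>k<l. (real k + 1) ^ (2*m-3) * g2 k)"

definition g1_sum :: "nat \<Rightarrow> real" where "g1_sum l = (\<Sum>d<l. g1 d)"

lemma weighted_sum_nonneg: "0 \<le> weighted_sum m l"
  unfolding weighted_sum_def by (intro sum_nonneg mult_nonneg_nonneg g2_nonneg) simp

lemma weighted_sum_mono: "l \<le> l' \<Longrightarrow> weighted_sum m l \<le> weighted_sum m l'"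
  unfolding weighted_sum_def by (intro sum_mono2) (auto intro!: mult_nonneg_nonneg g2_nonneg)

lemma g1_sum_nonneg: "0 \<le> g1_sum l"
  unfolding g1_sum_def by (intro sum_nonneg g1_nonneg)

lemma g1_sum_mono: "l \<le> l' \<Longrightarrow> g1_sum l \<le> g1_sum l'"
  unfolding g1_sum_def by (intro sum_mono2) (auto intro!: g1_nonneg)

text \<open>As \<open>g2\<close> decreases, \<open>g2 q\<close> is at most every coefficient in the
  sum, and the weights alone add up to the order \<open>q ^ (2*m-2)\<close>.\<close>

lemma power_g2_le_weighted_sum:
  assumes "m \<ge> 2" shows "real q ^ (2*m-2) * g2 q \<le> real (2*m-2) * weighted_sum m q"
proof -
  have e: "2*m-3+1 = 2*m-2" using assms by simp
  have "real q ^ (2*m-2) * g2 q \<le> (real (2*m-2) * (\<Sum>k<q. (real k + 1) ^ (2*m-3))) * g2 q"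
  proof (rule mult_right_mono[OF _ g2_nonneg])
    have "real q ^ (2*m-3+1) \<le> real (2*m-3+1) * (\<Sum>k<q. (real k + 1) ^ (2*m-3))"
      using assms by (intro power_le_sum_powers) simp
    then show "real q ^ (2*m-2) \<le> real (2*m-2) * (\<Sum>k<q. (real k + 1) ^ (2*m-3))" unfolding e .
  qed
  also have "\<dots> = real (2*m-2) * (\<Sum>k<q. (real k + 1) ^ (2*m-3) * g2 q)"
    by (simp add: sum_distrib_right mult.assoc)
  also have "\<dots> \<le> real (2*m-2) * weighted_sum m q"
    unfolding weighted_sum_def by (intro mult_left_mono sum_mono g2_antimono) auto
  finally show ?thesis .
qed

end

text \<open>Where \<open>b\<close> dominates, only one factor of the truncated power is spent on
  \<open>b\<close> and the others are bounded by \<open>c\<close>. A first moment of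
  \<open>b\<close> therefore suffices.\<close>

lemma power_add_le_truncated:
  fixes a b c :: real
  assumes m: "m \<ge> 1" and c: "c \<ge> 0"
  shows "min \<bar>a + b\<bar> c ^ (2*m) \<le> 2 ^ (2*m) * a ^ (2*m) + 2 * c ^ (2*m-1) * \<bar>b\<bar>"
proof (cases "\<bar>b\<bar> \<le> \<bar>a\<bar>")
  case True
  have "min \<bar>a + b\<bar> c ^ (2*m) \<le> (2 * \<bar>a\<bar>) ^ (2*m)"
    using True c by (intro power_mono) auto
  then show ?thesis using c by (simp add: power_mult_distrib power_even_abs add_increasing2)
next
  case False
  have "Suc (2*m-1) = 2*m" using m by simp
  then have "min \<bar>a + b\<bar> c ^ (2*m) = min \<bar>a + b\<bar> c ^ (2*m-1) * min \<bar>a + b\<bar> c"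
    by (metis power_Suc2)
  also have "\<dots> \<le> c ^ (2*m-1) * (2 * \<bar>b\<bar>)"
    using c False by (intro mult_mono power_mono) auto
  finally show ?thesis by (simp add: mult_ac add_increasing zero_le_even_power)
qed

text \<open>The counterpart above the level: where \<open>a\<close> dominates,
  \<open>\<bar>a + b\<bar> > c\<close> lets the first power be raised to order \<open>2*m\<close> at
  the price of dividing by \<open>c ^ (2*m-1)\<close>.\<close>

lemma excess_le_power:
  fixes a b c :: real
  assumes m: "m \<ge> 1" and c: "c > 0"
  shows "max 0 (\<bar>a + b\<bar> - c) \<le> 2 ^ (2*m) * a ^ (2*m) / c ^ (2*m-1) + 2 * \<bar>b\<bar>"
proof -
  have nn: "0 \<le> 2 ^ (2*m) * a ^ (2*m) / c ^ (2*m-1)"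
    using c by (simp add: zero_le_even_power)
  have "\<bar>a + b\<bar> \<le> 2 ^ (2*m) * a ^ (2*m) / c ^ (2*m-1) + 2 * \<bar>b\<bar>" if "\<bar>a + b\<bar> > c"
  proof (cases "\<bar>b\<bar> \<le> \<bar>a\<bar>")
    case True
    have S: "Suc (2*m-1) = 2*m" using m by simp
    have "\<bar>a + b\<bar> * c ^ (2*m-1) \<le> (2 * \<bar>a\<bar>) * (2 * \<bar>a\<bar>) ^ (2*m-1)"
      using True that c by (intro mult_mono power_mono) auto
    also have "\<dots> = (2 * \<bar>a\<bar>) ^ (2*m)" by (metis S power_Suc)
    also have "\<dots> = 2 ^ (2*m) * a ^ (2*m)" by (simp add: power_mult_distrib power_even_abs)
    finally have "\<bar>a + b\<bar> \<le> 2 ^ (2*m) * a ^ (2*m) / c ^ (2*m-1)" using c by (simp add: pos_le_divide_eq)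
    then show ?thesis by simp
  next
    case False
    then show ?thesis using nn by linarith
  qed
  then show ?thesis using nn c by (cases "\<bar>a + b\<bar> > c") auto
qed

context dependent_sequence
begin

text \<open>A sum of \<open>n\<close> terms is bounded by \<open>n\<close>, so truncating it at
  \<open>n\<close> changes nothing; in this way the part \<open>B\<close>, of which only a first
  moment is known, enters a moment of order \<open>2*m\<close>. The start \<open>s = q\<close>
  leaves room for the conditioning and does not matter by stationarity.\<close>

lemma moment_recursion:
  assumes m: "m \<ge> 2" and q: "1 \<le> q" "q \<le> n" and \<Phi>: "\<And>l. l \<le> q \<Longrightarrow> moment (2*m) l \<le> \<Phi>"
  shows "moment (2*m) n \<le> 2 ^ (2*m) * block_const m * ((real n * g1_sum n) ^ m
     + real n * real q ^ (2*m-1) * g2 q + real n / real q * \<Phi>) + 64 * real n ^ (2*m) * g2 q"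
proof -
  interpret block_decomposition M Fk Y g1 g2 m n q q
    by unfold_locales (use m q in auto)
  let ?X = "(real n * (\<Sum>d<n. g1 d)) ^ m + real n * real q ^ (2*m-1) * g2 q + real n / real q * \<Phi>"
  obtain A B where AB: "bmeas M A" "bmeas M B" "\<And>x. psums q n x = A x + B x"
    "expectation (\<lambda>x. A x ^ (2*m)) \<le> block_const m * ?X"
    "expectation (\<lambda>x. \<bar>B x\<bar>) \<le> 32 * real n * g2 q"
    using block_approximation[OF \<Phi>] by blast
  have "moment (2*m) n = expectation (\<lambda>x. psums q n x ^ (2*m))" by (simp add: moment_psums)
  also have "\<dots> \<le> expectation (\<lambda>x. 2 ^ (2*m) * A x ^ (2*m) + 2 * real n ^ (2*m-1) * \<bar>B x\<bar>)"
  proof (intro integral_mono bmeas_integrable bmeas_intros psums_bmeas_M AB)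
    fix x
    have "min \<bar>A x + B x\<bar> (real n) = \<bar>psums q n x\<bar>"
      using psums_le[of q n x] by (simp flip: AB(3))
    then show "psums q n x ^ (2*m) \<le> 2 ^ (2*m) * A x ^ (2*m) + 2 * real n ^ (2*m-1) * \<bar>B x\<bar>"
      using power_add_le_truncated[of m "real n" "A x" "B x"] m by (simp add: power_even_abs)
  qed
  also have "\<dots> = 2 ^ (2*m) * expectation (\<lambda>x. A x ^ (2*m)) + 2 * real n ^ (2*m-1) * expectation (\<lambda>x. \<bar>B x\<bar>)"
    by (subst Bochner_Integration.integral_add Bochner_Integration.integral_mult_right,
        (intro bmeas_integrable bmeas_intros AB; fail)+)+ simp
  also have "\<dots> \<le> 2 ^ (2*m) * (block_const m * ?X) + 2 * real n ^ (2*m-1) * (32 * real n * g2 q)"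
    using AB by (intro add_mono mult_left_mono) auto
  also have "2 * real n ^ (2*m-1) * (32 * real n * g2 q) = 64 * real n ^ (2*m) * g2 q"
  proof -
    have "Suc (2*m-1) = 2*m" using m by simp
    then have "real n ^ (2*m) = real n ^ (2*m-1) * real n" by (metis power_Suc2)
    then show ?thesis by (simp add: mult_ac)
  qed
  finally show ?thesis by (simp only: g1_sum_def mult.assoc)
qed

end

text \<open>At least twice the factor that multiplies the block moment in
  \<open>moment_recursion\<close>: dividing by it leaves at most half of the claimed bound to the
  inductive contribution.\<close>

definition split_const :: "nat \<Rightarrow> nat" where
  "split_const m = nat \<lceil>2 * (2 ^ (2*m) * block_const m)\<rceil> + 1"

text \<open>The doubled bracket leaves room for the half taken up by the induction. The last summand
  covers lengths below \<open>split_const m\<close>, where no blocks are formed.\<close>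

definition moment_const :: "nat \<Rightarrow> real" where
  "moment_const m = 2 * (2 ^ (2*m) * block_const m + 2 ^ (2*m) * block_const m * real (2*m-2)
      + 64 * (2 * real (split_const m)) ^ (2*m-2) * real (2*m-2)) + 2 * real (split_const m) ^ (2*m-2)"

lemma moment_const_pos: "moment_const m > 0"
proof -
  have "split_const m > 0" by (simp add: split_const_def)
  then show ?thesis unfolding moment_const_def using block_const_pos[of m]
    by (intro add_nonneg_pos add_nonneg_nonneg mult_nonneg_nonneg mult_pos_pos) auto
qed

context dependent_sequence
begin

text \<open>Blocks of length \<open>q = n div split_const m\<close> multiply the block moment by about \<open>n / q\<close>; the induction
  closes because the claimed bound is quadratic in the length, at the price of one factor \<open>n\<close>.\<close>

theorem moment_le:
  assumes m: "m \<ge> 2"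
  shows "moment (2*m) n \<le> moment_const m * ((real n * g1_sum n) ^ m + (real n)\<^sup>2 * weighted_sum m n)"
proof (induction n rule: less_induct)
  case (less n)
  let ?K = "moment_const m" and ?L = "split_const m" and ?c = "2 ^ (2*m) * block_const m"
  define a where "a = (real n * g1_sum n) ^ m"
  define d where "d = (real n)\<^sup>2 * weighted_sum m n"
  have a0: "a \<ge> 0" unfolding a_def by (intro zero_le_power mult_nonneg_nonneg g1_sum_nonneg) simp
  have d0: "d \<ge> 0" unfolding d_def by (intro mult_nonneg_nonneg weighted_sum_nonneg) simp
  have c0: "?c > 0" using block_const_pos by simp
  have K0: "?K > 0" by (rule moment_const_pos)
  have L1: "?L \<ge> 1" by (simp add: split_const_def)
  have Lc: "2 * ?c \<le> real ?L" unfolding split_const_def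
    using real_nat_ceiling_ge[of "2 * ?c"] by simp
  have e: "Suc (Suc (2*m-2)) = 2*m" using m by simp
  have split_pow: "y ^ (2*m) = y\<^sup>2 * y ^ (2*m-2)" for y :: real
    by (metis e add_2_eq_Suc power_add)
  consider "n = 0" | "1 \<le> n" "n < ?L" | "?L \<le> n" by linarith
  then show ?case
  proof cases
    case 1
    then show ?thesis using m by (simp add: moment_def power_0_left)
  next
    case 2
    \<comment> \<open>For these bounded lengths all but one factor of the power is estimated by
      \<open>n\<close>, and \<open>g2 0\<close> is the first term of
      \<open>weighted_sum m n\<close>.\<close>
    have S: "Suc (2*m-1) = 2*m" using m by simp
    have "moment (2*m) n = expectation (\<lambda>x. psums 0 n x ^ (2*m))" by (simp add: moment_psums)
    also have "\<dots> \<le> expectation (\<lambda>x. real n ^ (2*m-1) * \<bar>psums 0 n x\<bar>)"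
    proof (intro integral_mono bmeas_integrable bmeas_intros psums_bmeas_M)
      fix x
      have "psums 0 n x ^ (2*m) = \<bar>psums 0 n x\<bar> ^ (2*m-1) * \<bar>psums 0 n x\<bar>"
        by (metis S power_Suc2 power_even_abs even_mult_iff even_numeral)
      also have "\<dots> \<le> real n ^ (2*m-1) * \<bar>psums 0 n x\<bar>"
        using psums_le[of 0 n x] by (intro mult_right_mono power_mono) auto
      finally show "psums 0 n x ^ (2*m) \<le> real n ^ (2*m-1) * \<bar>psums 0 n x\<bar>" .
    qed
    also have "\<dots> = real n ^ (2*m-1) * expectation (\<lambda>x. \<bar>psums 0 n x\<bar>)" by simp
    also have "\<dots> \<le> real n ^ (2*m-1) * (2 * real n * g2 0)"
      by (intro mult_left_mono abs_expectation_psums_le) auto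
    also have "\<dots> = 2 * (real n ^ (2*m-1) * real n) * g2 0" by simp
    also have "real n ^ (2*m-1) * real n = (real n)\<^sup>2 * real n ^ (2*m-2)" by (metis S power_Suc2 split_pow)
    also have "2 * ((real n)\<^sup>2 * real n ^ (2*m-2)) * g2 0 \<le> 2 * ((real n)\<^sup>2 * real ?L ^ (2*m-2)) * weighted_sum m n"
    proof (intro mult_mono mult_left_mono power_mono)
      have "weighted_sum m 1 \<le> weighted_sum m n" using 2 by (intro weighted_sum_mono) auto
      then show "g2 0 \<le> weighted_sum m n" by (simp add: weighted_sum_def)
    qed (use 2 in \<open>auto intro!: g2_nonneg\<close>)
    also have "\<dots> = (2 * real ?L ^ (2*m-2)) * d" by (simp add: d_def)
    also have "\<dots> \<le> ?K * (a + d)"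
    proof (intro mult_mono)
      show "2 * real ?L ^ (2*m-2) \<le> ?K" unfolding moment_const_def using c0 by simp
    qed (use a0 d0 K0 in auto)
    finally show ?thesis by (simp add: a_def d_def)
  next
    case 3
    define q where "q = n div ?L"
    have q1: "1 \<le> q" using 3 L1 by (simp add: q_def div_greater_zero_iff Suc_le_eq)
    have qL: "q * ?L \<le> n" by (simp add: q_def)
    have nq: "n \<le> 2 * ?L * q"
    proof -
      have "n < q * ?L + ?L" using L1 unfolding q_def
        by (metis add.commute add_less_cancel_left div_mult_mod_eq mod_less_divisor less_le_trans zero_less_one)
      also have "\<dots> \<le> q * ?L + q * ?L" using q1 by simp
      also have "\<dots> = 2 * ?L * q" by (simp only: mult_2 distrib_right mult.commute)
      finally show ?thesis by (rule less_imp_le)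
    qed
    have L2: "?L > 1" 
    proof -
      have "2 ^ (2*m) * block_const m > 0" by (rule c0)
      then have "\<lceil>2 * (2 ^ (2*m) * block_const m)\<rceil> > 0" by simp
      then show ?thesis by (simp add: split_const_def)
    qed
    have qn: "q < n"
      unfolding q_def using L2 3 L1 by (intro div_less_dividend) auto
    have Lpos: "real ?L > 0" using L1 by simp
    have qr: "real q \<le> real n / real ?L"
      using qL Lpos by (simp add: field_simps flip: of_nat_mult)
    define \<Phi> where "\<Phi> = ?K * ((real q * g1_sum n) ^ m + (real q)\<^sup>2 * weighted_sum m n)"
    have \<Phi>: "moment (2*m) l \<le> \<Phi>" if "l \<le> q" for l
    proof -
      have "moment (2*m) l \<le> ?K * ((real l * g1_sum l) ^ m + (real l)\<^sup>2 * weighted_sum m l)"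
        using that qn by (intro less) auto
      also have "\<dots> \<le> \<Phi>"
        unfolding \<Phi>_def using that qn K0
        by (intro mult_left_mono add_mono power_mono mult_mono g1_sum_mono weighted_sum_mono)
           (auto intro!: g1_sum_nonneg weighted_sum_nonneg mult_nonneg_nonneg)
      finally show ?thesis .
    qed
    \<comment> \<open>As \<open>m \<ge> 2\<close>, both parts of \<open>\<Phi>\<close> fall short of
      their values at \<open>n\<close> by at least the factor \<open>(q / n) ^ 2\<close>. One factor
      \<open>q / n\<close> pays for the number of blocks, the other is at most
      \<open>1 / ?L\<close>.\<close>
    have A: "real n / real q * \<Phi> \<le> ?K / real ?L * (a + d)"
    proof -
      have qpos: "real q > 0" using q1 by simp
      have r: "real q / real n \<le> 1 / real ?L" "0 \<le> real q / real n" "real q / real n \<le> 1"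
        using qr qn L1 by (auto simp: field_simps)
      have n0: "real n > 0" using qn by simp
      have "real n / real q * (real q * g1_sum n) ^ m = (real q / real n) ^ (m-1) * a"
      proof -
        have "m = Suc (m-1)" using m by simp
        then obtain k where k: "m = Suc k" by blast
        show ?thesis using qpos n0 by (simp add: k a_def field_simps)
      qed
      also have "\<dots> \<le> (1 / real ?L) * a"
      proof (rule mult_right_mono[OF _ a0])
        have "(real q / real n) ^ (m-1) \<le> (real q / real n) ^ 1"
          using r m by (intro power_decreasing) auto
        then show "(real q / real n) ^ (m-1) \<le> 1 / real ?L" using r by simp
      qed
      finally have 1: "real n / real q * (real q * g1_sum n) ^ m \<le> (1 / real ?L) * a" .
      have "real n / real q * ((real q)\<^sup>2 * weighted_sum m n) = real n * real q * weighted_sum m n"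
        using qpos by (simp add: power2_eq_square)
      also have "\<dots> \<le> real n * (real n / real ?L) * weighted_sum m n"
        using qr by (intro mult_right_mono mult_left_mono weighted_sum_nonneg) auto
      also have "\<dots> = (1 / real ?L) * d" by (simp add: d_def power2_eq_square)
      finally have 2: "real n / real q * ((real q)\<^sup>2 * weighted_sum m n) \<le> (1 / real ?L) * d" .
      have "real n / real q * \<Phi> = ?K * (real n / real q * (real q * g1_sum n) ^ m
          + real n / real q * ((real q)\<^sup>2 * weighted_sum m n))"
        unfolding \<Phi>_def by (simp only: distrib_left mult.left_commute)
      also have "\<dots> \<le> ?K * ((1 / real ?L) * a + (1 / real ?L) * d)"
        using 1 2 K0 by (intro mult_left_mono add_mono) auto
      also have "\<dots> = ?K / real ?L * (a + d)" by (simp add: distrib_left)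
      finally show ?thesis .
    qed
    have W: "real q ^ (2*m-2) * g2 q \<le> real (2*m-2) * weighted_sum m n"
      using order_trans[OF power_g2_le_weighted_sum[OF m, of q] mult_left_mono[OF weighted_sum_mono[of q n m]]] qn
      by simp
    have B: "real n * real q ^ (2*m-1) * g2 q \<le> real (2*m-2) * d"
    proof -
      have "Suc (2*m-2) = 2*m-1" using m by simp
      then have "real q ^ (2*m-1) = real q * real q ^ (2*m-2)" by (metis power_Suc)
      then have "real n * real q ^ (2*m-1) * g2 q = real n * real q * (real q ^ (2*m-2) * g2 q)" by simp
      also have "\<dots> \<le> real n * real n * (real (2*m-2) * weighted_sum m n)"
        by (rule mult_mono[OF _ W]) (use qn in \<open>auto intro!: mult_left_mono mult_nonneg_nonneg g2_nonneg\<close>)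
      finally show ?thesis by (simp only: d_def power2_eq_square mult_ac)
    qed
    \<comment> \<open>\<open>q\<close> is comparable to \<open>n\<close>, so powers of
      \<open>n\<close> may be exchanged for powers of \<open>q\<close> at the cost of a
      constant.\<close>
    have C: "real n ^ (2*m) * g2 q \<le> (2 * real ?L) ^ (2*m-2) * (real (2*m-2) * d)"
    proof -
      have "real n \<le> (2 * real ?L) * real q"
        using nq by (metis of_nat_le_iff of_nat_mult of_nat_numeral)
      then have "real n ^ (2*m-2) \<le> ((2 * real ?L) * real q) ^ (2*m-2)" by (intro power_mono) auto
      then have "real n ^ (2*m) * g2 q \<le> ((real n)\<^sup>2 * ((2 * real ?L) * real q) ^ (2*m-2)) * g2 q"
        unfolding split_pow by (intro mult_right_mono mult_left_mono g2_nonneg) auto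
      also have "\<dots> = (2 * real ?L) ^ (2*m-2) * ((real n)\<^sup>2 * (real q ^ (2*m-2) * g2 q))"
        by (simp add: power_mult_distrib)
      also have "\<dots> \<le> (2 * real ?L) ^ (2*m-2) * ((real n)\<^sup>2 * (real (2*m-2) * weighted_sum m n))"
        using W by (intro mult_left_mono) auto
      finally show ?thesis by (simp add: d_def mult_ac)
    qed
    have "moment (2*m) n \<le> ?c * (a + real n * real q ^ (2*m-1) * g2 q + real n / real q * \<Phi>) + 64 * real n ^ (2*m) * g2 q"
      unfolding a_def using moment_recursion[OF m q1 less_imp_le[OF qn] \<Phi>] by simp
    also have "\<dots> \<le> ?c * (a + real (2*m-2) * d + ?K / real ?L * (a + d))
        + 64 * ((2 * real ?L) ^ (2*m-2) * (real (2*m-2) * d))"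
      using A B C c0 by (intro add_mono mult_left_mono) auto
    also have "\<dots> = ?c * a + (?c * real (2*m-2) + 64 * (2 * real ?L) ^ (2*m-2) * real (2*m-2)) * d
        + (?c / real ?L) * (?K * (a + d))"
      by (simp add: algebra_simps)
    also have "\<dots> \<le> (?K / 2) * a + (?K / 2) * d + (1/2) * (?K * (a + d))"
    proof (intro add_mono mult_right_mono)
      show "?c / real ?L \<le> 1/2" using Lc L1 by (simp add: field_simps)
      show "?c \<le> ?K / 2" unfolding moment_const_def using c0 by simp
      show "?c * real (2*m-2) + 64 * (2 * real ?L) ^ (2*m-2) * real (2*m-2) \<le> ?K / 2"
        unfolding moment_const_def using c0 by simp
    qed (use a0 d0 K0 in auto)
    also have "\<dots> = ?K * (a + d)" by (simp add: algebra_simps)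
    finally show ?thesis by (simp add: a_def d_def)
  qed
qed

end

section \<open>Truncation at an explicit level\<close>

text \<open>The product serves proper blocks, the last summand the case of a single block,
  \<open>q = n\<close>.\<close>

definition decomposition_const :: "nat \<Rightarrow> real" where
  "decomposition_const m = block_const m * (real (2*m-1) + moment_const m) + moment_const m"

definition truncation_const :: "nat \<Rightarrow> real" where
  "truncation_const m = 2 ^ (2*m) * decomposition_const m + 64"

lemma decomposition_const_pos: "decomposition_const m > 0"
  unfolding decomposition_const_def using block_const_pos[of m] moment_const_pos[of m]
  by (intro add_nonneg_pos mult_nonneg_nonneg add_nonneg_nonneg) auto

lemma truncation_const_pos: "truncation_const m > 0"
  unfolding truncation_const_def using decomposition_const_pos[of m] by (intro add_pos_pos mult_pos_pos) auto

text \<open>The level at which \<open>\<bar>Z\<bar>\<close> is cut in the proof of \<open>truncation\<close>: it balances the two parts of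
  the decomposition and, unlike them, depends measurably on the parameters.\<close>

definition truncation_level :: "nat \<Rightarrow> nat \<Rightarrow> real \<Rightarrow> real \<Rightarrow> real" where
  "truncation_level m n a b = (if b = 0 then real n else root (2*m-1) (a / b))"

lemma truncation_level_nonneg: "a \<ge> 0 \<Longrightarrow> b \<ge> 0 \<Longrightarrow> truncation_level m n a b \<ge> 0"
  unfolding truncation_level_def by (cases "2*m-1 = 0") auto

text \<open>For nonzero \<open>b\<close> the level \<open>c\<close> satisfies
  \<open>c ^ (2*m-1) * b = a\<close>. Below the level \<open>B\<close> contributes
  \<open>c ^ (2*m-1) * b\<close>, which is \<open>a\<close>; above it \<open>A\<close> contributes
  \<open>a / c ^ (2*m-1)\<close>, which is \<open>b\<close>. Each of the two estimates thus sees
  both parts on its own scale.\<close>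

lemma (in prob_space) truncation_of_sum:
  assumes AB: "bmeas M A" "bmeas M B" "\<And>x. Z x = A x + B x" and Z: "\<And>x. \<bar>Z x\<bar> \<le> real n"
    and a: "a \<ge> 0" "expectation (\<lambda>x. A x ^ (2*m)) \<le> d * a" and d: "d \<ge> 0"
    and b: "b \<ge> 0" "expectation (\<lambda>x. \<bar>B x\<bar>) \<le> 32 * b" and m: "m \<ge> 1"
  shows "expectation (\<lambda>x. min \<bar>Z x\<bar> (truncation_level m n a b) ^ (2*m)) \<le> (2 ^ (2*m) * d + 64) * a"
    and "expectation (\<lambda>x. max 0 (\<bar>Z x\<bar> - truncation_level m n a b)) \<le> (2 ^ (2*m) * d + 64) * b"
proof -
  let ?c = "truncation_level m n a b"
  have c0: "?c \<ge> 0" by (rule truncation_level_nonneg[OF a(1) b(1)])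
  have "bmeas M (\<lambda>x. A x + B x)" by (intro bmeas_intros AB)
  then have ZM: "bmeas M Z" by (simp flip: AB(3))
  note bi = bmeas_integrable bmeas_intros AB(1,2) ZM
  have ab: "?c ^ (2*m-1) * b = a" if "b \<noteq> 0"
  proof -
    have "root (2*m-1) (a / b) ^ (2*m-1) = a / b" using a b m by (intro real_root_pow_pos2) auto
    then show ?thesis using that by (simp add: truncation_level_def)
  qed
  have "expectation (\<lambda>x. min \<bar>Z x\<bar> ?c ^ (2*m)) \<le> expectation (\<lambda>x. 2 ^ (2*m) * A x ^ (2*m) + 2 * ?c ^ (2*m-1) * \<bar>B x\<bar>)"
    by (intro integral_mono bi) (use power_add_le_truncated[OF m c0] in \<open>simp add: AB(3)\<close>)
  also have "\<dots> = 2 ^ (2*m) * expectation (\<lambda>x. A x ^ (2*m)) + 2 * ?c ^ (2*m-1) * expectation (\<lambda>x. \<bar>B x\<bar>)"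
    by (subst Bochner_Integration.integral_add Bochner_Integration.integral_mult_right, (intro bi; fail)+)+ simp
  also have "\<dots> \<le> 2 ^ (2*m) * (d * a) + 2 * ?c ^ (2*m-1) * (32 * b)"
    using a b c0 by (intro add_mono mult_left_mono) auto
  also have "\<dots> = 2 ^ (2*m) * (d * a) + 64 * (?c ^ (2*m-1) * b)" by simp
  also have "\<dots> \<le> 2 ^ (2*m) * (d * a) + 64 * a"
    using ab a by (cases "b = 0") auto
  finally show "expectation (\<lambda>x. min \<bar>Z x\<bar> ?c ^ (2*m)) \<le> (2 ^ (2*m) * d + 64) * a"
    by (simp add: algebra_simps)
  have exc: "expectation (\<lambda>x. max 0 (\<bar>Z x\<bar> - e)) \<le> 2 ^ (2*m) * (d * a) / e ^ (2*m-1) + 64 * b" if "e > 0" for e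
  proof -
    have "expectation (\<lambda>x. max 0 (\<bar>Z x\<bar> - e)) \<le> expectation (\<lambda>x. (2 ^ (2*m) / e ^ (2*m-1)) * A x ^ (2*m) + 2 * \<bar>B x\<bar>)"
      by (intro integral_mono bi) (use excess_le_power[OF m that] in \<open>simp add: AB(3)\<close>)
    also have "\<dots> = (2 ^ (2*m) / e ^ (2*m-1)) * expectation (\<lambda>x. A x ^ (2*m)) + 2 * expectation (\<lambda>x. \<bar>B x\<bar>)"
      by (subst Bochner_Integration.integral_add Bochner_Integration.integral_mult_right, (intro bi; fail)+)+ simp
    also have "\<dots> \<le> (2 ^ (2*m) / e ^ (2*m-1)) * (d * a) + 2 * (32 * b)"
      using a b that by (intro add_mono mult_left_mono) auto
    finally show ?thesis by simp
  qed
  show "expectation (\<lambda>x. max 0 (\<bar>Z x\<bar> - ?c)) \<le> (2 ^ (2*m) * d + 64) * b"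
  proof (cases "b = 0")
    case True
    \<comment> \<open>With \<open>b = 0\<close> the level is \<open>n\<close>, a bound for
      \<open>Z\<close>, so there is no excess at all.\<close>
    then have "max 0 (\<bar>Z x\<bar> - ?c) = 0" for x using Z[of x] by (simp add: truncation_level_def)
    then show ?thesis using True by simp
  next
    case False
    then have b0: "b > 0" using b by simp
    show ?thesis
    proof (cases "a = 0")
      case True
      \<comment> \<open>The level is 0 and cannot be divided by. It is approached by levels
        \<open>e > 0\<close>, at each of which the contribution of \<open>A\<close> is already
        zero.\<close>
      then have c: "?c = 0" using m False by (simp add: truncation_level_def)
      have "expectation (\<lambda>x. max 0 (\<bar>Z x\<bar> - ?c)) \<le> 64 * b + e" if "e > 0" for e
      proof -
        have "expectation (\<lambda>x. max 0 (\<bar>Z x\<bar> - ?c)) \<le> expectation (\<lambda>x. max 0 (\<bar>Z x\<bar> - e) + e)"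
          by (intro integral_mono bi) (use that c in auto)
        also have "\<dots> = expectation (\<lambda>x. max 0 (\<bar>Z x\<bar> - e)) + e"
          by (subst Bochner_Integration.integral_add, (intro bi; fail)+) (simp add: prob_space)
        also have "\<dots> \<le> 64 * b + e" using exc[OF that] True by simp
        finally show ?thesis .
      qed
      then have "expectation (\<lambda>x. max 0 (\<bar>Z x\<bar> - ?c)) \<le> 64 * b" by (rule field_le_epsilon)
      also have "\<dots> \<le> (2 ^ (2*m) * d + 64) * b" using d b by (intro mult_right_mono) auto
      finally show ?thesis .
    next
      case nz: False
      then have cp: "?c > 0" using a b0 False m by (simp add: truncation_level_def)
      have "a / ?c ^ (2*m-1) = b" using ab[OF False] cp by (simp add: field_simps)
      then have "2 ^ (2*m) * (d * a) / ?c ^ (2*m-1) = 2 ^ (2*m) * d * b" by (metis mult.assoc times_divide_eq_right)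
      then show ?thesis using exc[OF cp] by (simp add: algebra_simps)
    qed
  qed
qed

context dependent_sequence
begin

text \<open>About \<open>n / q\<close> blocks have moments of order
  \<open>q ^ 2 * weighted_sum m q\<close> each; this, added to the Gaussian part, is the size of the
  moment of \<open>A\<close>.\<close>

definition gauss_jump :: "nat \<Rightarrow> nat \<Rightarrow> nat \<Rightarrow> real" where
  "gauss_jump m n q = (real n * g1_sum n) ^ m + real n * real q * weighted_sum m q"

text \<open>For \<open>q = n\<close> the sum is a single block and goes into \<open>A\<close>
  unchanged, so nothing is left for \<open>B\<close>.\<close>

definition tail_cost :: "nat \<Rightarrow> nat \<Rightarrow> real" where
  "tail_cost n q = real n * (if q < n then g2 q else 0)"

lemma gauss_jump_nonneg: "0 \<le> gauss_jump m n q"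
  unfolding gauss_jump_def
  by (intro add_nonneg_nonneg zero_le_power mult_nonneg_nonneg g1_sum_nonneg weighted_sum_nonneg) auto

lemma tail_cost_nonneg: "0 \<le> tail_cost n q"
  unfolding tail_cost_def using g2_nonneg by simp

text \<open>The sums start at index \<open>n\<close>, so that conditioning \<open>q \<le> n\<close> steps earlier stays at nonnegative times.\<close>

lemma decomposition:
  assumes m: "m \<ge> 2" and q: "q \<le> n"
  obtains A B where "bmeas M A" "bmeas M B" "\<And>x. psums n n x = A x + B x"
    "expectation (\<lambda>x. A x ^ (2*m)) \<le> decomposition_const m * gauss_jump m n q"
    "expectation (\<lambda>x. \<bar>B x\<bar>) \<le> 32 * tail_cost n q"
proof -
  note gj0 = gauss_jump_nonneg[of m n q]
  let ?K = "moment_const m"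
  have K0: "?K > 0" by (rule moment_const_pos)
  \<comment> \<open>At the two ends no blocks are formed: \<open>q = n\<close> puts the whole sum
    into \<open>A\<close>, and \<open>q = 0\<close> puts it into \<open>B\<close>.\<close>
  consider "q = n" | "q = 0" "q < n" | "1 \<le> q" "q < n" using q by linarith
  then show ?thesis
  proof cases
    case 1
    have "moment (2*m) n \<le> ?K * gauss_jump m n q"
      using moment_le[OF m, of n] 1 by (simp add: gauss_jump_def power2_eq_square)
    also have "\<dots> \<le> decomposition_const m * gauss_jump m n q"
      using gj0 block_const_pos[of m] K0 unfolding decomposition_const_def by (intro mult_right_mono) auto
    finally show ?thesis
      using 1 by (intro that[of "psums n n" "\<lambda>_. 0"]) (auto intro: psums_bmeas_M simp: moment_psums tail_cost_def)
  next
    case 2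
    have "expectation (\<lambda>x. \<bar>psums n n x\<bar>) \<le> 2 * real n * g2 0" by (rule abs_expectation_psums_le)
    also have "\<dots> \<le> 32 * tail_cost n q"
      using 2 g2_nonneg[of 0] by (simp add: tail_cost_def)
    finally show ?thesis
      using m gj0 decomposition_const_pos[of m]
      by (intro that[of "\<lambda>_. 0" "psums n n"]) (auto intro: psums_bmeas_M simp: power_0_left)
  next
    case 3
    interpret block_decomposition M Fk Y g1 g2 m n q n
      by unfold_locales (use m 3 in auto)
    define \<Phi> where "\<Phi> = ?K * ((real q * g1_sum n) ^ m + (real q)\<^sup>2 * weighted_sum m q)"
    have \<Phi>: "moment (2*m) l \<le> \<Phi>" if "l \<le> q" for l
    proof -
      have "moment (2*m) l \<le> ?K * ((real l * g1_sum l) ^ m + (real l)\<^sup>2 * weighted_sum m l)"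
        by (rule moment_le[OF \<open>2 \<le> m\<close>])
      also have "\<dots> \<le> \<Phi>"
        unfolding \<Phi>_def using that 3 K0
        by (intro mult_left_mono add_mono power_mono mult_mono g1_sum_mono weighted_sum_mono)
           (auto intro!: g1_sum_nonneg weighted_sum_nonneg mult_nonneg_nonneg)
      finally show ?thesis .
    qed
    let ?X = "(real n * (\<Sum>d<n. g1 d)) ^ m + real n * real q ^ (2*m-1) * g2 q + real n / real q * \<Phi>"
    define a where "a = (real n * g1_sum n) ^ m"
    define w where "w = real n * real q * weighted_sum m q"
    have a0: "a \<ge> 0" unfolding a_def by (intro zero_le_power mult_nonneg_nonneg g1_sum_nonneg) simp
    have w0: "w \<ge> 0" unfolding w_def by (intro mult_nonneg_nonneg weighted_sum_nonneg) auto
    have 1: "real n * real q ^ (2*m-1) * g2 q \<le> real (2*m-2) * w"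
    proof -
      have "Suc (2*m-2) = 2*m-1" using m by simp
      then have "real q ^ (2*m-1) = real q * real q ^ (2*m-2)" by (metis power_Suc)
      then have "real n * real q ^ (2*m-1) * g2 q = real n * real q * (real q ^ (2*m-2) * g2 q)" by simp
      also have "\<dots> \<le> real n * real q * (real (2*m-2) * weighted_sum m q)"
        using \<open>2 \<le> m\<close> by (intro mult_left_mono power_g2_le_weighted_sum) auto
      finally show ?thesis by (simp add: w_def mult_ac)
    qed
    have 2: "real n / real q * \<Phi> \<le> ?K * (a + w)"
    proof -
      have qpos: "real q > 0" using 3 by simp
      have n0: "real n > 0" using 3 by simp
      have "real n / real q * (real q * g1_sum n) ^ m = (real q / real n) ^ (m-1) * a"
      proof -
        have "m = Suc (m-1)" using \<open>2 \<le> m\<close> by simp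
        then obtain k where k: "m = Suc k" by blast
        show ?thesis using qpos n0 by (simp add: k a_def field_simps)
      qed
      also have "\<dots> \<le> 1 * a"
        using 3 a0 by (intro mult_right_mono power_le_one) auto
      finally have i: "real n / real q * (real q * g1_sum n) ^ m \<le> a" by simp
      have ii: "real n / real q * ((real q)\<^sup>2 * weighted_sum m q) = w"
        using qpos by (simp add: power2_eq_square w_def)
      have "real n / real q * \<Phi> = ?K * (real n / real q * (real q * g1_sum n) ^ m
          + real n / real q * ((real q)\<^sup>2 * weighted_sum m q))"
        unfolding \<Phi>_def by (simp only: distrib_left mult.left_commute)
      also have "\<dots> \<le> ?K * (a + w)" using i ii K0 by (intro mult_left_mono) auto
      finally show ?thesis .
    qed
    have "block_const m * ?X \<le> block_const m * (a + real (2*m-2) * w + ?K * (a + w))"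
      using 1 2 block_const_pos[of m] by (intro mult_left_mono add_mono) (auto simp: a_def g1_sum_def)
    also have "\<dots> \<le> block_const m * ((real (2*m-1) + ?K) * (a + w))"
    proof -
      have "a + real (2*m-2) * w \<le> real (2*m-1) * a + real (2*m-1) * w"
        using a0 w0 \<open>2 \<le> m\<close> mult_right_mono[of 1 "real (2*m-1)" a] mult_right_mono[of "real (2*m-2)" "real (2*m-1)" w] by auto
      then show ?thesis using block_const_pos[of m] by (intro mult_left_mono) (auto simp: algebra_simps)
    qed
    also have "\<dots> \<le> decomposition_const m * (a + w)"
      unfolding decomposition_const_def using a0 w0 K0 by (simp add: distrib_right mult.assoc)
    finally have X: "block_const m * ?X \<le> decomposition_const m * gauss_jump m n q"
      by (simp add: gauss_jump_def a_def w_def)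
    show ?thesis
    proof (rule block_approximation[OF \<Phi>])
      fix A B assume "bmeas M A" "bmeas M B" "\<And>x. psums n n x = A x + B x"
        "expectation (\<lambda>x. A x ^ (2*m)) \<le> block_const m * ?X"
        "expectation (\<lambda>x. \<bar>B x\<bar>) \<le> 32 * real n * g2 q"
      then show ?thesis using X 3 by (intro that[of A B]) (auto simp: tail_cost_def)
    qed
  qed
qed

theorem truncation:
  assumes m: "m \<ge> 2" and q: "q \<le> n"
  defines "c \<equiv> truncation_level m n (gauss_jump m n q) (tail_cost n q)"
  shows "expectation (\<lambda>x. min \<bar>psums n n x\<bar> c ^ (2*m)) \<le> truncation_const m * gauss_jump m n q"
    and "expectation (\<lambda>x. max 0 (\<bar>psums n n x\<bar> - c)) \<le> truncation_const m * tail_cost n q"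
proof -
  obtain A B where AB: "bmeas M A" "bmeas M B" "\<And>x. psums n n x = A x + B x"
    "expectation (\<lambda>x. A x ^ (2*m)) \<le> decomposition_const m * gauss_jump m n q"
    "expectation (\<lambda>x. \<bar>B x\<bar>) \<le> 32 * tail_cost n q"
    using decomposition[OF m q] by blast
  have m1: "m \<ge> 1" using m by simp
  note T = truncation_of_sum[OF AB(1-3) psums_le gauss_jump_nonneg AB(4)
      less_imp_le[OF decomposition_const_pos] tail_cost_nonneg AB(5) m1]
  show "expectation (\<lambda>x. min \<bar>psums n n x\<bar> c ^ (2*m)) \<le> truncation_const m * gauss_jump m n q"
    using T(1) by (simp only: c_def truncation_const_def)
  show "expectation (\<lambda>x. max 0 (\<bar>psums n n x\<bar> - c)) \<le> truncation_const m * tail_cost n q"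
    using T(2) by (simp only: c_def truncation_const_def)
qed

end

section \<open>Weighted integrals and tails\<close>

lemma nn_integral_powr_from_0:
  fixes a c :: real
  assumes "a > -1" "c \<ge> 0"
  shows "(\<integral>\<^sup>+x. ennreal (x powr a) * indicator {0..c} x \<partial>lborel) = ennreal (c powr (a+1) / (a+1))"
  by (rule nn_integral_has_integral_lebesgue'[OF _ has_integral_powr_from_0]) (use assms in auto)

lemma nn_integral_powr_to_inf:
  fixes a e :: real
  assumes "e < -1" "a > 0"
  shows "(\<integral>\<^sup>+x. ennreal (x powr e) * indicator {a..} x \<partial>lborel) = ennreal (a powr (e+1) / (- e - 1))"
proof -
  have "(\<integral>\<^sup>+x. ennreal (x powr e) * indicator {a..} x \<partial>lborel) = ennreal (- (a powr (e+1)) / (e+1))"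
    by (rule nn_integral_has_integral_lebesgue'[OF _ has_integral_powr_to_inf]) (use assms in auto)
  also have "- (a powr (e+1)) / (e+1) = a powr (e+1) / (- e - 1)"
    using assms by (simp add: field_simps)
  finally show ?thesis .
qed

text \<open>Levels are counted in multiples of \<open>c\<close>, so that a tail bound at level
  \<open>c * l\<close> can be inserted directly. For infinite \<open>G\<close> the integral exceeds
  \<open>K powr p\<close> for every \<open>K\<close>.\<close>

lemma ennpowr_le_layer_cake:
  fixes p c :: real
  assumes p: "p > 0" and c: "c > 0"
  shows "ennpowr G p \<le> ennreal (c powr p) *
     (\<integral>\<^sup>+l. ennreal (p * l powr (p - 1)) * indicator {0<..} l * (if ennreal (c * l) < G then 1 else 0) \<partial>lborel)"
    (is "_ \<le> _ * ?I")
proof -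
  have lower: "ennreal (K powr p) \<le> ?I" if K: "K \<ge> 0" "ennreal (c * K) \<le> G" for K
  proof -
    have "ennreal (K powr p) = ennreal p * ennreal (K powr (p - 1 + 1) / (p - 1 + 1))"
      using p by (simp flip: ennreal_mult)
    also have "\<dots> = ennreal p * (\<integral>\<^sup>+x. ennreal (x powr (p - 1)) * indicator {0..K} x \<partial>lborel)"
      using p K by (subst nn_integral_powr_from_0) auto
    also have "\<dots> = (\<integral>\<^sup>+x. ennreal p * (ennreal (x powr (p - 1)) * indicator {0..K} x) \<partial>lborel)"
      by (rule nn_integral_cmult[symmetric]) auto
    also have "\<dots> \<le> ?I"
    proof (rule nn_integral_mono_AE)
      have "AE x in lborel. x \<noteq> K" "AE x in lborel. x \<noteq> (0::real)" by (rule AE_lborel_singleton)+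
      then show "AE x in lborel. ennreal p * (ennreal (x powr (p - 1)) * indicator {0..K} x)
          \<le> ennreal (p * x powr (p - 1)) * indicator {0<..} x * (if ennreal (c * x) < G then 1 else 0)"
      proof eventually_elim
        case (elim x)
        show ?case
        proof (cases "x \<in> {0..K}")
          case True
          then have x: "0 < x" "x < K" using elim by auto
          then have "ennreal (c * x) < ennreal (c * K)"
            using c by (intro ennreal_lessI) auto
          then have "ennreal (c * x) < G" using K(2) by (rule less_le_trans)
          then show ?thesis using x p by (simp add: ennreal_mult)
        qed simp
      qed
    qed
    finally show ?thesis .
  qed
  show ?thesis
  proof (cases G)
    case (real g)
    then have "ennreal ((g / c) powr p) \<le> ?I" using c by (intro lower) auto
    then have "ennreal (c powr p) * ennreal ((g / c) powr p) \<le> ennreal (c powr p) * ?I"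
      by (rule mult_left_mono) simp
    moreover have "ennreal (c powr p) * ennreal ((g / c) powr p) = ennpowr G p"
      using real c by (simp add: ennpowr_def powr_divide flip: ennreal_mult)
    ultimately show ?thesis by simp
  next
    case top
    have "?I = top"
    proof (rule ccontr)
      assume "?I \<noteq> top"
      then obtain r where r: "r \<ge> 0" "?I = ennreal r" by (cases ?I) auto
      have "ennreal (((r + 1) powr (1/p)) powr p) \<le> ?I" by (rule lower) (use top in auto)
      then have "ennreal (r + 1) \<le> ennreal r" using r p by (simp add: powr_powr)
      then show False using r by simp
    qed
    then show ?thesis using c by (simp add: ennreal_mult_top)
  qed
qed

text \<open>Jensen's inequality for the density \<open>w / \<integral>w\<close>; points with \<open>w = 0\<close> are covered by \<open>x / 0 = 0\<close>.\<close>

lemma nn_integral_power_le_weighted: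
  fixes f w :: "'b \<Rightarrow> real"
  assumes [measurable]: "f \<in> borel_measurable N" "w \<in> borel_measurable N"
    and f: "\<And>x. 0 \<le> f x" and w: "\<And>x. 0 \<le> w x" and fw: "\<And>x. w x = 0 \<Longrightarrow> f x = 0" and m: "m \<ge> 1"
  shows "(\<integral>\<^sup>+x. f x \<partial>N) ^ (2*m) \<le> (\<integral>\<^sup>+x. w x \<partial>N) ^ (2*m-1) * (\<integral>\<^sup>+x. ennreal (f x ^ (2*m) / w x ^ (2*m-1)) \<partial>N)"
    (is "?I ^ _ \<le> ?W ^ _ * ?R")
proof -
  have S: "Suc (2*m-1) = 2*m" using m by simp
  have pt: "real (2*m) * y ^ (2*m-1) * f x \<le> f x ^ (2*m) / w x ^ (2*m-1) + real (2*m-1) * y ^ (2*m) * w x"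
    if "y \<ge> 0" for x y
  proof (cases "w x = 0")
    case True
    then show ?thesis using fw m by (simp add: power_0_left)
  next
    case False
    then have wx: "w x > 0" using w[of x] by simp
    have "y ^ (2 * m) + real (2 * m) * (y ^ (2 * m-1) * (f x / w x - y)) \<le> (f x / w x) ^ (2 * m)"
      by (rule power_even_tangent)
    then have "(y ^ (2 * m) + real (2 * m) * (y ^ (2 * m-1) * (f x / w x - y))) * w x \<le> (f x / w x) ^ (2 * m) * w x"
      using wx by (intro mult_right_mono) auto
    moreover have "(f x / w x) ^ (2*m) * w x = f x ^ (2*m) / w x ^ (2*m-1)"
    proof -
      have "w x ^ (2*m) = w x ^ (2*m-1) * w x" by (metis S power_Suc2)
      then show ?thesis using wx by (simp add: power_divide)
    qed
    moreover have "(y ^ (2 * m) + real (2 * m) * (y ^ (2 * m-1) * (f x / w x - y))) * w x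
        = real (2*m) * y ^ (2*m-1) * f x - real (2*m-1) * y ^ (2*m) * w x"
    proof -
      have y: "y ^ (2*m) = y ^ (2*m-1) * y" by (metis S power_Suc2)
      have r: "real (2*m) = real (2*m-1) + 1" using m by (simp add: of_nat_diff)
      show ?thesis unfolding y r using wx by (simp add: field_simps)
    qed
    ultimately show ?thesis by linarith
  qed
  have int: "ennreal (real (2*m) * y ^ (2*m-1)) * ?I \<le> ?R + ennreal (real (2*m-1) * y ^ (2*m)) * ?W" if y: "y \<ge> 0" for y
  proof -
    have "ennreal (real (2*m) * y ^ (2*m-1)) * ?I = (\<integral>\<^sup>+x. ennreal (real (2*m) * y ^ (2*m-1)) * f x \<partial>N)"
      by (rule nn_integral_cmult[symmetric]) simp
    also have "\<dots> \<le> (\<integral>\<^sup>+x. ennreal (f x ^ (2*m) / w x ^ (2*m-1)) + ennreal (real (2*m-1) * y ^ (2*m)) * w x \<partial>N)"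
    proof (rule nn_integral_mono)
      fix x
      have "ennreal (real (2*m) * y ^ (2*m-1)) * f x = ennreal (real (2*m) * y ^ (2*m-1) * f x)"
        using y f by (simp add: ennreal_mult)
      also have "\<dots> \<le> ennreal (f x ^ (2*m) / w x ^ (2*m-1) + real (2*m-1) * y ^ (2*m) * w x)"
        by (intro ennreal_leI pt y)
      also have "\<dots> = ennreal (f x ^ (2*m) / w x ^ (2*m-1)) + ennreal (real (2*m-1) * y ^ (2*m) * w x)"
        using y f[of x] w[of x] by (intro ennreal_plus) auto
      also have "ennreal (real (2*m-1) * y ^ (2*m) * w x) = ennreal (real (2*m-1) * y ^ (2*m)) * w x"
        using y w by (simp add: ennreal_mult)
      finally show "ennreal (real (2*m) * y ^ (2*m-1)) * f x
          \<le> ennreal (f x ^ (2*m) / w x ^ (2*m-1)) + ennreal (real (2*m-1) * y ^ (2*m)) * w x" .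
    qed
    also have "\<dots> = ?R + ennreal (real (2*m-1) * y ^ (2*m)) * ?W"
      by (subst nn_integral_add) (auto simp: nn_integral_cmult)
    finally show ?thesis .
  qed
  have zero: "?I = 0" if "AE x in N. f x = 0"
    using that by (subst nn_integral_0_iff_AE) auto
  show ?thesis
  proof (cases "?I = 0")
    case True then show ?thesis using m by (simp add: power_0_left)
  next
    case False
    have W0: "?W \<noteq> 0"
    proof
      assume "?W = 0"
      then have "AE x in N. w x \<le> 0" by (subst (asm) nn_integral_0_iff_AE) (auto simp: ennreal_eq_0_iff)
      then have "AE x in N. f x = 0" by eventually_elim (use w fw in \<open>auto intro: antisym\<close>)
      then show False using zero False by simp
    qed
    have R0: "?R \<noteq> 0"
    proof
      assume "?R = 0"
      then have "AE x in N. f x ^ (2*m) / w x ^ (2*m-1) \<le> 0" by (subst (asm) nn_integral_0_iff_AE) (auto simp: ennreal_eq_0_iff)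
      then have "AE x in N. f x = 0"
      proof eventually_elim
        case (elim x)
        show ?case
        proof (cases "w x = 0")
          case False
          then have "w x ^ (2*m-1) > 0" using w[of x] by simp
          then have "f x ^ (2*m) \<le> 0" using elim by (simp add: divide_le_0_iff)
          then show ?thesis using f[of x] by (metis antisym power_eq_0_iff zero_le_power)
        qed (rule fw)
      qed
      then show False using zero False by simp
    qed
    show ?thesis
    proof (cases "?W = top \<or> ?R = top")
      case True
      have "?W ^ (2*m-1) * ?R = top"
        using True W0 R0 m by (auto simp: ennreal_mult_eq_top_iff power_eq_top_ennreal ennreal_top_mult ennreal_mult_top)
      then show ?thesis by simp
    next
      case False
      then obtain W R where WR: "?W = ennreal W" "W \<ge> 0" "?R = ennreal R" "R \<ge> 0"
        by (cases ?W; cases ?R) auto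
      then have Wp: "W > 0" using W0 by (cases "W = 0") auto
      \<comment> \<open>The integral of \<open>f\<close> is shown to be finite by the linear
        inequality at \<open>y = 1\<close>; the optimal \<open>y\<close> can be formed only
        afterwards.\<close>
      have "ennreal (real (2*m) * 1 ^ (2*m-1)) * ?I \<le> ennreal R + ennreal (real (2*m-1) * 1 ^ (2*m)) * ennreal W"
        using int[of 1] WR by simp
      then have "?I \<noteq> top" using m
        by (auto simp: ennreal_mult_top ennreal_top_mult top_unique ennreal_mult_eq_top_iff ennreal_add_eq_top)
      then obtain I where I: "?I = ennreal I" "I \<ge> 0" by (cases ?I) auto
      \<comment> \<open>The optimal point of tangency, namely the mean of \<open>f / w\<close> under
        the density \<open>w / W\<close>.\<close>
      define y where "y = I / W"
      have y0: "y \<ge> 0" using I Wp by (simp add: y_def)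
      have "ennreal (real (2*m) * y ^ (2*m-1) * I) \<le> ennreal (R + real (2*m-1) * y ^ (2*m) * W)"
        using int[OF y0] y0 I WR by (simp flip: ennreal_mult ennreal_plus)
      then have "real (2*m) * y ^ (2*m-1) * I \<le> R + real (2*m-1) * y ^ (2*m) * W"
        by (rule ennreal_le_iff[THEN iffD1, rotated]) (use WR y0 in auto)
      moreover have yI: "y ^ (2*m-1) * I = y ^ (2*m) * W"
      proof -
        have "y ^ (2*m) = y ^ (2*m-1) * y" by (metis S power_Suc2)
        then show ?thesis using Wp by (simp add: y_def)
      qed
      moreover have "real (2*m) = real (2*m-1) + 1" using m by (simp add: of_nat_diff)
      ultimately have "(real (2*m-1) + 1) * (y ^ (2*m) * W) \<le> R + real (2*m-1) * (y ^ (2*m) * W)"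
        by (simp only: mult.assoc)
      moreover have "z \<le> R" if "(c + 1) * z \<le> R + c * z" for c z :: real
        using that by (simp add: distrib_right)
      ultimately have "y ^ (2*m) * W \<le> R" by blast
      then have "y ^ (2*m) * W * W ^ (2*m-1) \<le> R * W ^ (2*m-1)" using Wp by (intro mult_right_mono) auto
      moreover have "y ^ (2*m) * W * W ^ (2*m-1) = I ^ (2*m)"
      proof -
        have "W ^ (2*m) = W * W ^ (2*m-1)" by (metis S power_Suc)
        then have "y ^ (2*m) * W * W ^ (2*m-1) = (y * W) ^ (2*m)" by (simp add: power_mult_distrib)
        then show ?thesis using Wp by (simp add: y_def)
      qed
      ultimately have "I ^ (2*m) \<le> W ^ (2*m-1) * R" by (simp add: mult.commute)
      then have "ennreal (I ^ (2*m)) \<le> ennreal (W ^ (2*m-1) * R)" by (rule ennreal_leI)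
      then show ?thesis using WR I by (simp add: ennreal_mult ennreal_power)
    qed
  qed
qed

lemma power_even_split: "m \<ge> 1 \<Longrightarrow> x ^ (2*m) = x ^ (2*m-1) * (x :: 'b :: comm_monoid_mult)"
  by (cases m) (simp_all add: mult_ac)

text \<open>Markov's inequality of order \<open>2*m\<close> is followed by
  \<open>nn_integral_power_le_weighted\<close> and Fubini's theorem. The weight \<open>w\<close> is
  at disposal; it has to balance its own integral against that of
  \<open>b t / w t ^ (2*m-1)\<close>.\<close>

lemma (in prob_space) markov_power_integral:
  fixes f :: "real \<Rightarrow> 'a \<Rightarrow> real" and w b :: "real \<Rightarrow> real"
  assumes f_meas: "case_prod f \<in> borel_measurable (lborel \<Otimes>\<^sub>M M)"
    and [measurable]: "w \<in> borel_measurable borel" "b \<in> borel_measurable borel"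
    and f: "\<And>t x. 0 \<le> f t x" and w: "\<And>t. 0 \<le> w t" and fw: "\<And>t x. w t = 0 \<Longrightarrow> f t x = 0"
    and b: "AE t in lborel. (\<integral>\<^sup>+x. ennreal (f t x ^ (2*m)) \<partial>M) \<le> ennreal (b t)" "\<And>t. 0 \<le> b t"
    and m: "m \<ge> 1" and l: "l > 0"
  shows "emeasure M {x \<in> space M. ennreal l < (\<integral>\<^sup>+t. ennreal (f t x) \<partial>lborel)}
     \<le> ennreal (1 / l ^ (2*m)) * ((\<integral>\<^sup>+t. ennreal (w t) \<partial>lborel) ^ (2*m-1) * (\<integral>\<^sup>+t. ennreal (b t / w t ^ (2*m-1)) \<partial>lborel))"
proof -
  interpret P: pair_sigma_finite lborel M
    by (simp add: pair_sigma_finite_def sigma_finite_lborel sigma_finite_measure_axioms)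
  note [measurable] = f_meas
  have [measurable]: "(\<lambda>x. f t x) \<in> borel_measurable M" for t
    using measurable_compose[OF _ f_meas, of "\<lambda>x. (t, x)" M] by simp
  have fx: "(\<lambda>t. f t x) \<in> borel_measurable lborel" if "x \<in> space M" for x
    using measurable_compose[OF _ f_meas, of "\<lambda>t. (t, x)" lborel] that by simp
  define F where "F x = (\<integral>\<^sup>+t. ennreal (f t x) \<partial>lborel)" for x
  have [measurable]: "F \<in> borel_measurable M"
    unfolding F_def[abs_def] by measurable
  have "emeasure M {x \<in> space M. ennreal l < F x} \<le> emeasure M {x \<in> space M. 1 \<le> ennreal (1 / l ^ (2*m)) * F x ^ (2*m)}"
  proof (rule emeasure_mono)
    show "{x \<in> space M. ennreal l < F x} \<subseteq> {x \<in> space M. 1 \<le> ennreal (1 / l ^ (2*m)) * F x ^ (2*m)}"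
    proof clarify
      fix x assume "ennreal l < F x"
      then have "ennreal l ^ (2*m) \<le> F x ^ (2*m)" by (intro power_mono) auto
      then have "ennreal (1 / l ^ (2*m)) * ennreal l ^ (2*m) \<le> ennreal (1 / l ^ (2*m)) * F x ^ (2*m)"
        by (rule mult_left_mono) simp
      moreover have "ennreal (1 / l ^ (2*m)) * ennreal l ^ (2*m) = 1"
        using l by (simp add: ennreal_power flip: ennreal_mult)
      ultimately show "1 \<le> ennreal (1 / l ^ (2*m)) * F x ^ (2*m)" by simp
    qed
  qed measurable
  also have "\<dots> \<le> ennreal (1 / l ^ (2*m)) * (\<integral>\<^sup>+x. F x ^ (2*m) * indicator (space M) x \<partial>M)"
    by (rule nn_integral_Markov_inequality) auto
  also have "\<dots> = ennreal (1 / l ^ (2*m)) * (\<integral>\<^sup>+x. F x ^ (2*m) \<partial>M)"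
    by (intro arg_cong[where f="\<lambda>y. _ * y"] nn_integral_cong) auto
  also have "\<dots> \<le> ennreal (1 / l ^ (2*m)) * ((\<integral>\<^sup>+t. ennreal (w t) \<partial>lborel) ^ (2*m-1) * (\<integral>\<^sup>+t. ennreal (b t / w t ^ (2*m-1)) \<partial>lborel))"
  proof (rule mult_left_mono)
    let ?W = "\<integral>\<^sup>+t. ennreal (w t) \<partial>lborel"
    have "(\<integral>\<^sup>+x. F x ^ (2*m) \<partial>M) \<le> (\<integral>\<^sup>+x. ?W ^ (2*m-1) * (\<integral>\<^sup>+t. ennreal (f t x ^ (2*m) / w t ^ (2*m-1)) \<partial>lborel) \<partial>M)"
    proof (rule nn_integral_mono)
      fix x assume "x \<in> space M"
      then show "F x ^ (2*m) \<le> ?W ^ (2*m-1) * (\<integral>\<^sup>+t. ennreal (f t x ^ (2*m) / w t ^ (2*m-1)) \<partial>lborel)"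
        unfolding F_def using f w fw m fx by (intro nn_integral_power_le_weighted) auto
    qed
    also have "\<dots> = ?W ^ (2*m-1) * (\<integral>\<^sup>+x. (\<integral>\<^sup>+t. ennreal (f t x ^ (2*m) / w t ^ (2*m-1)) \<partial>lborel) \<partial>M)"
      by (rule nn_integral_cmult) measurable
    also have "(\<integral>\<^sup>+x. (\<integral>\<^sup>+t. ennreal (f t x ^ (2*m) / w t ^ (2*m-1)) \<partial>lborel) \<partial>M)
       = (\<integral>\<^sup>+t. (\<integral>\<^sup>+x. ennreal (f t x ^ (2*m) / w t ^ (2*m-1)) \<partial>M) \<partial>lborel)"
    proof -
      have "(\<lambda>(t, x). ennreal (f t x ^ (2*m) / w t ^ (2*m-1))) \<in> borel_measurable (lborel \<Otimes>\<^sub>M M)"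
        by measurable
      from P.Fubini[OF this] show ?thesis by simp
    qed
    also have "\<dots> \<le> (\<integral>\<^sup>+t. ennreal (b t / w t ^ (2*m-1)) \<partial>lborel)"
    proof (rule nn_integral_mono_AE)
      show "AE t in lborel. (\<integral>\<^sup>+x. ennreal (f t x ^ (2*m) / w t ^ (2*m-1)) \<partial>M) \<le> ennreal (b t / w t ^ (2*m-1))"
        using b(1)
      proof eventually_elim
        case (elim t)
        have "(\<integral>\<^sup>+x. ennreal (f t x ^ (2*m) / w t ^ (2*m-1)) \<partial>M)
            = (\<integral>\<^sup>+x. ennreal (1 / w t ^ (2*m-1)) * ennreal (f t x ^ (2*m)) \<partial>M)"
          using f w by (intro nn_integral_cong) (simp flip: ennreal_mult)
        also have "\<dots> = ennreal (1 / w t ^ (2*m-1)) * (\<integral>\<^sup>+x. ennreal (f t x ^ (2*m)) \<partial>M)"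
          by (rule nn_integral_cmult) measurable
        also have "\<dots> \<le> ennreal (1 / w t ^ (2*m-1)) * ennreal (b t)"
          using elim by (rule mult_left_mono) simp
        also have "\<dots> = ennreal (b t / w t ^ (2*m-1))"
          using w b(2) by (simp flip: ennreal_mult)
        finally show ?case .
      qed
    qed
    finally show "(\<integral>\<^sup>+x. F x ^ (2*m) \<partial>M) \<le> ?W ^ (2*m-1) * (\<integral>\<^sup>+t. ennreal (b t / w t ^ (2*m-1)) \<partial>lborel)"
      by (simp add: mult_left_mono)
  qed simp
  finally show ?thesis by (simp only: F_def)
qed

lemma (in prob_space) markov_integral:
  fixes f :: "real \<Rightarrow> 'a \<Rightarrow> real" and b :: "real \<Rightarrow> ennreal"
  assumes f_meas: "case_prod f \<in> borel_measurable (lborel \<Otimes>\<^sub>M M)"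
    and b: "AE t in lborel. (\<integral>\<^sup>+x. ennreal (f t x) \<partial>M) \<le> b t" and l: "l > 0"
  shows "emeasure M {x \<in> space M. ennreal l < (\<integral>\<^sup>+t. ennreal (f t x) \<partial>lborel)}
     \<le> ennreal (1 / l) * (\<integral>\<^sup>+t. b t \<partial>lborel)"
proof -
  interpret P: pair_sigma_finite lborel M
    by (simp add: pair_sigma_finite_def sigma_finite_lborel sigma_finite_measure_axioms)
  note [measurable] = f_meas
  define F where "F x = (\<integral>\<^sup>+t. ennreal (f t x) \<partial>lborel)" for x
  have [measurable]: "F \<in> borel_measurable M"
    unfolding F_def[abs_def] by measurable
  have "emeasure M {x \<in> space M. ennreal l < F x} \<le> emeasure M {x \<in> space M. 1 \<le> ennreal (1 / l) * F x}"
  proof (rule emeasure_mono)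
    show "{x \<in> space M. ennreal l < F x} \<subseteq> {x \<in> space M. 1 \<le> ennreal (1 / l) * F x}"
    proof clarify
      fix x assume "ennreal l < F x"
      then have "ennreal (1 / l) * ennreal l \<le> ennreal (1 / l) * F x"
        by (intro mult_left_mono) auto
      moreover have "ennreal (1 / l) * ennreal l = 1" using l by (simp flip: ennreal_mult)
      ultimately show "1 \<le> ennreal (1 / l) * F x" by simp
    qed
  qed measurable
  also have "\<dots> \<le> ennreal (1 / l) * (\<integral>\<^sup>+x. F x * indicator (space M) x \<partial>M)"
    by (rule nn_integral_Markov_inequality) auto
  also have "(\<integral>\<^sup>+x. F x * indicator (space M) x \<partial>M) = (\<integral>\<^sup>+x. F x \<partial>M)"
    by (intro nn_integral_cong) auto
  also have "\<dots> = (\<integral>\<^sup>+t. (\<integral>\<^sup>+x. ennreal (f t x) \<partial>M) \<partial>lborel)"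
  proof -
    have "(\<lambda>(t, x). ennreal (f t x)) \<in> borel_measurable (lborel \<Otimes>\<^sub>M M)" by measurable
    from P.Fubini[OF this] show ?thesis by (simp add: F_def)
  qed
  also have "ennreal (1 / l) * \<dots> \<le> ennreal (1 / l) * (\<integral>\<^sup>+t. b t \<partial>lborel)"
    by (intro mult_left_mono nn_integral_mono_AE b) simp
  finally show ?thesis by (simp only: F_def)
qed

section \<open>Tail of an integrated family at a fixed level\<close>

text \<open>Abstracts from the process what the tail estimate needs. The bounds concern positive
  \<open>t\<close>, negative thresholds being reached by reflection, and almost every
  \<open>t\<close>, because at an atom the distribution function of a negative threshold can exceed
  the tail. The level in \<open>trunc\<close> is explicit, hence measurable in
  \<open>t\<close>.\<close>

locale truncated_family = prob_space M for M :: "'a measure" +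
  fixes Z :: "real \<Rightarrow> 'a \<Rightarrow> real" and al :: "nat \<Rightarrow> real" and H S :: "real \<Rightarrow> real"
    and n m :: nat and K :: real
  assumes n: "n \<ge> 1" and m: "m \<ge> 2" and K: "K \<ge> 0"
    and Z_meas: "case_prod Z \<in> borel_measurable (lborel \<Otimes>\<^sub>M M)"
    and al_antimono: "\<And>i j. i \<le> j \<Longrightarrow> al j \<le> al i" and al_nonneg: "\<And>i. 0 \<le> al i"
    and H_antimono: "\<And>s t. s \<le> t \<Longrightarrow> H t \<le> H s" and H_nonneg: "\<And>t. 0 \<le> H t"
    and H_lim: "\<And>e. e > 0 \<Longrightarrow> \<exists>t>0. H t < e"
    and H_meas [measurable]: "H \<in> borel_measurable borel"
    and S_meas [measurable]: "S \<in> borel_measurable borel" and S_nonneg: "\<And>t. 0 \<le> S t"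
    and mean: "AE t in lborel. 0 < t \<longrightarrow> (\<integral>\<^sup>+x. ennreal \<bar>Z t x\<bar> \<partial>M) \<le> ennreal (K * (real n * min (al 0) (H t)))"
    and trunc: "AE t in lborel. 0 < t \<longrightarrow> (\<forall>q\<le>n.
       let a = (real n * S t) ^ m + real n * real q * (\<Sum>k<q. (real k + 1) ^ (2*m-3) * min (al k) (H t));
           b = real n * (if q < n then min (al q) (H t) else 0);
           c = truncation_level m n a b
       in (\<integral>\<^sup>+x. ennreal (min \<bar>Z t x\<bar> c ^ (2*m)) \<partial>M) \<le> ennreal (K * a) \<and>
          (\<integral>\<^sup>+x. ennreal (max 0 (\<bar>Z t x\<bar> - c)) \<partial>M) \<le> ennreal (K * b))"
begin

definition \<gamma> :: "nat \<Rightarrow> real \<Rightarrow> real" where "\<gamma> k t = min (al k) (H t)"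
definition gpart :: "real \<Rightarrow> real" where "gpart t = (real n * S t) ^ m"
definition jpart :: "nat \<Rightarrow> real \<Rightarrow> real" where
  "jpart q t = real n * real q * (\<Sum>k<q. (real k + 1) ^ (2*m-3) * \<gamma> k t)"
definition bpart :: "nat \<Rightarrow> real \<Rightarrow> real" where
  "bpart q t = real n * (if q < n then \<gamma> q t else 0)"
definition cut :: "nat \<Rightarrow> real \<Rightarrow> real" where
  "cut q t = truncation_level m n (gpart t + jpart q t) (bpart q t)"

lemma \<gamma>_meas [measurable]: "\<gamma> k \<in> borel_measurable borel"
  unfolding \<gamma>_def[abs_def] by measurable
lemma gpart_meas [measurable]: "gpart \<in> borel_measurable borel"
  unfolding gpart_def[abs_def] by measurable
lemma jpart_meas [measurable]: "jpart q \<in> borel_measurable borel"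
  unfolding jpart_def[abs_def] by measurable
lemma bpart_meas [measurable]: "bpart q \<in> borel_measurable borel"
  unfolding bpart_def[abs_def] by measurable
lemma cut_meas [measurable]: "cut q \<in> borel_measurable borel"
  unfolding cut_def[abs_def] truncation_level_def by measurable

lemma \<gamma>_nonneg: "0 \<le> \<gamma> k t" by (simp add: \<gamma>_def al_nonneg H_nonneg)
lemma \<gamma>_antimono: "i \<le> j \<Longrightarrow> \<gamma> j t \<le> \<gamma> i t"
  unfolding \<gamma>_def using al_antimono[of i j] by auto
lemma gpart_nonneg: "0 \<le> gpart t" by (simp add: gpart_def S_nonneg)
lemma jpart_nonneg: "0 \<le> jpart q t"
  unfolding jpart_def by (intro mult_nonneg_nonneg sum_nonneg \<gamma>_nonneg) auto
lemma bpart_nonneg: "0 \<le> bpart q t" by (simp add: bpart_def \<gamma>_nonneg)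
lemma cut_nonneg: "0 \<le> cut q t"
  unfolding cut_def by (intro truncation_level_nonneg add_nonneg_nonneg gpart_nonneg jpart_nonneg bpart_nonneg)

lemma mean_AE: "AE t in lborel. 0 < t \<longrightarrow> (\<integral>\<^sup>+x. ennreal \<bar>Z t x\<bar> \<partial>M) \<le> ennreal (K * (real n * \<gamma> 0 t))"
  using mean by (simp add: \<gamma>_def)

lemma trunc_AE: "AE t in lborel. 0 < t \<longrightarrow> (\<forall>q\<le>n.
    (\<integral>\<^sup>+x. ennreal (min \<bar>Z t x\<bar> (cut q t) ^ (2*m)) \<partial>M) \<le> ennreal (K * (gpart t + jpart q t)) \<and>
    (\<integral>\<^sup>+x. ennreal (max 0 (\<bar>Z t x\<bar> - cut q t)) \<partial>M) \<le> ennreal (K * bpart q t))"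
  unfolding cut_def gpart_def jpart_def bpart_def \<gamma>_def by (rule trunc[unfolded Let_def])

text \<open>The range of \<open>t\<close> is cut at \<open>R\<close>. Below \<open>R\<close> the variable is truncated, and Hoelder's inequality
  is applied with the weight \<open>sqrt S\<close> where the Gaussian part dominates and with a power of \<open>t\<close> elsewhere.\<close>

definition gset :: "real \<Rightarrow> nat \<Rightarrow> real set" where
  "gset R q = {t. 0 < t \<and> t < R \<and> 0 < S t \<and> jpart q t \<le> gpart t}"
definition jset :: "real \<Rightarrow> nat \<Rightarrow> real set" where
  "jset R q = {t. 0 < t \<and> t < R \<and> gpart t < jpart q t}"

lemma gset_meas [measurable]: "gset R q \<in> sets borel" unfolding gset_def by measurable
lemma jset_meas [measurable]: "jset R q \<in> sets borel" unfolding jset_def by measurable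

definition gauss_term :: "real \<Rightarrow> nat \<Rightarrow> real \<Rightarrow> 'a \<Rightarrow> real" where
  "gauss_term R q t x = (if t \<in> gset R q then min \<bar>Z t x\<bar> (cut q t) else 0)"
definition jump_term :: "real \<Rightarrow> nat \<Rightarrow> real \<Rightarrow> 'a \<Rightarrow> real" where
  "jump_term R q t x = (if t \<in> jset R q then min \<bar>Z t x\<bar> (cut q t) else 0)"
text \<open>Beyond \<open>R\<close> the whole variable is left over. The same is done below
  \<open>R\<close> where \<open>S t = 0\<close> and the jump part does not dominate: there both
  parts are zero, so the truncated variable vanishes almost surely.\<close>

definition rest_term :: "real \<Rightarrow> nat \<Rightarrow> real \<Rightarrow> 'a \<Rightarrow> real" where
  "rest_term R q t x = (if t \<le> 0 then 0 else if t \<in> gset R q \<union> jset R q then max 0 (\<bar>Z t x\<bar> - cut q t) else \<bar>Z t x\<bar>)"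

lemma terms_meas [measurable]:
  "case_prod (gauss_term R q) \<in> borel_measurable (lborel \<Otimes>\<^sub>M M)"
  "case_prod (jump_term R q) \<in> borel_measurable (lborel \<Otimes>\<^sub>M M)"
  "case_prod (rest_term R q) \<in> borel_measurable (lborel \<Otimes>\<^sub>M M)"
proof -
  have [measurable]: "(\<lambda>z. Z (fst z) (snd z)) \<in> borel_measurable (lborel \<Otimes>\<^sub>M M)"
    using Z_meas by (simp add: case_prod_beta')
  show "case_prod (gauss_term R q) \<in> borel_measurable (lborel \<Otimes>\<^sub>M M)"
    "case_prod (jump_term R q) \<in> borel_measurable (lborel \<Otimes>\<^sub>M M)"
    "case_prod (rest_term R q) \<in> borel_measurable (lborel \<Otimes>\<^sub>M M)"
    unfolding gauss_term_def[abs_def] jump_term_def[abs_def] rest_term_def[abs_def] case_prod_beta' by measurable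
qed

lemma Z_section_meas: "(\<lambda>x. Z t x) \<in> borel_measurable M"
  using measurable_compose[OF _ Z_meas, of "\<lambda>x. (t, x)" M] by simp

lemma abs_Z_eq: "0 < t \<Longrightarrow> \<bar>Z t x\<bar> = rest_term R q t x + gauss_term R q t x + jump_term R q t x"
  unfolding rest_term_def gauss_term_def jump_term_def gset_def jset_def using cut_nonneg[of q t]
  by auto

text \<open>On \<open>gset R q\<close> the moment bound is at most \<open>2 * K * gpart t\<close>.
  With the weight \<open>sqrt (S t)\<close>, dividing \<open>gpart t\<close> by the weight to the
  power \<open>2*m-1\<close> leaves \<open>n ^ m * sqrt (S t)\<close>, so both factors of Hoelder's
  inequality reproduce the same integral.\<close>

lemma gauss_term_tail:
  assumes q: "q \<le> n" and l: "l > 0"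
  shows "emeasure M {x \<in> space M. ennreal l < (\<integral>\<^sup>+t. ennreal (gauss_term R q t x) \<partial>lborel)}
    \<le> ennreal (2 * K * real n ^ m / l ^ (2*m)) * (\<integral>\<^sup>+t. ennreal (sqrt (S t)) * indicator {0<..} t \<partial>lborel) ^ (2*m)"
proof -
  let ?s = "\<integral>\<^sup>+t. ennreal (sqrt (S t)) * indicator {0<..} t \<partial>lborel"
  let ?w = "\<lambda>t. if t \<in> gset R q then sqrt (S t) else 0"
  let ?b = "\<lambda>t. if t \<in> gset R q then 2 * K * gpart t else 0"
  have "emeasure M {x \<in> space M. ennreal l < (\<integral>\<^sup>+t. ennreal (gauss_term R q t x) \<partial>lborel)}
     \<le> ennreal (1 / l ^ (2*m)) * ((\<integral>\<^sup>+t. ennreal (?w t) \<partial>lborel) ^ (2*m-1) * (\<integral>\<^sup>+t. ennreal (?b t / ?w t ^ (2*m-1)) \<partial>lborel))"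
  proof (rule markov_power_integral)
    show "case_prod (gauss_term R q) \<in> borel_measurable (lborel \<Otimes>\<^sub>M M)" by (rule terms_meas)
    show "AE t in lborel. (\<integral>\<^sup>+x. ennreal (gauss_term R q t x ^ (2*m)) \<partial>M) \<le> ennreal (?b t)"
      using trunc_AE
    proof eventually_elim
      case (elim t)
      show ?case
      proof (cases "t \<in> gset R q")
        case True
        then have "(\<integral>\<^sup>+x. ennreal (gauss_term R q t x ^ (2*m)) \<partial>M) \<le> ennreal (K * (gpart t + jpart q t))"
          using elim q by (simp add: gauss_term_def gset_def)
        also have "\<dots> \<le> ennreal (?b t)"
          using True mult_left_mono[OF _ K, of "gpart t + jpart q t" "2 * gpart t"]
          by (intro ennreal_leI) (auto simp: gset_def)
        finally show ?thesis .
      next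
        case False
        then show ?thesis using m by (simp add: gauss_term_def power_0_left)
      qed
    qed
  qed (use m l K in \<open>auto simp: gauss_term_def gset_def cut_nonneg gpart_nonneg S_nonneg\<close>)
  also have "\<dots> \<le> ennreal (1 / l ^ (2*m)) * (?s ^ (2*m-1) * (ennreal (2 * K * real n ^ m) * ?s))"
  proof (intro mult_left_mono mult_mono power_mono)
    show "(\<integral>\<^sup>+t. ennreal (?w t) \<partial>lborel) \<le> ?s"
      by (intro nn_integral_mono) (auto simp: gset_def indicator_def)
    have "(\<integral>\<^sup>+t. ennreal (?b t / ?w t ^ (2*m-1)) \<partial>lborel) \<le> (\<integral>\<^sup>+t. ennreal (2 * K * real n ^ m) * (ennreal (sqrt (S t)) * indicator {0<..} t) \<partial>lborel)"
    proof (rule nn_integral_mono)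
      fix t
      show "ennreal (?b t / ?w t ^ (2*m-1)) \<le> ennreal (2 * K * real n ^ m) * (ennreal (sqrt (S t)) * indicator {0<..} t)"
      proof (cases "t \<in> gset R q")
        case True
        then have t: "0 < t" "0 < S t" by (auto simp: gset_def)
        have "gpart t / sqrt (S t) ^ (2*m-1) = real n ^ m * sqrt (S t)"
        proof -
          have S: "Suc (2*m-1) = 2*m" using m by simp
          have "S t ^ m = (sqrt (S t))\<^sup>2 ^ m" using t by simp
          also have "\<dots> = sqrt (S t) ^ (2*m)" by (simp only: power_mult)
          also have "\<dots> = sqrt (S t) ^ (2*m-1) * sqrt (S t)" by (metis S power_Suc2)
          finally show ?thesis using t by (simp add: gpart_def power_mult_distrib)
        qed
        then have "?b t / ?w t ^ (2*m-1) = 2 * K * real n ^ m * sqrt (S t)" using True by (simp add: mult.assoc flip: times_divide_eq_right)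
        then show ?thesis using t K by (simp add: ennreal_mult)
      qed simp
    qed
    also have "\<dots> = ennreal (2 * K * real n ^ m) * ?s" by (rule nn_integral_cmult) measurable
    finally show "(\<integral>\<^sup>+t. ennreal (?b t / ?w t ^ (2*m-1)) \<partial>lborel) \<le> ennreal (2 * K * real n ^ m) * ?s" .
  qed auto
  also have "\<dots> = (ennreal (1 / l ^ (2*m)) * ennreal (2 * K * real n ^ m)) * (?s ^ (2*m-1) * ?s)"
    by (simp only: mult_ac)
  also have "?s ^ (2*m-1) * ?s = ?s ^ (2*m)"
    using m by (intro power_even_split[symmetric]) simp
  also have "ennreal (1 / l ^ (2*m)) * ennreal (2 * K * real n ^ m) = ennreal (2 * K * real n ^ m / l ^ (2*m))"
    using K l by (simp flip: ennreal_mult)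
  finally show ?thesis .
qed

end

context truncated_family
begin

text \<open>Of the cut only \<open>(k + 1) * t \<le> l\<close> survives, a consequence of
  \<open>k < q\<close>, \<open>t < R\<close> and \<open>q * R \<le> l\<close>. The bound can then be
  integrated in \<open>l\<close>, although \<open>R\<close> and \<open>q\<close> depend on
  \<open>l\<close>.\<close>

definition jump_integral :: "real \<Rightarrow> ennreal" where
  "jump_integral l = (\<Sum>k<n. ennreal ((real k + 1) ^ (2*m-3)) *
     (\<integral>\<^sup>+t. ennreal (t ^ (2*m-2) * \<gamma> k t) * indicator {t. 0 < t \<and> (real k + 1) * t \<le> l} t \<partial>lborel))"

text \<open>For given \<open>t > 0\<close> and \<open>l > 0\<close> at most one index contributes,
  the integer part of \<open>l / (2*t)\<close>. The factor 2 makes room for replacing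
  \<open>(0, R)\<close> by its upper half in \<open>choice_of_cut\<close>.\<close>

definition rest_integral :: "real \<Rightarrow> ennreal" where
  "rest_integral l = (\<Sum>k<n. \<integral>\<^sup>+t. ennreal (\<gamma> k t) * indicator {t. 0 < t \<and> 2 * real k * t \<le> l \<and> l < 2 * (real k + 1) * t} t \<partial>lborel)"

text \<open>The weight \<open>t powr a\<close> is integrable at 0, its integral over
  \<open>(0, R)\<close> has a power of order \<open>2*m-1\<close> proportional to \<open>R\<close>,
  and dividing by its own power of that order multiplies by \<open>t ^ (2*m-2)\<close>. The factor
  \<open>R\<close> meets the factor \<open>q\<close> of \<open>jpart\<close>, and
  \<open>q * R \<le> l\<close> cancels one power of \<open>l\<close>.\<close>

lemma jump_term_tail:
  assumes q: "q \<le> n" and l: "l > 0" and R: "R > 0" "real q * R \<le> l"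
  shows "emeasure M {x \<in> space M. ennreal l < (\<integral>\<^sup>+t. ennreal (jump_term R q t x) \<partial>lborel)}
    \<le> ennreal (2 * K * real (2*m-1) ^ (2*m-1) * real n / l ^ (2*m-1)) * jump_integral l"
proof -
  define a where "a = - (real (2*m-2) / real (2*m-1))"
  have S: "Suc (2*m-1) = 2*m" "Suc (2*m-2) = 2*m-1" using m by simp_all
  have S': "real (2*m-1) = real (2*m-2) + 1" using m by (simp add: of_nat_diff)
  have a: "a > -1" "a + 1 = 1 / real (2*m-1)" "a * real (2*m-1) = - real (2*m-2)"
    unfolding a_def using m S' by (auto simp: field_simps)
  let ?w = "\<lambda>t. if 0 < t \<and> t < R then t powr a else 0"
  let ?b = "\<lambda>t. if t \<in> jset R q then 2 * K * jpart q t else 0"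
  have "emeasure M {x \<in> space M. ennreal l < (\<integral>\<^sup>+t. ennreal (jump_term R q t x) \<partial>lborel)}
     \<le> ennreal (1 / l ^ (2*m)) * ((\<integral>\<^sup>+t. ennreal (?w t) \<partial>lborel) ^ (2*m-1) * (\<integral>\<^sup>+t. ennreal (?b t / ?w t ^ (2*m-1)) \<partial>lborel))"
  proof (rule markov_power_integral)
    show "case_prod (jump_term R q) \<in> borel_measurable (lborel \<Otimes>\<^sub>M M)" by (rule terms_meas)
    show "AE t in lborel. (\<integral>\<^sup>+x. ennreal (jump_term R q t x ^ (2*m)) \<partial>M) \<le> ennreal (?b t)"
      using trunc_AE
    proof eventually_elim
      case (elim t)
      show ?case
      proof (cases "t \<in> jset R q")
        case True
        then have "(\<integral>\<^sup>+x. ennreal (jump_term R q t x ^ (2*m)) \<partial>M) \<le> ennreal (K * (gpart t + jpart q t))"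
          using elim q by (simp add: jump_term_def jset_def)
        also have "\<dots> \<le> ennreal (?b t)"
          using True mult_left_mono[OF _ K, of "gpart t + jpart q t" "2 * jpart q t"]
          by (intro ennreal_leI) (auto simp: jset_def)
        finally show ?thesis .
      next
        case False
        then show ?thesis using m by (simp add: jump_term_def power_0_left)
      qed
    qed
  qed (use m l K in \<open>auto simp: jump_term_def jset_def cut_nonneg jpart_nonneg split: if_splits\<close>)
  also have "\<dots> \<le> ennreal (1 / l ^ (2*m)) * (ennreal (real (2*m-1) ^ (2*m-1) * R) * (ennreal (2 * K * real n * real q) * jump_integral l))"
  proof (intro mult_left_mono mult_mono)
    have "(\<integral>\<^sup>+t. ennreal (?w t) \<partial>lborel) \<le> (\<integral>\<^sup>+t. ennreal (t powr a) * indicator {0..R} t \<partial>lborel)"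
      by (intro nn_integral_mono) (auto simp: indicator_def)
    also have "\<dots> = ennreal (R powr (a + 1) / (a + 1))"
      using a R by (intro nn_integral_powr_from_0) auto
    also have "R powr (a + 1) / (a + 1) = real (2*m-1) * R powr (1 / real (2*m-1))"
      unfolding a(2) by simp
    finally have "(\<integral>\<^sup>+t. ennreal (?w t) \<partial>lborel) ^ (2*m-1) \<le> ennreal (real (2*m-1) * R powr (1 / real (2*m-1))) ^ (2*m-1)"
      by (intro power_mono) auto
    also have "\<dots> = ennreal ((real (2*m-1) * R powr (1 / real (2*m-1))) ^ (2*m-1))"
      by (intro ennreal_power) simp
    also have "(real (2*m-1) * R powr (1 / real (2*m-1))) ^ (2*m-1) = real (2*m-1) ^ (2*m-1) * R"
    proof -
      have "(R powr (1 / real (2*m-1))) ^ (2*m-1) = (R powr (1 / real (2*m-1))) powr real (2*m-1)"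
        using R by (intro powr_realpow[symmetric]) simp
      also have "\<dots> = R" using R m by (simp add: powr_powr)
      finally show ?thesis by (simp add: power_mult_distrib)
    qed
    finally show "(\<integral>\<^sup>+t. ennreal (?w t) \<partial>lborel) ^ (2*m-1) \<le> ennreal (real (2*m-1) ^ (2*m-1) * R)" .
    let ?g = "\<lambda>k t. ennreal (t ^ (2*m-2) * \<gamma> k t) * indicator {t. 0 < t \<and> (real k + 1) * t \<le> l} t"
    have "(\<integral>\<^sup>+t. ennreal (?b t / ?w t ^ (2*m-1)) \<partial>lborel)
        \<le> (\<integral>\<^sup>+t. ennreal (2 * K * real n * real q) * (\<Sum>k<n. ennreal ((real k + 1) ^ (2*m-3)) * ?g k t) \<partial>lborel)"
    proof (rule nn_integral_mono)
      fix t
      show "ennreal (?b t / ?w t ^ (2*m-1)) \<le> ennreal (2 * K * real n * real q) * (\<Sum>k<n. ennreal ((real k + 1) ^ (2*m-3)) * ?g k t)"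
      proof (cases "t \<in> jset R q")
        case True
        then have t: "0 < t" "t < R" by (auto simp: jset_def)
        have "(t powr a) ^ (2*m-1) = (t powr a) powr real (2*m-1)"
          using t by (intro powr_realpow[symmetric]) simp
        also have "\<dots> = t powr (- real (2*m-2))" by (simp only: powr_powr a(3))
        also have "\<dots> = 1 / t ^ (2*m-2)" using t by (simp add: powr_minus_divide powr_realpow)
        finally have w: "(t powr a) ^ (2*m-1) = 1 / t ^ (2*m-2)" .
        have "?b t / ?w t ^ (2*m-1) = 2 * K * jpart q t * t ^ (2*m-2)"
          using True t w by simp
        also have "\<dots> = 2 * K * real n * real q * (\<Sum>k<q. (real k + 1) ^ (2*m-3) * (t ^ (2*m-2) * \<gamma> k t))"
          by (simp add: jpart_def sum_distrib_right sum_distrib_left mult_ac)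
        finally have e1: "ennreal (?b t / ?w t ^ (2*m-1)) = ennreal (2 * K * real n * real q) *
            ennreal (\<Sum>k<q. (real k + 1) ^ (2*m-3) * (t ^ (2*m-2) * \<gamma> k t))"
          using t K by (simp add: ennreal_mult sum_nonneg \<gamma>_nonneg)
        have e2: "ennreal (\<Sum>k<q. (real k + 1) ^ (2*m-3) * (t ^ (2*m-2) * \<gamma> k t))
            = (\<Sum>k<q. ennreal ((real k + 1) ^ (2*m-3)) * ?g k t)"
        proof (subst sum_ennreal[symmetric])
          show "(\<Sum>k<q. ennreal ((real k + 1) ^ (2*m-3) * (t ^ (2*m-2) * \<gamma> k t)))
              = (\<Sum>k<q. ennreal ((real k + 1) ^ (2*m-3)) * ?g k t)"
          proof (rule sum.cong)
            fix k assume "k \<in> {..<q}"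
            then have "(real k + 1) * t \<le> real q * R" using t by (intro mult_mono) auto
            then have "(real k + 1) * t \<le> l" using R by linarith
            then show "ennreal ((real k + 1) ^ (2*m-3) * (t ^ (2*m-2) * \<gamma> k t)) = ennreal ((real k + 1) ^ (2*m-3)) * ?g k t"
              using t by (simp add: ennreal_mult \<gamma>_nonneg)
          qed simp
        qed (use t in \<open>simp add: \<gamma>_nonneg\<close>)
        have e3: "(\<Sum>k<q. ennreal ((real k + 1) ^ (2*m-3)) * ?g k t) \<le> (\<Sum>k<n. ennreal ((real k + 1) ^ (2*m-3)) * ?g k t)"
          using q by (intro sum_mono2) auto
        show ?thesis unfolding e1 e2 by (rule mult_left_mono[OF e3]) simp
      qed simp
    qed
    also have "\<dots> = ennreal (2 * K * real n * real q) * jump_integral l"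
      unfolding jump_integral_def
      by (subst nn_integral_cmult, measurable, subst nn_integral_sum, measurable, simp add: nn_integral_cmult)
    finally show "(\<integral>\<^sup>+t. ennreal (?b t / ?w t ^ (2*m-1)) \<partial>lborel) \<le> ennreal (2 * K * real n * real q) * jump_integral l" .
  qed auto
  also have "\<dots> = ennreal ((1 / l ^ (2*m)) * (real (2*m-1) ^ (2*m-1) * R) * (2 * K * real n * real q)) * jump_integral l"
  proof -
    have "0 \<le> 1 / l ^ (2*m)" "0 \<le> real (2*m-1) ^ (2*m-1) * R" using l R by auto
    then have "ennreal ((1 / l ^ (2*m)) * (real (2*m-1) ^ (2*m-1) * R) * (2 * K * real n * real q))
        = ennreal (1 / l ^ (2*m)) * ennreal (real (2*m-1) ^ (2*m-1) * R) * ennreal (2 * K * real n * real q)"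
      by (simp only: ennreal_mult' mult_nonneg_nonneg)
    then show ?thesis by (simp only: mult.assoc)
  qed
  also have "\<dots> \<le> ennreal (2 * K * real (2*m-1) ^ (2*m-1) * real n / l ^ (2*m-1)) * jump_integral l"
  proof (intro mult_right_mono ennreal_leI)
    have "(1 / l ^ (2*m)) * (real (2*m-1) ^ (2*m-1) * R) * (2 * K * real n * real q)
       = (2 * K * real (2*m-1) ^ (2*m-1) * real n) * (real q * R) / l ^ (2*m)" by simp
    also have "\<dots> \<le> (2 * K * real (2*m-1) ^ (2*m-1) * real n) * l / l ^ (2*m)"
      using l K R by (intro divide_right_mono mult_left_mono) auto
    also have "\<dots> = 2 * K * real (2*m-1) ^ (2*m-1) * real n / l ^ (2*m-1)"
    proof -
      have "l ^ (2*m) = l * l ^ (2*m-1)" by (metis S(1) power_Suc)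
      then show ?thesis using l by (simp only:) (simp add: field_simps)
    qed
    finally show "(1 / l ^ (2*m)) * (real (2*m-1) ^ (2*m-1) * R) * (2 * K * real n * real q)
      \<le> 2 * K * real (2*m-1) ^ (2*m-1) * real n / l ^ (2*m-1)" .
  qed simp
  finally show ?thesis .
qed

definition rest_cost :: "real \<Rightarrow> nat \<Rightarrow> real \<Rightarrow> real" where
  "rest_cost R q t = (if t \<le> 0 then 0 else if t < R then bpart q t else real n * \<gamma> 0 t)"

lemma rest_term_mean:
  assumes q: "q \<le> n"
  shows "AE t in lborel. (\<integral>\<^sup>+x. ennreal (rest_term R q t x) \<partial>M) \<le> ennreal (K * rest_cost R q t)"
  using trunc_AE mean_AE
proof eventually_elim
  case (elim t)
  have [measurable]: "(\<lambda>x. Z t x) \<in> borel_measurable M" by (rule Z_section_meas)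
  consider "t \<le> 0" | "0 < t" "t \<in> gset R q \<union> jset R q" | "0 < t" "R \<le> t" "t \<notin> gset R q \<union> jset R q"
    | "0 < t" "t < R" "t \<notin> gset R q \<union> jset R q" by linarith
  then show ?case
  proof cases
    case 1 then show ?thesis by (simp add: rest_term_def rest_cost_def)
  next
    case 2
    then have "t < R" by (auto simp: gset_def jset_def)
    then show ?thesis using 2 elim q by (simp add: rest_term_def rest_cost_def)
  next
    case 3
    then show ?thesis using elim by (simp add: rest_term_def rest_cost_def)
  next
    case 4
    then have "S t = 0" "jpart q t \<le> gpart t" using S_nonneg[of t] by (auto simp: gset_def jset_def)
    then have "gpart t + jpart q t = 0" using m jpart_nonneg[of q t] by (simp add: gpart_def power_0_left)
    then have "(\<integral>\<^sup>+x. ennreal (min \<bar>Z t x\<bar> (cut q t) ^ (2*m)) \<partial>M) \<le> 0" using elim(1) 4 q by auto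
    then have "(\<integral>\<^sup>+x. ennreal (min \<bar>Z t x\<bar> (cut q t) ^ (2*m)) \<partial>M) = 0" by simp
    then have "AE x in M. min \<bar>Z t x\<bar> (cut q t) ^ (2*m) \<le> 0"
      by (subst (asm) nn_integral_0_iff_AE) (auto simp: ennreal_eq_0_iff)
    then have ae: "AE x in M. \<bar>Z t x\<bar> = max 0 (\<bar>Z t x\<bar> - cut q t)"
    proof eventually_elim
      case (elim x)
      have "0 \<le> min \<bar>Z t x\<bar> (cut q t)" using cut_nonneg[of q t] by simp
      then have "min \<bar>Z t x\<bar> (cut q t) = 0" using elim m by (metis antisym power_eq_0_iff zero_le_power)
      then show ?case by (auto simp: min_def max_def split: if_splits)
    qed
    have "(\<integral>\<^sup>+x. ennreal \<bar>Z t x\<bar> \<partial>M) = (\<integral>\<^sup>+x. ennreal (max 0 (\<bar>Z t x\<bar> - cut q t)) \<partial>M)"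
    proof (rule nn_integral_cong_AE)
      show "AE x in M. ennreal \<bar>Z t x\<bar> = ennreal (max 0 (\<bar>Z t x\<bar> - cut q t))"
        using ae by eventually_elim (rule arg_cong[where f = ennreal])
    qed
    then show ?thesis using elim(1) 4 q by (simp add: rest_term_def rest_cost_def)
  qed
qed

definition rest_fun :: "real \<Rightarrow> real \<Rightarrow> ennreal" where
  "rest_fun l t = (\<Sum>k<n. ennreal (\<gamma> k t) * indicator {t. 0 < t \<and> 2 * real k * t \<le> l \<and> l < 2 * (real k + 1) * t} t)"

lemma rest_fun_meas [measurable]: "rest_fun l \<in> borel_measurable borel"
  unfolding rest_fun_def[abs_def] by measurable

lemma rest_integral_eq: "rest_integral l = (\<integral>\<^sup>+t. rest_fun l t \<partial>lborel)"
  unfolding rest_integral_def rest_fun_def by (rule nn_integral_sum[symmetric]) measurable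

text \<open>Among the terms of \<open>rest_fun l t\<close> is \<open>\<gamma> j t\<close> for
  \<open>j\<close> the integer part of \<open>l / (2*t)\<close>, and \<open>\<gamma>\<close>
  decreases in its index.\<close>

lemma gamma_le_rest_fun:
  assumes t: "0 < t" and l: "0 < l" and k: "k < n" "nat \<lfloor>l / (2*t)\<rfloor> \<le> k"
  shows "ennreal (\<gamma> k t) \<le> rest_fun l t"
proof -
  define j where "j = nat \<lfloor>l / (2*t)\<rfloor>"
  have j: "real j \<le> l / (2*t)" "l / (2*t) < real j + 1"
    unfolding j_def using t l by (auto simp: of_nat_nat)
  have "ennreal (\<gamma> k t) \<le> ennreal (\<gamma> j t)" using k by (intro ennreal_leI \<gamma>_antimono) (simp add: j_def)
  also have "\<dots> = ennreal (\<gamma> j t) * indicator {t. 0 < t \<and> 2 * real j * t \<le> l \<and> l < 2 * (real j + 1) * t} t"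
    using t j by (simp add: field_simps)
  also have "\<dots> \<le> rest_fun l t"
    unfolding rest_fun_def using k by (intro member_le_sum) (auto simp: j_def)
  finally show ?thesis .
qed

text \<open>\<open>R\<close> is the point where \<open>H t\<close> falls below \<open>al \<lfloor>l / t\<rfloor>\<close>, and \<open>q\<close> is about \<open>l / R\<close>.\<close>

lemma choice_of_cut:
  assumes l: "l > 0"
  obtains R q where "R > 0" "q \<le> n" "real q * R \<le> l"
    "(\<integral>\<^sup>+t. ennreal (rest_cost R q t) \<partial>lborel) \<le> ennreal (2 * real n) * rest_integral l"
proof (cases "al 0 = 0")
  case True
  have "\<gamma> 0 t = 0" for t using True H_nonneg[of t] by (simp add: \<gamma>_def)
  then have "rest_cost 1 0 t = 0" for t by (simp add: rest_cost_def bpart_def)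
  then show ?thesis by (intro that[of 1 0]) (use l in auto)
next
  case False
  then have al0: "al 0 > 0" using al_nonneg[of 0] by simp
  \<comment> \<open>For \<open>t\<close> in this upward closed set all \<open>\<gamma> k t\<close>
    with \<open>k\<close> at most the integer part of \<open>l / t\<close> equal \<open>H t\<close>.
    The crude bound by lag 0 therefore loses nothing there, and \<open>l < real n * t\<close> keeps
    these indices below \<open>n\<close>.\<close>
  define bad where "bad = {t. 0 < t \<and> l < real n * t \<and> H t < al (nat \<lfloor>l / t\<rfloor>)}"
  have up: "t \<in> bad" if "s \<in> bad" "s \<le> t" for s t
  proof -
    have s: "0 < s" "l < real n * s" "H s < al (nat \<lfloor>l / s\<rfloor>)" using that by (auto simp: bad_def)
    have "l / t \<le> l / s" using s that l by (intro divide_left_mono) auto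
    then have "al (nat \<lfloor>l / s\<rfloor>) \<le> al (nat \<lfloor>l / t\<rfloor>)" by (intro al_antimono nat_mono floor_mono)
    moreover have "H t \<le> H s" by (rule H_antimono[OF that(2)])
    moreover have "real n * s \<le> real n * t" using that by (intro mult_left_mono) auto
    ultimately show ?thesis using s that by (auto simp: bad_def)
  qed
  have lower: "l / real n \<le> t" if "t \<in> bad" for t
    using that n by (simp add: bad_def field_simps less_imp_le)
  obtain t1 where t1: "t1 > 0" "H t1 < al 0" using H_lim[OF al0] by blast
  have ne: "max t1 (l + 1) \<in> bad"
  proof -
    let ?t = "max t1 (l + 1)"
    have t: "?t > 0" "l < ?t" using t1 l by auto
    have "\<lfloor>l / ?t\<rfloor> = 0" using t l by (simp add: floor_eq_iff)
    moreover have "H ?t < al 0" using H_antimono[of t1 ?t] t1 by simp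
    moreover have "l < real n * ?t"
    proof -
      have "1 * ?t \<le> real n * ?t" using n t by (intro mult_right_mono) auto
      then show ?thesis by (rule less_le_trans[rotated]) (simp only: mult_1 t(2))
    qed
    ultimately show ?thesis using t by (simp add: bad_def)
  qed
  define R where "R = Inf bad"
  have R: "R \<ge> l / real n" unfolding R_def using ne lower by (intro cInf_greatest) auto
  then have R0: "R > 0" using l n less_le_trans[of 0 "l / real n" R] by simp
  have bdd: "bdd_below bad" by (rule bdd_belowI[of _ 0]) (auto simp: bad_def)
  have above: "t \<in> bad" if "R < t" for t
  proof -
    have "Inf bad < t" using that by (simp add: R_def)
    then obtain s where "s \<in> bad" "s < t" using cInf_lessD ne by (metis empty_iff)
    then show ?thesis by (intro up[of s t]) simp_all
  qed
  have below: "t \<notin> bad" if "t < R" for t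
    using that cInf_lower[OF _ bdd, of t] by (auto simp: R_def)
  define q where "q = min n (nat \<lfloor>l / R\<rfloor>)"
  have q: "q \<le> n" by (simp add: q_def)
  have "real q \<le> real (nat \<lfloor>l / R\<rfloor>)" by (simp add: q_def)
  also have "\<dots> \<le> l / R" using l R0 by (intro of_nat_floor) simp
  finally have "real q \<le> l / R" .
  then have qR: "real q * R \<le> l" using R0 by (simp add: field_simps)
  have hi: "ennreal (rest_cost R q t) \<le> ennreal (real n) * rest_fun l t" if t: "R < t" for t
  proof -
    have b: "0 < t" "l < real n * t" "H t < al (nat \<lfloor>l / t\<rfloor>)" using above[OF t] by (auto simp: bad_def)
    let ?k = "nat \<lfloor>l / (2*t)\<rfloor>"
    have k1: "?k \<le> nat \<lfloor>l / t\<rfloor>" using b l by (intro nat_mono floor_mono divide_left_mono) auto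
    have "l / t < real n" using b by (simp add: field_simps)
    then have "nat \<lfloor>l / t\<rfloor> < n" using b l by (simp add: nat_less_iff floor_less_iff)
    then have k: "?k < n" using k1 by simp
    have "\<gamma> 0 t \<le> \<gamma> ?k t" unfolding \<gamma>_def using b al_antimono[OF k1] by auto
    then have "ennreal (real n * \<gamma> 0 t) \<le> ennreal (real n) * ennreal (\<gamma> ?k t)"
      by (simp add: ennreal_mult'[symmetric] ennreal_leI mult_left_mono \<gamma>_nonneg)
    also have "\<dots> \<le> ennreal (real n) * rest_fun l t"
      using b l k by (intro mult_left_mono gamma_le_rest_fun) auto
    finally show ?thesis using b t by (simp add: rest_cost_def)
  qed
  have lo: "(\<integral>\<^sup>+t. ennreal (rest_cost R q t) * indicator {0<..<R} t \<partial>lborel)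
      \<le> (\<integral>\<^sup>+t. ennreal (2 * real n) * (rest_fun l t * indicator {0<..<R} t) \<partial>lborel)"
  proof (cases "q < n")
    case False
    then have "rest_cost R q t * indicator {0<..<R} t = 0" for t by (auto simp: rest_cost_def bpart_def indicator_def)
    then have "ennreal (rest_cost R q t) * indicator {0<..<R} t = 0" for t
      by (metis ennreal_0 ennreal_indicator ennreal_mult'' indicator_pos_le)
    then show ?thesis by (simp only:) simp
  next
    case True
    then have qf: "q = nat \<lfloor>l / R\<rfloor>" by (simp add: q_def min_def split: if_splits)
    then have lR: "l / R < real q + 1" using l R0 by (simp add: of_nat_nat)
    \<comment> \<open>A point \<open>t'\<close> slightly below \<open>R\<close> is not in
      \<open>bad\<close>, so \<open>H t'\<close> is at least the coefficient at the integer part of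
      \<open>l / t'\<close>. Close enough to \<open>R\<close> that index is at most
      \<open>q\<close>.\<close>
    have Hq: "al q \<le> H t" if t: "t < R" for t
    proof -
      have 1: "l / (real q + 1) < R" using lR R0 by (simp add: field_simps)
      have "l / R < real n" using lR True by linarith
      then have 2: "l / real n < R" using R0 n by (simp add: field_simps)
      define u where "u = max (max t (l / (real q + 1))) (max (l / real n) (R/2))"
      obtain t' where t': "u < t'" "t' < R" using dense[of u R] 1 2 t R0 by (auto simp: u_def)
      then have t'': "t < t'" "l / (real q + 1) < t'" "l / real n < t'" "0 < t'"
        using R0 by (auto simp: u_def)
      have "l / t' < real q + 1" using t'' by (simp add: field_simps)
      then have "nat \<lfloor>l / t'\<rfloor> \<le> q" using l t'' by (simp add: nat_le_iff floor_le_iff)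
      then have "al q \<le> al (nat \<lfloor>l / t'\<rfloor>)" by (rule al_antimono)
      moreover have "l < real n * t'" using t'' n by (simp add: field_simps)
      then have "al (nat \<lfloor>l / t'\<rfloor>) \<le> H t'" using below[OF t'(2)] t'' by (auto simp: bad_def)
      moreover have "H t' \<le> H t" using t'' by (intro H_antimono) simp
      ultimately show ?thesis by linarith
    qed
    have "(\<integral>\<^sup>+t. ennreal (rest_cost R q t) * indicator {0<..<R} t \<partial>lborel)
        \<le> (\<integral>\<^sup>+t. ennreal (real n * al q) * indicator {0<..<R} t \<partial>lborel)"
    proof (rule nn_integral_mono)
      fix t
      show "ennreal (rest_cost R q t) * indicator {0<..<R} t \<le> ennreal (real n * al q) * indicator {0<..<R} t"
        using True by (auto simp: indicator_def rest_cost_def bpart_def \<gamma>_def intro!: ennreal_leI mult_left_mono)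
    qed
    \<comment> \<open>The interval is replaced by its upper half. There \<open>\<gamma> q t\<close>
      equals \<open>al q\<close>, and \<open>R < 2 * t\<close> puts the integer part of
      \<open>l / (2*t)\<close> at or below \<open>q\<close>.\<close>
    also have "\<dots> = ennreal (2 * real n) * (\<integral>\<^sup>+t. ennreal (al q) * indicator {R/2<..<R} t \<partial>lborel)"
      using R0 al_nonneg[of q] by (simp add: nn_integral_cmult_indicator flip: ennreal_mult)
    also have "\<dots> \<le> ennreal (2 * real n) * (\<integral>\<^sup>+t. rest_fun l t * indicator {0<..<R} t \<partial>lborel)"
    proof (intro mult_left_mono nn_integral_mono)
      fix t
      show "ennreal (al q) * indicator {R/2<..<R} t \<le> rest_fun l t * indicator {0<..<R} t"
      proof (cases "t \<in> {R/2<..<R}")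
        case t: True
        then have t0: "0 < t" "t < R" "R < 2 * t" using R0 by auto
        have "nat \<lfloor>l / (2*t)\<rfloor> \<le> q"
          unfolding qf using t0 l R0 by (intro nat_mono floor_mono divide_left_mono) auto
        then have "ennreal (\<gamma> q t) \<le> rest_fun l t" using t0 l True by (intro gamma_le_rest_fun) auto
        moreover have "\<gamma> q t = al q" using Hq[OF t0(2)] by (simp add: \<gamma>_def)
        ultimately show ?thesis using t0 t by simp
      qed simp
    qed simp
    also have "\<dots> = (\<integral>\<^sup>+t. ennreal (2 * real n) * (rest_fun l t * indicator {0<..<R} t) \<partial>lborel)"
      by (rule nn_integral_cmult[symmetric]) measurable
    finally show ?thesis .
  qed
  have [measurable]: "rest_cost R q \<in> borel_measurable borel"
    unfolding rest_cost_def[abs_def] by measurable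
  have "(\<integral>\<^sup>+t. ennreal (rest_cost R q t) \<partial>lborel)
     = (\<integral>\<^sup>+t. ennreal (rest_cost R q t) * indicator {0<..<R} t + ennreal (rest_cost R q t) * indicator {R<..} t \<partial>lborel)"
  proof (rule nn_integral_cong_AE)
    have "AE t in lborel. t \<noteq> R" by (rule AE_lborel_singleton)
    then show "AE t in lborel. ennreal (rest_cost R q t)
        = ennreal (rest_cost R q t) * indicator {0<..<R} t + ennreal (rest_cost R q t) * indicator {R<..} t"
      by eventually_elim (auto simp: indicator_def rest_cost_def)
  qed
  also have "\<dots> = (\<integral>\<^sup>+t. ennreal (rest_cost R q t) * indicator {0<..<R} t \<partial>lborel)
      + (\<integral>\<^sup>+t. ennreal (rest_cost R q t) * indicator {R<..} t \<partial>lborel)"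
    by (rule nn_integral_add) measurable
  also have "\<dots> \<le> (\<integral>\<^sup>+t. ennreal (2 * real n) * (rest_fun l t * indicator {0<..<R} t) \<partial>lborel)
      + (\<integral>\<^sup>+t. ennreal (2 * real n) * (rest_fun l t * indicator {R<..} t) \<partial>lborel)"
  proof (intro add_mono lo nn_integral_mono)
    fix t
    have "ennreal (real n) * rest_fun l t \<le> ennreal (2 * real n) * rest_fun l t"
      by (intro mult_right_mono ennreal_leI) auto
    then show "ennreal (rest_cost R q t) * indicator {R<..} t \<le> ennreal (2 * real n) * (rest_fun l t * indicator {R<..} t)"
      using hi[of t] by (auto simp: indicator_def)
  qed
  also have "\<dots> = (\<integral>\<^sup>+t. ennreal (2 * real n) * (rest_fun l t * indicator {0<..<R} t) + ennreal (2 * real n) * (rest_fun l t * indicator {R<..} t) \<partial>lborel)"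
    by (rule nn_integral_add[symmetric]) measurable
  also have "\<dots> \<le> (\<integral>\<^sup>+t. ennreal (2 * real n) * rest_fun l t \<partial>lborel)"
    by (intro nn_integral_mono) (auto simp: indicator_def)
  also have "\<dots> = ennreal (2 * real n) * rest_integral l"
    unfolding rest_integral_eq by (rule nn_integral_cmult) measurable
  finally show ?thesis by (rule that[OF R0 q qR])
qed

text \<open>Three nonnegative quantities with sum above \<open>3 * l\<close> cannot all be at most
  \<open>l\<close>. Each of them has its tail bound for the cut chosen at this very level.\<close>

theorem tail_bound:
  assumes l: "l > 0"
  shows "emeasure M {x \<in> space M. ennreal (3 * l) < (\<integral>\<^sup>+t. ennreal \<bar>Z t x\<bar> * indicator {0<..} t \<partial>lborel)}
    \<le> ennreal (2 * K * real n ^ m / l ^ (2*m)) * (\<integral>\<^sup>+t. ennreal (sqrt (S t)) * indicator {0<..} t \<partial>lborel) ^ (2*m)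
     + ennreal (2 * K * real (2*m-1) ^ (2*m-1) * real n / l ^ (2*m-1)) * jump_integral l
     + ennreal (2 * K * real n / l) * rest_integral l"
proof -
  obtain R q where R: "R > 0" and q: "q \<le> n" and qR: "real q * R \<le> l"
    and rc: "(\<integral>\<^sup>+t. ennreal (rest_cost R q t) \<partial>lborel) \<le> ennreal (2 * real n) * rest_integral l"
    using choice_of_cut[OF l] by blast
  let ?g = "\<lambda>x. \<integral>\<^sup>+t. ennreal (gauss_term R q t x) \<partial>lborel"
  let ?j = "\<lambda>x. \<integral>\<^sup>+t. ennreal (jump_term R q t x) \<partial>lborel"
  let ?r = "\<lambda>x. \<integral>\<^sup>+t. ennreal (rest_term R q t x) \<partial>lborel"
  note [measurable] = terms_meas
  have rest: "emeasure M {x \<in> space M. ennreal l < ?r x} \<le> ennreal (2 * K * real n / l) * rest_integral l"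
  proof -
    have "emeasure M {x \<in> space M. ennreal l < ?r x} \<le> ennreal (1 / l) * (\<integral>\<^sup>+t. ennreal (K * rest_cost R q t) \<partial>lborel)"
      by (intro markov_integral rest_term_mean q l terms_meas)
    also have "(\<integral>\<^sup>+t. ennreal (K * rest_cost R q t) \<partial>lborel) = ennreal K * (\<integral>\<^sup>+t. ennreal (rest_cost R q t) \<partial>lborel)"
    proof (subst nn_integral_cmult[symmetric])
      show "(\<lambda>t. ennreal (rest_cost R q t)) \<in> borel_measurable lborel"
        unfolding rest_cost_def by measurable
    qed (simp add: ennreal_mult' K)
    also have "ennreal (1 / l) * (ennreal K * (\<integral>\<^sup>+t. ennreal (rest_cost R q t) \<partial>lborel))
        \<le> ennreal (1 / l) * (ennreal K * (ennreal (2 * real n) * rest_integral l))"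
      by (intro mult_left_mono rc) auto
    also have "\<dots> = ennreal (1 / l * (K * (2 * real n))) * rest_integral l"
    proof -
      have "ennreal (1 / l * (K * (2 * real n))) = ennreal (1 / l) * (ennreal K * ennreal (2 * real n))"
        using l by (subst ennreal_mult'[of "1 / l"]) (simp_all only: ennreal_mult'[OF K] divide_nonneg_pos zero_le_one)
      then show ?thesis by (simp only: mult.assoc)
    qed
    also have "1 / l * (K * (2 * real n)) = 2 * K * real n / l" by simp
    finally show ?thesis .
  qed
  have "{x \<in> space M. ennreal (3 * l) < (\<integral>\<^sup>+t. ennreal \<bar>Z t x\<bar> * indicator {0<..} t \<partial>lborel)}
     \<subseteq> ({x \<in> space M. ennreal l < ?g x} \<union> {x \<in> space M. ennreal l < ?j x}) \<union> {x \<in> space M. ennreal l < ?r x}"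
  proof clarsimp
    fix x assume x: "x \<in> space M" and big: "ennreal (3 * l) < (\<integral>\<^sup>+t. ennreal \<bar>Z t x\<bar> * indicator {0<..} t \<partial>lborel)"
      and "\<not> ennreal l < ?r x" "\<not> ennreal l < ?j x"
    show "ennreal l < ?g x"
    proof (rule ccontr)
      assume "\<not> ennreal l < ?g x"
      have [measurable]: "(\<lambda>t. gauss_term R q t x) \<in> borel_measurable lborel" "(\<lambda>t. jump_term R q t x) \<in> borel_measurable lborel"
        "(\<lambda>t. rest_term R q t x) \<in> borel_measurable lborel"
        using measurable_compose[OF _ terms_meas(1), of "\<lambda>t. (t, x)" lborel]
          measurable_compose[OF _ terms_meas(2), of "\<lambda>t. (t, x)" lborel]
          measurable_compose[OF _ terms_meas(3), of "\<lambda>t. (t, x)" lborel] x by simp_all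
      have "(\<integral>\<^sup>+t. ennreal \<bar>Z t x\<bar> * indicator {0<..} t \<partial>lborel)
        \<le> (\<integral>\<^sup>+t. (ennreal (rest_term R q t x) + ennreal (gauss_term R q t x)) + ennreal (jump_term R q t x) \<partial>lborel)"
      proof (rule nn_integral_mono)
        fix t
        have nn: "0 \<le> gauss_term R q t x" "0 \<le> jump_term R q t x" "0 \<le> rest_term R q t x"
          using cut_nonneg[of q t] by (auto simp: gauss_term_def jump_term_def rest_term_def)
        show "ennreal \<bar>Z t x\<bar> * indicator {0<..} t
          \<le> (ennreal (rest_term R q t x) + ennreal (gauss_term R q t x)) + ennreal (jump_term R q t x)"
        proof (cases "0 < t")
          case True
          then show ?thesis using abs_Z_eq[OF True, of x R q] nn by (simp flip: ennreal_plus)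
        qed simp
      qed
      also have "\<dots> = (?r x + ?g x) + ?j x"
        by (simp add: nn_integral_add)
      also have "\<dots> \<le> (ennreal l + ennreal l) + ennreal l"
        using \<open>\<not> ennreal l < ?g x\<close> \<open>\<not> ennreal l < ?r x\<close> \<open>\<not> ennreal l < ?j x\<close>
        by (intro add_mono) (auto simp: not_less)
      also have "\<dots> = ennreal (3 * l)" using l by (simp flip: ennreal_plus)
      finally show False using big by simp
    qed
  qed
  then have "emeasure M {x \<in> space M. ennreal (3 * l) < (\<integral>\<^sup>+t. ennreal \<bar>Z t x\<bar> * indicator {0<..} t \<partial>lborel)}
     \<le> emeasure M (({x \<in> space M. ennreal l < ?g x} \<union> {x \<in> space M. ennreal l < ?j x}) \<union> {x \<in> space M. ennreal l < ?r x})"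
    by (intro emeasure_mono) measurable
  also have "\<dots> \<le> (emeasure M {x \<in> space M. ennreal l < ?g x} + emeasure M {x \<in> space M. ennreal l < ?j x}) + emeasure M {x \<in> space M. ennreal l < ?r x}"
  proof -
    have s: "{x \<in> space M. ennreal l < ?g x} \<in> sets M" "{x \<in> space M. ennreal l < ?j x} \<in> sets M" "{x \<in> space M. ennreal l < ?r x} \<in> sets M"
      by measurable
    then show ?thesis
      by (intro order_trans[OF emeasure_subadditive] add_right_mono emeasure_subadditive) auto
  qed
  also have "\<dots> \<le> ennreal (2 * K * real n ^ m / l ^ (2*m)) * (\<integral>\<^sup>+t. ennreal (sqrt (S t)) * indicator {0<..} t \<partial>lborel) ^ (2*m)
     + ennreal (2 * K * real (2*m-1) ^ (2*m-1) * real n / l ^ (2*m-1)) * jump_integral l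
     + ennreal (2 * K * real n / l) * rest_integral l"
    by (intro add_mono gauss_term_tail jump_term_tail rest q l R qR)
  finally show ?thesis .
qed

end

section \<open>Integration over the levels\<close>

context truncated_family
begin

definition gauss_scale :: ennreal where
  "gauss_scale = (\<integral>\<^sup>+t. ennreal (sqrt (S t)) * indicator {0<..} t \<partial>lborel)"

text \<open>The common bound, up to constants, for the jump part and the remainder after integration
  over \<open>l\<close>. The layer-cake formula in \<open>u\<close> compares it with the quantile
  integral.\<close>

definition jump_scale :: "real \<Rightarrow> ennreal" where
  "jump_scale p = (\<Sum>k<n. ennreal ((real k + 1) powr (p - 2)) *
     (\<integral>\<^sup>+t. ennreal (t powr (p - 1) * \<gamma> k t) * indicator {0<..} t \<partial>lborel))"

text \<open>With the integrals exchanged, \<open>l powr (p - 2 * real m)\<close> is integrated over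
  \<open>l \<ge> (k + 1) * t\<close>. The condition \<open>p + 2 \<le> 2 * real m\<close> makes this
  converge with a constant at most 1, and adding exponents leaves
  \<open>(k + 1) powr (p - 2)\<close> and \<open>t powr (p - 1)\<close>.\<close>

lemma integrated_jump:
  assumes p: "p > 2" "p + 2 \<le> 2 * real m"
  shows "(\<integral>\<^sup>+l. ennreal (l powr (p - 2 * real m)) * indicator {0<..} l * jump_integral l \<partial>lborel) \<le> jump_scale p"
proof -
  let ?h = "\<lambda>k l t. ennreal (l powr (p - 2 * real m)) * indicator {0<..} l *
     (ennreal (t ^ (2*m-2) * \<gamma> k t) * (if 0 < t \<and> (real k + 1) * t \<le> l then 1 else 0))"
  have [measurable]: "(\<lambda>z. ?h k (fst z) (snd z)) \<in> borel_measurable (borel \<Otimes>\<^sub>M borel)" for k by measurable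
  have ind: "indicator {t. 0 < t \<and> (real k + 1) * t \<le> l} t = (if 0 < t \<and> (real k + 1) * t \<le> l then 1 else 0 :: ennreal)" for k l t
    by (simp add: indicator_def)
  have "(\<integral>\<^sup>+l. ennreal (l powr (p - 2 * real m)) * indicator {0<..} l * jump_integral l \<partial>lborel)
      = (\<integral>\<^sup>+l. (\<Sum>k<n. ennreal ((real k + 1) ^ (2*m-3)) * (\<integral>\<^sup>+t. ?h k l t \<partial>lborel)) \<partial>lborel)"
  proof (rule nn_integral_cong)
    fix l :: real
    have H: "(\<integral>\<^sup>+t. ?h k l t \<partial>lborel) = ennreal (l powr (p - 2 * real m)) * indicator {0<..} l *
        (\<integral>\<^sup>+t. ennreal (t ^ (2*m-2) * \<gamma> k t) * (if 0 < t \<and> (real k + 1) * t \<le> l then 1 else 0) \<partial>lborel)" for k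
      by (rule nn_integral_cmult) measurable
    show "ennreal (l powr (p - 2 * real m)) * indicator {0<..} l * jump_integral l
       = (\<Sum>k<n. ennreal ((real k + 1) ^ (2*m-3)) * (\<integral>\<^sup>+t. ?h k l t \<partial>lborel))"
      unfolding jump_integral_def ind sum_distrib_left H by (rule sum.cong[OF refl], rule mult.left_commute)
  qed
  also have "\<dots> = (\<Sum>k<n. \<integral>\<^sup>+l. ennreal ((real k + 1) ^ (2*m-3)) * (\<integral>\<^sup>+t. ?h k l t \<partial>lborel) \<partial>lborel)"
    by (rule nn_integral_sum) measurable
  also have "\<dots> = (\<Sum>k<n. ennreal ((real k + 1) ^ (2*m-3)) * (\<integral>\<^sup>+l. (\<integral>\<^sup>+t. ?h k l t \<partial>lborel) \<partial>lborel))"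
    by (rule sum.cong[OF refl], rule nn_integral_cmult) measurable
  also have "\<dots> = (\<Sum>k<n. ennreal ((real k + 1) ^ (2*m-3)) * (\<integral>\<^sup>+t. (\<integral>\<^sup>+l. ?h k l t \<partial>lborel) \<partial>lborel))"
  proof (intro sum.cong refl arg_cong[where f = "\<lambda>y. _ * y"])
    fix k
    have "(\<lambda>(l, t). ?h k l t) \<in> borel_measurable (lborel \<Otimes>\<^sub>M lborel)" by measurable
    from lborel_pair.Fubini[OF this]
    show "(\<integral>\<^sup>+l. (\<integral>\<^sup>+t. ?h k l t \<partial>lborel) \<partial>lborel) = (\<integral>\<^sup>+t. (\<integral>\<^sup>+l. ?h k l t \<partial>lborel) \<partial>lborel)" by simp
  qed
  also have "\<dots> \<le> jump_scale p"
    unfolding jump_scale_def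
  proof (rule sum_mono)
    fix k
    have "ennreal ((real k + 1) ^ (2*m-3)) * (\<integral>\<^sup>+t. (\<integral>\<^sup>+l. ?h k l t \<partial>lborel) \<partial>lborel)
       = (\<integral>\<^sup>+t. ennreal ((real k + 1) ^ (2*m-3)) * (\<integral>\<^sup>+l. ?h k l t \<partial>lborel) \<partial>lborel)"
      by (rule nn_integral_cmult[symmetric]) measurable
    also have "\<dots> \<le> (\<integral>\<^sup>+t. ennreal ((real k + 1) powr (p - 2)) * (ennreal (t powr (p - 1) * \<gamma> k t) * indicator {0<..} t) \<partial>lborel)"
    proof (rule nn_integral_mono)
      fix t :: real
      show "ennreal ((real k + 1) ^ (2*m-3)) * (\<integral>\<^sup>+l. ?h k l t \<partial>lborel)
          \<le> ennreal ((real k + 1) powr (p - 2)) * (ennreal (t powr (p - 1) * \<gamma> k t) * indicator {0<..} t)"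
      proof (cases "0 < t")
        case True
        let ?a = "(real k + 1) * t" and ?e = "p - 2 * real m"
        have a: "?a > 0" using True by (intro mult_pos_pos) auto
        have "(\<integral>\<^sup>+l. ?h k l t \<partial>lborel) = (\<integral>\<^sup>+l. ennreal (t ^ (2*m-2) * \<gamma> k t) * (ennreal (l powr ?e) * indicator {?a..} l) \<partial>lborel)"
        proof (rule nn_integral_cong)
          fix l :: real
          show "?h k l t = ennreal (t ^ (2*m-2) * \<gamma> k t) * (ennreal (l powr ?e) * indicator {?a..} l)"
          proof (cases "?a \<le> l")
            case le: True
            then have "0 < l" using a by linarith
            then show ?thesis using le True by (simp add: mult.commute)
          qed simp
        qed
        also have "\<dots> = ennreal (t ^ (2*m-2) * \<gamma> k t) * (\<integral>\<^sup>+l. ennreal (l powr ?e) * indicator {?a..} l \<partial>lborel)"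
          by (rule nn_integral_cmult) measurable
        finally have i1: "(\<integral>\<^sup>+l. ?h k l t \<partial>lborel) = \<dots>" .
        have "(\<integral>\<^sup>+l. ennreal (l powr ?e) * indicator {?a..} l \<partial>lborel) = ennreal (?a powr (?e + 1) / (- ?e - 1))"
          using p a by (intro nn_integral_powr_to_inf) auto
        also have "\<dots> \<le> ennreal (?a powr (?e + 1))"
        proof (rule ennreal_leI)
          have "?a powr (?e + 1) / (- ?e - 1) \<le> ?a powr (?e + 1) / 1"
            using p by (intro divide_left_mono) auto
          then show "?a powr (?e + 1) / (- ?e - 1) \<le> ?a powr (?e + 1)" by simp
        qed
        finally have i2: "(\<integral>\<^sup>+l. ennreal (l powr ?e) * indicator {?a..} l \<partial>lborel) \<le> ennreal (?a powr (?e + 1))" .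
        have "ennreal ((real k + 1) ^ (2*m-3)) * (\<integral>\<^sup>+l. ?h k l t \<partial>lborel)
           \<le> ennreal ((real k + 1) ^ (2*m-3)) * (ennreal (t ^ (2*m-2) * \<gamma> k t) * ennreal (?a powr (?e + 1)))"
          unfolding i1 by (intro mult_left_mono i2) auto
        also have "\<dots> = ennreal ((real k + 1) ^ (2*m-3) * (t ^ (2*m-2) * \<gamma> k t * ?a powr (?e + 1)))"
          using True by (simp add: ennreal_mult \<gamma>_nonneg)
        also have "(real k + 1) ^ (2*m-3) * (t ^ (2*m-2) * \<gamma> k t * ?a powr (?e + 1))
           = (real k + 1) powr (p - 2) * (t powr (p - 1) * \<gamma> k t)"
        proof -
          have r: "real (2*m-3) = 2 * real m - 3" "real (2*m-2) = 2 * real m - 2" using m by (simp_all add: of_nat_diff)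
          have e1: "(real k + 1) ^ (2*m-3) * (real k + 1) powr (?e + 1) = (real k + 1) powr (p - 2)"
            by (subst powr_realpow[symmetric]) (simp_all add: r flip: powr_add)
          have e2: "t ^ (2*m-2) * t powr (?e + 1) = t powr (p - 1)"
            using True by (subst powr_realpow[symmetric]) (simp_all add: r flip: powr_add)
          have e3: "?a powr (?e + 1) = (real k + 1) powr (?e + 1) * t powr (?e + 1)"
            using True by (intro powr_mult)
          have "c * (u * g * (c' * t')) = (c * c') * ((u * t') * g)" for c u g c' t' :: real by (simp only: mult_ac)
          then show ?thesis unfolding e3 e1[symmetric] e2[symmetric] .
        qed
        also have "ennreal ((real k + 1) powr (p - 2) * (t powr (p - 1) * \<gamma> k t))
           = ennreal ((real k + 1) powr (p - 2)) * (ennreal (t powr (p - 1) * \<gamma> k t) * indicator {0<..} t)"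
          using True by (simp add: ennreal_mult')
        finally show ?thesis .
      qed simp
    qed
    also have "\<dots> = ennreal ((real k + 1) powr (p - 2)) * (\<integral>\<^sup>+t. ennreal (t powr (p - 1) * \<gamma> k t) * indicator {0<..} t \<partial>lborel)"
      by (rule nn_integral_cmult) measurable
    finally show "ennreal ((real k + 1) ^ (2*m-3)) * (\<integral>\<^sup>+t. (\<integral>\<^sup>+l. ?h k l t \<partial>lborel) \<partial>lborel)
        \<le> ennreal ((real k + 1) powr (p - 2)) * (\<integral>\<^sup>+t. ennreal (t powr (p - 1) * \<gamma> k t) * indicator {0<..} t \<partial>lborel)" .
  qed
  finally show ?thesis .
qed

text \<open>For fixed \<open>k\<close> and \<open>t\<close> the admissible levels lie in an interval
  of length \<open>2 * t\<close>, on which \<open>l powr (p - 2)\<close> is at most its value at the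
  right end, because \<open>p > 2\<close>.\<close>

lemma integrated_rest:
  assumes p: "p > 2"
  shows "(\<integral>\<^sup>+l. ennreal (l powr (p - 2)) * indicator {0<..} l * rest_integral l \<partial>lborel) \<le> ennreal (2 powr (p - 1)) * jump_scale p"
proof -
  let ?h = "\<lambda>k l t. ennreal (l powr (p - 2)) * indicator {0<..} l *
     (ennreal (\<gamma> k t) * (if 0 < t \<and> 2 * real k * t \<le> l \<and> l < 2 * (real k + 1) * t then 1 else 0))"
  have [measurable]: "(\<lambda>z. ?h k (fst z) (snd z)) \<in> borel_measurable (borel \<Otimes>\<^sub>M borel)" for k by measurable
  have ind: "indicator {t. 0 < t \<and> 2 * real k * t \<le> l \<and> l < 2 * (real k + 1) * t} t
      = (if 0 < t \<and> 2 * real k * t \<le> l \<and> l < 2 * (real k + 1) * t then 1 else 0 :: ennreal)" for k l t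
    by (simp add: indicator_def)
  have "(\<integral>\<^sup>+l. ennreal (l powr (p - 2)) * indicator {0<..} l * rest_integral l \<partial>lborel)
      = (\<integral>\<^sup>+l. (\<Sum>k<n. (\<integral>\<^sup>+t. ?h k l t \<partial>lborel)) \<partial>lborel)"
  proof (rule nn_integral_cong)
    fix l :: real
    have H: "(\<integral>\<^sup>+t. ?h k l t \<partial>lborel) = ennreal (l powr (p - 2)) * indicator {0<..} l *
        (\<integral>\<^sup>+t. ennreal (\<gamma> k t) * (if 0 < t \<and> 2 * real k * t \<le> l \<and> l < 2 * (real k + 1) * t then 1 else 0) \<partial>lborel)" for k
      by (rule nn_integral_cmult) measurable
    show "ennreal (l powr (p - 2)) * indicator {0<..} l * rest_integral l = (\<Sum>k<n. (\<integral>\<^sup>+t. ?h k l t \<partial>lborel))"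
      unfolding rest_integral_def ind sum_distrib_left H ..
  qed
  also have "\<dots> = (\<Sum>k<n. \<integral>\<^sup>+l. (\<integral>\<^sup>+t. ?h k l t \<partial>lborel) \<partial>lborel)"
    by (rule nn_integral_sum) measurable
  also have "\<dots> = (\<Sum>k<n. (\<integral>\<^sup>+t. (\<integral>\<^sup>+l. ?h k l t \<partial>lborel) \<partial>lborel))"
  proof (intro sum.cong refl)
    fix k
    have "(\<lambda>(l, t). ?h k l t) \<in> borel_measurable (lborel \<Otimes>\<^sub>M lborel)" by measurable
    from lborel_pair.Fubini[OF this]
    show "(\<integral>\<^sup>+l. (\<integral>\<^sup>+t. ?h k l t \<partial>lborel) \<partial>lborel) = (\<integral>\<^sup>+t. (\<integral>\<^sup>+l. ?h k l t \<partial>lborel) \<partial>lborel)" by simp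
  qed
  also have "\<dots> \<le> (\<Sum>k<n. ennreal (2 powr (p - 1)) * (ennreal ((real k + 1) powr (p - 2)) *
     (\<integral>\<^sup>+t. ennreal (t powr (p - 1) * \<gamma> k t) * indicator {0<..} t \<partial>lborel)))"
  proof (rule sum_mono)
    fix k
    have "(\<integral>\<^sup>+t. (\<integral>\<^sup>+l. ?h k l t \<partial>lborel) \<partial>lborel)
      \<le> (\<integral>\<^sup>+t. ennreal (2 powr (p - 1) * (real k + 1) powr (p - 2)) * (ennreal (t powr (p - 1) * \<gamma> k t) * indicator {0<..} t) \<partial>lborel)"
    proof (rule nn_integral_mono)
      fix t :: real
      show "(\<integral>\<^sup>+l. ?h k l t \<partial>lborel)
          \<le> ennreal (2 powr (p - 1) * (real k + 1) powr (p - 2)) * (ennreal (t powr (p - 1) * \<gamma> k t) * indicator {0<..} t)"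
      proof (cases "0 < t")
        case True
        let ?a = "2 * real k * t" and ?b = "2 * (real k + 1) * t"
        have ab: "0 \<le> ?a" "?a \<le> ?b" "0 < ?b" using True by (auto intro!: mult_pos_pos)
        have "(\<integral>\<^sup>+l. ?h k l t \<partial>lborel) \<le> (\<integral>\<^sup>+l. ennreal (\<gamma> k t * ?b powr (p - 2)) * indicator {?a..<?b} l \<partial>lborel)"
        proof (rule nn_integral_mono)
          fix l :: real
          show "?h k l t \<le> ennreal (\<gamma> k t * ?b powr (p - 2)) * indicator {?a..<?b} l"
          proof (cases "0 < l \<and> l \<in> {?a..<?b}")
            case l: True
            have "l powr (p - 2) \<le> ?b powr (p - 2)" using l p by (intro powr_mono2) auto
            then have "ennreal (l powr (p - 2)) * ennreal (\<gamma> k t) \<le> ennreal (\<gamma> k t * ?b powr (p - 2))"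
              by (simp add: \<gamma>_nonneg mult.commute mult_left_mono ennreal_leI flip: ennreal_mult)
            then show ?thesis using l True by simp
          qed (auto simp: indicator_def)
        qed
        also have "\<dots> = ennreal (\<gamma> k t * ?b powr (p - 2)) * ennreal (?b - ?a)"
          using ab by (subst nn_integral_cmult_indicator) auto
        also have "\<dots> = ennreal (\<gamma> k t * ?b powr (p - 2) * (?b - ?a))"
          using ab by (subst ennreal_mult) (auto simp: \<gamma>_nonneg)
        also have "\<gamma> k t * ?b powr (p - 2) * (?b - ?a) = (2 powr (p - 1) * (real k + 1) powr (p - 2)) * (t powr (p - 1) * \<gamma> k t)"
        proof -
          have "?b powr (p - 2) = 2 powr (p - 2) * (real k + 1) powr (p - 2) * t powr (p - 2)"
            using True by (simp only: powr_mult)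
          moreover have "?b - ?a = 2 * t" by (simp add: algebra_simps)
          moreover have "2 powr (p - 1) = 2 powr (p - 2) * (2::real)"
            using powr_add[of 2 "p - 2" 1] by simp
          moreover have "t powr (p - 1) = t powr (p - 2) * t"
            using powr_add[of t "p - 2" 1] True by simp
          ultimately show ?thesis by (simp only: mult_ac)
        qed
        also have "ennreal \<dots> = ennreal (2 powr (p - 1) * (real k + 1) powr (p - 2)) * (ennreal (t powr (p - 1) * \<gamma> k t) * indicator {0<..} t)"
          using True by (subst ennreal_mult) (auto simp: \<gamma>_nonneg)
        finally show ?thesis .
      next
        case False
        then show ?thesis by simp
      qed
    qed
    also have "\<dots> = ennreal (2 powr (p - 1) * (real k + 1) powr (p - 2)) * (\<integral>\<^sup>+t. ennreal (t powr (p - 1) * \<gamma> k t) * indicator {0<..} t \<partial>lborel)"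
      by (rule nn_integral_cmult) measurable
    also have "\<dots> = ennreal (2 powr (p - 1)) * (ennreal ((real k + 1) powr (p - 2)) * (\<integral>\<^sup>+t. ennreal (t powr (p - 1) * \<gamma> k t) * indicator {0<..} t \<partial>lborel))"
      by (subst ennreal_mult) (auto simp: mult.assoc)
    finally show "(\<integral>\<^sup>+t. (\<integral>\<^sup>+l. ?h k l t \<partial>lborel) \<partial>lborel)
      \<le> ennreal (2 powr (p - 1)) * (ennreal ((real k + 1) powr (p - 2)) * (\<integral>\<^sup>+t. ennreal (t powr (p - 1) * \<gamma> k t) * indicator {0<..} t \<partial>lborel))" .
  qed
  also have "\<dots> = ennreal (2 powr (p - 1)) * jump_scale p"
    unfolding jump_scale_def by (rule sum_distrib_left[symmetric])
  finally show ?thesis .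
qed

end

text \<open>\<open>3 powr p\<close> stems from the level \<open>3 * l\<close> in
  \<open>tail_bound\<close>. In the bracket, \<open>1 + 2 * K * p\<close> belongs to the Gaussian
  part, the next summand to the jump part and the last one to the remainder.\<close>

definition integral_const :: "nat \<Rightarrow> real \<Rightarrow> real \<Rightarrow> real" where
  "integral_const m K p =
     3 powr p * (1 + 2 * K * p + p * (2 * K * real (2*m-1) ^ (2*m-1)) + p * (2 * K) * 2 powr (p - 1))"

lemma integral_const_pos: "K \<ge> 0 \<Longrightarrow> p > 0 \<Longrightarrow> integral_const m K p > 0"
  unfolding integral_const_def by (intro mult_pos_pos add_pos_nonneg) auto

context truncated_family
begin

text \<open>The tail of order \<open>2*m\<close> is integrable against \<open>l powr (p - 1)\<close>
  only away from 0. Below the typical size \<open>X\<close> the trivial bound 1 for a probability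
  takes its place.\<close>

lemma integrated_gauss:
  assumes p: "p > 2" "p + 2 \<le> 2 * real m" and X: "X \<ge> 0"
  shows "(\<integral>\<^sup>+l. ennreal (p * l powr (p - 1)) * indicator {0<..} l *
      (if l < X then 1 else ennreal (2 * K * X ^ (2*m) / l ^ (2*m))) \<partial>lborel) \<le> ennreal ((1 + 2 * K * p) * X powr p)"
proof (cases "X = 0")
  case True
  then have "ennreal (p * l powr (p - 1)) * indicator {0<..} l * (if l < X then 1 else ennreal (2 * K * X ^ (2*m) / l ^ (2*m))) = 0" for l
    using m by (auto simp: power_0_left indicator_def)
  then show ?thesis by (simp only:) simp
next
  case False
  then have X0: "X > 0" using X by simp
  let ?e = "p - 1 - 2 * real m"
  have "(\<integral>\<^sup>+l. ennreal (p * l powr (p - 1)) * indicator {0<..} l *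
      (if l < X then 1 else ennreal (2 * K * X ^ (2*m) / l ^ (2*m))) \<partial>lborel)
    \<le> (\<integral>\<^sup>+l. ennreal p * (ennreal (l powr (p - 1)) * indicator {0..X} l) +
           ennreal (2 * K * p * X ^ (2*m)) * (ennreal (l powr ?e) * indicator {X..} l) \<partial>lborel)"
  proof (rule nn_integral_mono)
    fix l :: real
    show "ennreal (p * l powr (p - 1)) * indicator {0<..} l * (if l < X then 1 else ennreal (2 * K * X ^ (2*m) / l ^ (2*m)))
      \<le> ennreal p * (ennreal (l powr (p - 1)) * indicator {0..X} l) +
           ennreal (2 * K * p * X ^ (2*m)) * (ennreal (l powr ?e) * indicator {X..} l)"
    proof (cases "l < X")
      case True
      then show ?thesis using p by (cases "0 < l") (auto simp: ennreal_mult)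
    next
      case False
      then have l: "X \<le> l" "0 < l" using X0 by auto
      have "(p * l powr (p - 1)) * (2 * K * X ^ (2*m) / l ^ (2*m)) = (2 * K * p * X ^ (2*m)) * l powr ?e"
      proof -
        have "l powr ?e = l powr (p - 1) / l powr (real (2*m))" using l by (simp add: powr_diff)
        also have "l powr (real (2*m)) = l ^ (2*m)" using l by (intro powr_realpow) simp
        finally show ?thesis by simp
      qed
      then have "ennreal (p * l powr (p - 1)) * ennreal (2 * K * X ^ (2*m) / l ^ (2*m)) = ennreal (2 * K * p * X ^ (2*m)) * ennreal (l powr ?e)"
        using p K l X by (simp flip: ennreal_mult)
      then show ?thesis using l False by simp
    qed
  qed
  also have "\<dots> = (\<integral>\<^sup>+l. ennreal p * (ennreal (l powr (p - 1)) * indicator {0..X} l) \<partial>lborel) +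
        (\<integral>\<^sup>+l. ennreal (2 * K * p * X ^ (2*m)) * (ennreal (l powr ?e) * indicator {X..} l) \<partial>lborel)"
    by (rule nn_integral_add) measurable
  also have "(\<integral>\<^sup>+l. ennreal p * (ennreal (l powr (p - 1)) * indicator {0..X} l) \<partial>lborel) = ennreal p * ennreal (X powr (p - 1 + 1) / (p - 1 + 1))"
    using p X by (subst nn_integral_cmult) (auto simp: nn_integral_powr_from_0)
  also have "\<dots> = ennreal (X powr p)" using p by (simp flip: ennreal_mult)
  also have "(\<integral>\<^sup>+l. ennreal (2 * K * p * X ^ (2*m)) * (ennreal (l powr ?e) * indicator {X..} l) \<partial>lborel)
      = ennreal (2 * K * p * X ^ (2*m)) * ennreal (X powr (?e + 1) / (- ?e - 1))"
    using p X0 by (subst nn_integral_cmult) (auto simp: nn_integral_powr_to_inf)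
  also have "\<dots> = ennreal (2 * K * p * X ^ (2*m) * (X powr (?e + 1) / (- ?e - 1)))"
    using p K X0 by (subst ennreal_mult) auto
  finally have A: "(\<integral>\<^sup>+l. ennreal (p * l powr (p - 1)) * indicator {0<..} l *
      (if l < X then 1 else ennreal (2 * K * X ^ (2*m) / l ^ (2*m))) \<partial>lborel)
     \<le> ennreal (X powr p) + ennreal (2 * K * p * X ^ (2*m) * (X powr (?e + 1) / (- ?e - 1)))" .
  have B: "2 * K * p * X ^ (2*m) * (X powr (?e + 1) / (- ?e - 1)) \<le> 2 * K * p * X powr p"
  proof -
    have "X ^ (2*m) * (X powr (?e + 1) / (- ?e - 1)) \<le> X ^ (2*m) * (X powr (?e + 1) / 1)"
      using p X0 by (intro mult_left_mono divide_left_mono) auto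
    also have "\<dots> = X powr (real (2*m)) * X powr (?e + 1)" using X0 by (simp only: powr_realpow div_by_1)
    also have "\<dots> = X powr p" by (simp flip: powr_add)
    finally have "2 * K * p * (X ^ (2*m) * (X powr (?e + 1) / (- ?e - 1))) \<le> 2 * K * p * X powr p"
      using K p by (intro mult_left_mono) auto
    then show ?thesis by (simp only: mult.assoc)
  qed
  have "ennreal (X powr p) + ennreal (2 * K * p * X ^ (2*m) * (X powr (?e + 1) / (- ?e - 1)))
      \<le> ennreal (X powr p) + ennreal (2 * K * p * X powr p)"
    by (intro add_left_mono ennreal_leI B)
  also have "\<dots> = ennreal ((1 + 2 * K * p) * X powr p)"
    using K p by (simp add: distrib_right flip: ennreal_plus)
  finally show ?thesis using A by (rule order_trans[rotated])
qed

theorem moment_of_integral: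
  assumes p: "p > 2" "p + 2 \<le> 2 * real m"
  shows "(\<integral>\<^sup>+x. ennpowr (\<integral>\<^sup>+t. ennreal \<bar>Z t x\<bar> * indicator {0<..} t \<partial>lborel) p \<partial>M)
    \<le> ennreal (integral_const m K p) * (ennreal (real n powr (p / 2)) * ennpowr gauss_scale p + ennreal (real n) * jump_scale p)"
proof (cases gauss_scale)
  \<comment> \<open>An infinite Gaussian scale makes the right side infinite, since \<open>n\<close>
    and the constant are positive.\<close>
  case top
  have "ennreal (real n powr (p / 2)) * ennpowr gauss_scale p = top"
    using top n by (simp add: ennpowr_def ennreal_mult_top)
  then show ?thesis using integral_const_pos[OF K, of p m] p by (simp add: ennreal_mult_top)
next
  case (real \<sigma>)
  define X where "X = sqrt (real n) * \<sigma>"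
  have X0: "X \<ge> 0" using real by (simp add: X_def)
  define G where "G x = (\<integral>\<^sup>+t. ennreal \<bar>Z t x\<bar> * indicator {0<..} t \<partial>lborel)" for x
  interpret P: pair_sigma_finite lborel M
    by (simp add: pair_sigma_finite_def sigma_finite_lborel sigma_finite_measure_axioms)
  note [measurable] = Z_meas
  have Gm [measurable]: "G \<in> borel_measurable M"
    unfolding G_def[abs_def] by measurable
  let ?p = "\<lambda>l. ennreal (p * l powr (p - 1)) * indicator {0<..} l"
  let ?g = "\<lambda>l. if l < X then 1 else ennreal (2 * K * X ^ (2*m) / l ^ (2*m))"
  let ?c = "2 * K * real (2*m-1) ^ (2*m-1) * real n" and ?d = "2 * K * real n"
  have tail: "?p l * emeasure M {x \<in> space M. ennreal (3 * l) < G x}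
     \<le> ?p l * ?g l + (ennreal (p * ?c) * (ennreal (l powr (p - 2 * real m)) * indicator {0<..} l * jump_integral l)
        + ennreal (p * ?d) * (ennreal (l powr (p - 2)) * indicator {0<..} l * rest_integral l))" for l
  proof (cases "0 < l")
    case True
    let ?J = "ennreal (?c / l ^ (2*m-1)) * jump_integral l" and ?R = "ennreal (?d / l) * rest_integral l"
    have "emeasure M {x \<in> space M. ennreal (3 * l) < G x} \<le> ?g l + (?J + ?R)"
    proof (cases "l < X")
      case True
      have "emeasure M {x \<in> space M. ennreal (3 * l) < G x} \<le> 1" by (rule emeasure_le_1)
      then show ?thesis using True by (simp add: add_increasing2)
    next
      case False
      have "X ^ (2*m) = real n ^ m * \<sigma> ^ (2*m)"
        by (simp add: X_def power_mult_distrib power_mult)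
      then have "ennreal (2 * K * X ^ (2*m) / l ^ (2*m)) = ennreal (2 * K * real n ^ m / l ^ (2*m) * \<sigma> ^ (2*m))"
        by (simp add: mult.assoc)
      also have "\<dots> = ennreal (2 * K * real n ^ m / l ^ (2*m)) * gauss_scale ^ (2*m)"
        using real True K by (simp add: ennreal_power flip: ennreal_mult)
      finally show ?thesis
        using tail_bound[OF True] False by (simp add: G_def gauss_scale_def[symmetric] add.assoc)
    qed
    then have "?p l * emeasure M {x \<in> space M. ennreal (3 * l) < G x} \<le> ?p l * (?g l + (?J + ?R))"
      by (rule mult_left_mono) simp
    also have "\<dots> = ?p l * ?g l + (?p l * ?J + ?p l * ?R)" by (simp only: distrib_left)
    also have "?p l * ?J = ennreal (p * ?c) * (ennreal (l powr (p - 2 * real m)) * indicator {0<..} l * jump_integral l)"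
    proof -
      have "(p * l powr (p - 1)) * (?c / l ^ (2*m-1)) = (p * ?c) * l powr (p - 2 * real m)"
      proof -
        have "l ^ (2*m-1) = l powr real (2*m-1)" using True by (rule powr_realpow[symmetric])
        then have "l powr (p - 1) / l ^ (2*m-1) = l powr (p - 1 - real (2*m-1))" by (simp only: powr_diff)
        also have "p - 1 - real (2*m-1) = p - 2 * real m" using m by (simp add: of_nat_diff)
        finally have e: "l powr (p - 1) / l ^ (2*m-1) = l powr (p - 2 * real m)" .
        have "(p * l powr (p - 1)) * (?c / l ^ (2*m-1)) = (p * ?c) * (l powr (p - 1) / l ^ (2*m-1))" by simp
        then show ?thesis unfolding e .
      qed
      then have "ennreal (p * l powr (p - 1)) * ennreal (?c / l ^ (2*m-1)) = ennreal (p * ?c) * ennreal (l powr (p - 2 * real m))"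
        using p K True by (simp only: ennreal_mult'[symmetric] mult_nonneg_nonneg powr_ge_zero less_imp_le of_nat_0_le_iff zero_le_power zero_le_numeral)
      then show ?thesis using True by (simp add: mult.assoc[symmetric])
    qed
    also have "?p l * ?R = ennreal (p * ?d) * (ennreal (l powr (p - 2)) * indicator {0<..} l * rest_integral l)"
    proof -
      have "(p * l powr (p - 1)) * (?d / l) = (p * ?d) * l powr (p - 2)"
      proof -
        have "l powr (p - 1) / l powr 1 = l powr (p - 1 - 1)" by (simp only: powr_diff)
        then have e: "l powr (p - 1) / l = l powr (p - 2)" using True by simp
        have "(p * l powr (p - 1)) * (?d / l) = (p * ?d) * (l powr (p - 1) / l)" by simp
        then show ?thesis unfolding e .
      qed
      then have "ennreal (p * l powr (p - 1)) * ennreal (?d / l) = ennreal (p * ?d) * ennreal (l powr (p - 2))"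
        using p K True by (simp only: ennreal_mult'[symmetric] mult_nonneg_nonneg powr_ge_zero less_imp_le of_nat_0_le_iff zero_le_power zero_le_numeral)
      then show ?thesis using True by (simp add: mult.assoc[symmetric])
    qed
    finally show ?thesis .
  qed simp
  have [measurable]: "jump_integral \<in> borel_measurable borel"
    unfolding jump_integral_def[abs_def] by measurable
  have [measurable]: "rest_integral \<in> borel_measurable borel"
    unfolding rest_integral_def[abs_def] by measurable
  have "(\<integral>\<^sup>+x. ennpowr (G x) p \<partial>M) \<le> (\<integral>\<^sup>+x. ennreal (3 powr p) * (\<integral>\<^sup>+l. ?p l * (if ennreal (3 * l) < G x then 1 else 0) \<partial>lborel) \<partial>M)"
    using p by (intro nn_integral_mono ennpowr_le_layer_cake) auto
  also have "\<dots> = ennreal (3 powr p) * (\<integral>\<^sup>+x. (\<integral>\<^sup>+l. ?p l * (if ennreal (3 * l) < G x then 1 else 0) \<partial>lborel) \<partial>M)"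
    by (rule nn_integral_cmult) measurable
  also have "(\<integral>\<^sup>+x. (\<integral>\<^sup>+l. ?p l * (if ennreal (3 * l) < G x then 1 else 0) \<partial>lborel) \<partial>M)
      = (\<integral>\<^sup>+l. (\<integral>\<^sup>+x. ?p l * (if ennreal (3 * l) < G x then 1 else 0) \<partial>M) \<partial>lborel)"
  proof -
    have "(\<lambda>(l, x). ?p l * (if ennreal (3 * l) < G x then 1 else 0)) \<in> borel_measurable (lborel \<Otimes>\<^sub>M M)" by measurable
    from P.Fubini[OF this] show ?thesis by simp
  qed
  also have "\<dots> = (\<integral>\<^sup>+l. ?p l * emeasure M {x \<in> space M. ennreal (3 * l) < G x} \<partial>lborel)"
  proof (rule nn_integral_cong)
    fix l :: real
    have "(\<integral>\<^sup>+x. ?p l * (if ennreal (3 * l) < G x then 1 else 0) \<partial>M) = ?p l * (\<integral>\<^sup>+x. (if ennreal (3 * l) < G x then 1 else 0) \<partial>M)"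
      by (rule nn_integral_cmult) measurable
    also have "(\<integral>\<^sup>+x. (if ennreal (3 * l) < G x then 1 else 0) \<partial>M) = (\<integral>\<^sup>+x. indicator {x \<in> space M. ennreal (3 * l) < G x} x \<partial>M)"
      by (intro nn_integral_cong) (auto simp: indicator_def)
    also have "\<dots> = emeasure M {x \<in> space M. ennreal (3 * l) < G x}" by (rule nn_integral_indicator) measurable
    finally show "(\<integral>\<^sup>+x. ?p l * (if ennreal (3 * l) < G x then 1 else 0) \<partial>M) = ?p l * emeasure M {x \<in> space M. ennreal (3 * l) < G x}" .
  qed
  finally have E1: "(\<integral>\<^sup>+x. ennpowr (G x) p \<partial>M) \<le> ennreal (3 powr p) * (\<integral>\<^sup>+l. ?p l * emeasure M {x \<in> space M. ennreal (3 * l) < G x} \<partial>lborel)" .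
  let ?j = "\<lambda>l. ennreal (l powr (p - 2 * real m)) * indicator {0<..} l * jump_integral l"
  let ?r = "\<lambda>l. ennreal (l powr (p - 2)) * indicator {0<..} l * rest_integral l"
  let ?gs = "ennreal (real n powr (p / 2)) * ennpowr gauss_scale p" and ?js = "ennreal (real n) * jump_scale p"
  have "(\<integral>\<^sup>+l. ?p l * emeasure M {x \<in> space M. ennreal (3 * l) < G x} \<partial>lborel)
     \<le> (\<integral>\<^sup>+l. ?p l * ?g l + (ennreal (p * ?c) * (ennreal (l powr (p - 2 * real m)) * indicator {0<..} l * jump_integral l)
        + ennreal (p * ?d) * (ennreal (l powr (p - 2)) * indicator {0<..} l * rest_integral l)) \<partial>lborel)"
    by (intro nn_integral_mono tail)
  also have "\<dots> = (\<integral>\<^sup>+l. ?p l * ?g l \<partial>lborel) + (ennreal (p * ?c) * (\<integral>\<^sup>+l. ?j l \<partial>lborel)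
        + ennreal (p * ?d) * (\<integral>\<^sup>+l. ?r l \<partial>lborel))"
  proof -
    have "(\<integral>\<^sup>+l. ?p l * ?g l + (ennreal (p * ?c) * ?j l + ennreal (p * ?d) * ?r l) \<partial>lborel)
        = (\<integral>\<^sup>+l. ?p l * ?g l \<partial>lborel) + (\<integral>\<^sup>+l. ennreal (p * ?c) * ?j l + ennreal (p * ?d) * ?r l \<partial>lborel)"
      by (rule nn_integral_add) measurable
    moreover have "(\<integral>\<^sup>+l. ennreal (p * ?c) * ?j l + ennreal (p * ?d) * ?r l \<partial>lborel)
        = (\<integral>\<^sup>+l. ennreal (p * ?c) * ?j l \<partial>lborel) + (\<integral>\<^sup>+l. ennreal (p * ?d) * ?r l \<partial>lborel)"
      by (rule nn_integral_add) measurable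
    moreover have "(\<integral>\<^sup>+l. ennreal (p * ?c) * ?j l \<partial>lborel) = ennreal (p * ?c) * (\<integral>\<^sup>+l. ?j l \<partial>lborel)"
      by (rule nn_integral_cmult) measurable
    moreover have "(\<integral>\<^sup>+l. ennreal (p * ?d) * ?r l \<partial>lborel) = ennreal (p * ?d) * (\<integral>\<^sup>+l. ?r l \<partial>lborel)"
      by (rule nn_integral_cmult) measurable
    ultimately show ?thesis by (simp only:)
  qed
  also have "\<dots> \<le> ennreal ((1 + 2 * K * p) * X powr p) + (ennreal (p * ?c) * jump_scale p + ennreal (p * ?d) * (ennreal (2 powr (p - 1)) * jump_scale p))"
    by (intro add_mono mult_left_mono integrated_gauss[OF p X0] integrated_jump[OF p] integrated_rest[OF p(1)]) auto
  also have "\<dots> = ennreal (1 + 2 * K * p) * ?gs + (ennreal (p * (2 * K * real (2*m-1) ^ (2*m-1))) * ?js + ennreal (p * (2 * K) * 2 powr (p - 1)) * ?js)"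
  proof (intro arg_cong2[where f = "(+)"])
    have "X powr p = real n powr (p / 2) * \<sigma> powr p"
      using real by (simp add: X_def powr_mult powr_half_sqrt[symmetric] powr_powr)
    then have "ennreal ((1 + 2 * K * p) * X powr p) = ennreal (1 + 2 * K * p) * (ennreal (real n powr (p / 2)) * ennreal (\<sigma> powr p))"
      using K p by (simp add: ennreal_mult')
    then show "ennreal ((1 + 2 * K * p) * X powr p) = ennreal (1 + 2 * K * p) * ?gs"
      using real by (simp add: ennpowr_def)
    have "ennreal (p * ?c) = ennreal (p * (2 * K * real (2*m-1) ^ (2*m-1))) * ennreal (real n)"
      using K p by (subst ennreal_mult[symmetric]) (auto simp: mult.assoc)
    then show "ennreal (p * ?c) * jump_scale p = ennreal (p * (2 * K * real (2*m-1) ^ (2*m-1))) * ?js"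
      by (simp only: mult.assoc)
    have "ennreal (p * ?d) * ennreal (2 powr (p - 1)) = ennreal (p * (2 * K) * 2 powr (p - 1)) * ennreal (real n)"
      using K p by (subst (1 2) ennreal_mult[symmetric]) (auto simp: mult_ac)
    then show "ennreal (p * ?d) * (ennreal (2 powr (p - 1)) * jump_scale p) = ennreal (p * (2 * K) * 2 powr (p - 1)) * ?js"
      by (simp only: mult.assoc[symmetric])
  qed
  also have "\<dots> \<le> ennreal (integral_const m K p / 3 powr p) * (?gs + ?js)"
  proof -
    define a b d where "a = 1 + 2 * K * p" and "b = p * (2 * K * real (2*m-1) ^ (2*m-1))" and "d = p * (2 * K) * 2 powr (p - 1)"
    have abd: "a \<ge> 0" "b \<ge> 0" "d \<ge> 0" using K p by (auto simp: a_def b_def d_def)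
    have ic: "integral_const m K p / 3 powr p = a + (b + d)" by (simp add: integral_const_def a_def b_def d_def)
    have "ennreal a * ?gs + (ennreal b * ?js + ennreal d * ?js) = ennreal a * ?gs + ennreal (b + d) * ?js"
      using abd by (simp add: distrib_right ennreal_plus)
    also have "\<dots> \<le> ennreal (a + (b + d)) * ?gs + ennreal (a + (b + d)) * ?js"
    proof -
      have f: "ennreal a \<le> ennreal (a + (b + d))" "ennreal (b + d) \<le> ennreal (a + (b + d))"
        using abd by (auto intro!: ennreal_leI)
      show ?thesis by (rule add_mono[OF mult_right_mono[OF f(1)] mult_right_mono[OF f(2)]]) simp_all
    qed
    also have "\<dots> = ennreal (a + (b + d)) * (?gs + ?js)" by (simp only: distrib_left)
    finally show ?thesis unfolding ic a_def b_def d_def .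
  qed
  finally have E2: "(\<integral>\<^sup>+l. ?p l * emeasure M {x \<in> space M. ennreal (3 * l) < G x} \<partial>lborel) \<le> ennreal (integral_const m K p / 3 powr p) * (?gs + ?js)" .
  have "(\<integral>\<^sup>+x. ennpowr (G x) p \<partial>M) \<le> ennreal (3 powr p) * (ennreal (integral_const m K p / 3 powr p) * (?gs + ?js))"
    using E1 mult_left_mono[OF E2, of "ennreal (3 powr p)"] by (rule order_trans) simp
  also have "\<dots> = ennreal (3 powr p * (integral_const m K p / 3 powr p)) * (?gs + ?js)"
    by (simp add: ennreal_mult' mult.assoc del: times_divide_eq_right)
  finally show ?thesis by (simp add: G_def)
qed

end

section \<open>Dependency coefficients of the stationary sequence\<close>

lemma bmeas_prod:
  assumes "\<And>j. j \<in> J \<Longrightarrow> f j \<in> borel_measurable F" "\<And>j x. \<bar>f j x\<bar> \<le> (1::real)"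
  shows "bmeas F (\<lambda>x. \<Prod>j\<in>J. f j x)" and "\<bar>\<Prod>j\<in>J. f j x\<bar> \<le> 1"
proof -
  have le: "\<bar>\<Prod>j\<in>J. f j x\<bar> \<le> 1" for x
    unfolding abs_prod by (intro prod_le_1) (use assms in auto)
  then show "\<bar>\<Prod>j\<in>J. f j x\<bar> \<le> 1" .
  show "bmeas F (\<lambda>x. \<Prod>j\<in>J. f j x)"
    by (rule bmeasI[OF _ le]) (use assms in measurable)
qed

lemma (in prob_space) abs_expectation_le:
  assumes "bmeas M f" "\<And>x. \<bar>f x\<bar> \<le> c" shows "\<bar>expectation f\<bar> \<le> c"
proof -
  have "\<bar>expectation f\<bar> \<le> expectation (\<lambda>x. \<bar>f x\<bar>)" by (rule integral_abs_bound)
  also have "\<dots> \<le> expectation (\<lambda>_. c)"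
    by (intro integral_mono bmeas_integrable bmeas_intros) (use assms in auto)
  finally show ?thesis by (simp add: prob_space)
qed

lemma (in prob_space) centered_indicator:
  fixes Y :: "'a \<Rightarrow> real"
  assumes [measurable]: "Y \<in> borel_measurable M"
  shows "centered M (\<lambda>\<omega>. indicator {..t} (Y \<omega>)) \<in> borel_measurable M"
    and "\<bar>centered M (\<lambda>\<omega>. indicator {..t} (Y \<omega>)) x\<bar> \<le> 1"
proof -
  let ?i = "\<lambda>\<omega>. indicator {..t} (Y \<omega>) :: real"
  have [measurable]: "?i \<in> borel_measurable M"
    by (rule measurable_compose[OF assms borel_measurable_indicator]) simp
  show "centered M ?i \<in> borel_measurable M"
    unfolding centered_def[abs_def] by (intro borel_measurable_diff borel_measurable_const) measurable
  have b: "bmeas M ?i" by (rule bmeasI[of _ _ 1]) (auto simp: indicator_def)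
  have "expectation ?i \<le> expectation (\<lambda>_. 1)"
    by (intro integral_mono bmeas_integrable bmeas_intros b) (auto simp: indicator_def)
  moreover have "0 \<le> expectation ?i" by (intro integral_nonneg_AE AE_I2) (simp add: indicator_def)
  ultimately show "\<bar>centered M ?i x\<bar> \<le> 1"
    by (auto simp: centered_def indicator_def prob_space)
qed

text \<open>Makes the real suprema in the coefficients meaningful: the conditional expectation and
  the mean of a product bounded by 1 differ by at most 2.\<close>

lemma (in prob_space) alpha_dep_term:
  assumes F: "subalgebra M F" and Y: "\<And>j. j \<in> {1..k} \<Longrightarrow> Y j \<in> borel_measurable M"
  shows "(\<integral>\<omega>. \<bar>real_cond_exp M F (centered_ind_prod M k Y x) \<omega>
           - (\<integral>\<omega>'. centered_ind_prod M k Y x \<omega>' \<partial>M)\<bar> \<partial>M) \<le> 2"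
proof -
  let ?P = "centered_ind_prod M k Y x"
  have P: "bmeas M ?P" "\<And>\<omega>. \<bar>?P \<omega>\<bar> \<le> 1"
  proof -
    \<comment> \<open>Factors outside \<open>{1..k}\<close> are set to zero, because
      \<open>Y j\<close> is known to be measurable only for \<open>j\<close> in that range while
      \<open>bmeas_prod\<close> asks for a bound at every index.\<close>
    define h where "h j = (if j \<in> {1..k} then centered M (\<lambda>\<omega>'. indicator {..x j} (Y j \<omega>')) else (\<lambda>_. 0))" for j
    have eq: "?P = (\<lambda>\<omega>. \<Prod>j\<in>{1..k}. h j \<omega>)"
      unfolding centered_ind_prod_def[abs_def] h_def by (intro ext prod.cong) auto
    have 1: "h j \<in> borel_measurable M" if "j \<in> {1..k}" for j
      using centered_indicator(1)[OF Y[OF that]] that by (simp add: h_def)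
    have 2: "\<bar>h j \<omega>\<bar> \<le> 1" for j \<omega>
      using centered_indicator(2)[OF Y] by (simp add: h_def)
    show "bmeas M ?P" unfolding eq by (rule bmeas_prod(1)[of _ h, OF 1 2])
    show "\<bar>?P \<omega>\<bar> \<le> 1" for \<omega> unfolding eq by (rule bmeas_prod(2)[of _ h, OF 1 2])
  qed
  obtain g where g: "bmeas F g" "\<And>x. \<bar>g x\<bar> \<le> 1"
      "\<And>Z. bmeas F Z \<Longrightarrow> expectation (\<lambda>x. Z x * g x) = expectation (\<lambda>x. Z x * ?P x)"
      "AE x in M. real_cond_exp M F ?P x = g x"
    using that by (rule bounded_cond_exp[OF F P])
  have gM: "bmeas M g" using g(1) F bmeas_subalgebra by blast
  have [measurable]: "real_cond_exp M F ?P \<in> borel_measurable M" "g \<in> borel_measurable M"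
    using gM by (auto intro: bmeas_measurable)
  have "(\<integral>\<omega>. \<bar>real_cond_exp M F ?P \<omega> - (\<integral>\<omega>'. ?P \<omega>' \<partial>M)\<bar> \<partial>M) = (\<integral>\<omega>. \<bar>g \<omega> - (\<integral>\<omega>'. ?P \<omega>' \<partial>M)\<bar> \<partial>M)"
    by (intro integral_cong_AE) (use g(4) in auto)
  also have "\<dots> \<le> (\<integral>\<omega>. 2 \<partial>M)"
  proof (intro integral_mono bmeas_integrable bmeas_intros gM)
    fix \<omega>
    show "\<bar>g \<omega> - (\<integral>\<omega>'. ?P \<omega>' \<partial>M)\<bar> \<le> 2"
      using g(2)[of \<omega>] abs_expectation_le[OF P] by linarith
  qed
  finally show ?thesis by (simp add: prob_space)
qed

lemma (in prob_space) alpha_dep_bounds: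
  assumes F: "subalgebra M F" and Y: "\<And>j. j \<in> {1..k} \<Longrightarrow> Y j \<in> borel_measurable M"
  shows "alpha_dep M F k Y \<le> 2"
    and "(\<integral>\<omega>. \<bar>real_cond_exp M F (centered_ind_prod M k Y x) \<omega>
           - (\<integral>\<omega>'. centered_ind_prod M k Y x \<omega>' \<partial>M)\<bar> \<partial>M) \<le> alpha_dep M F k Y"
proof -
  let ?f = "\<lambda>x. \<integral>\<omega>. \<bar>real_cond_exp M F (centered_ind_prod M k Y x) \<omega>
           - (\<integral>\<omega>'. centered_ind_prod M k Y x \<omega>' \<partial>M)\<bar> \<partial>M"
  have b: "?f x \<le> 2" for x by (rule alpha_dep_term[OF F Y])
  show "alpha_dep M F k Y \<le> 2" unfolding alpha_dep_def by (intro cSUP_least b) auto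
  show "?f x \<le> alpha_dep M F k Y"
    unfolding alpha_dep_def by (rule cSUP_upper) (auto intro!: bdd_aboveI[of _ 2] b)
qed

section \<open>The shifted filtration and the coefficients\<close>

context stationary_setting
begin

text \<open>The inverse image of \<open>F0\<close> under \<open>T ^^ k\<close>, that is, the history
  up to time \<open>k\<close>. By \<open>F0_incr\<close> it grows with \<open>k\<close>.\<close>

definition past :: "nat \<Rightarrow> 'a measure" where
  "past k = vimage_algebra (space M) (T ^^ k) F0"

definition xs :: "nat \<Rightarrow> 'a \<Rightarrow> real" where "xs k \<omega> = X0 ((T ^^ k) \<omega>)"

lemma stat_seq_eq: "stat_seq M T X0 (int k) = xs k"
  by (simp add: stat_seq_def iter_int_def xs_def fun_eq_iff)

lemma T_pow_measurable [measurable]: "T ^^ k \<in> measurable M M"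
proof (induction k)
  case 0 then show ?case by (simp add: id_def)
next
  case (Suc k) then show ?case using T_measurable by (simp add: measurable_comp)
qed

lemma T_pow_space: "\<omega> \<in> space M \<Longrightarrow> (T ^^ k) \<omega> \<in> space M"
  using measurable_space[OF T_pow_measurable] by blast

lemma T_pow_distr: "distr M M (T ^^ k) = M"
proof (induction k)
  case 0
  then show ?case by (simp add: id_def distr_id2)
next
  case (Suc k)
  have "distr M M (T ^^ Suc k) = distr (distr M M (T ^^ k)) M T"
    by (subst distr_distr) (auto simp: T_measurable)
  then show ?case by (simp only: Suc T_preserves)
qed

lemma space_F0: "space F0 = space M" using F0_subalgebra by (simp add: subalgebra_def)

lemma T_pow_maps: "T ^^ k \<in> space M \<rightarrow> space F0"
  using T_pow_space by (auto simp: space_F0)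

lemma sets_past: "sets (past k) = {(T ^^ k) -` A \<inter> space M | A. A \<in> sets F0}"
  unfolding past_def by (rule sets_vimage_algebra2[OF T_pow_maps])

lemma past_subalgebra: "subalgebra M (past k)"
proof -
  have "sets F0 \<subseteq> sets M" using F0_subalgebra by (simp add: subalgebra_def)
  then have "sets (past k) \<subseteq> sets M"
    unfolding sets_past using measurable_sets[OF T_pow_measurable] by auto
  then show ?thesis by (simp add: subalgebra_def past_def)
qed

lemma past_Suc: "sets (past k) \<subseteq> sets (past (Suc k))"
proof
  fix B assume "B \<in> sets (past k)"
  then obtain A where A: "A \<in> sets F0" "B = (T ^^ k) -` A \<inter> space M" by (auto simp: sets_past)
  obtain A' where A': "A' \<in> sets F0" "A = T -` A' \<inter> space M" using F0_incr A(1) by blast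
  have "B = (T ^^ Suc k) -` A' \<inter> space M"
    unfolding A(2) A'(2) using T_pow_space[of _ k] by auto
  then show "B \<in> sets (past (Suc k))" unfolding sets_past using A'(1) by blast
qed

lemma past_mono: "i \<le> j \<Longrightarrow> subalgebra (past j) (past i)"
proof -
  assume "i \<le> j"
  then have "sets (past i) \<subseteq> sets (past j)"
    by (induction j rule: dec_induct) (use past_Suc in blast)+
  then show ?thesis by (simp add: subalgebra_def past_def)
qed

lemma measurable_past: "f \<in> borel_measurable F0 \<Longrightarrow> (\<lambda>\<omega>. f ((T ^^ k) \<omega>)) \<in> borel_measurable (past k)"
  unfolding past_def by (rule measurable_compose[OF measurable_vimage_algebra1[OF T_pow_maps]])

lemma xs_measurable_past: "xs k \<in> borel_measurable (past k)"
  unfolding xs_def[abs_def] by (rule measurable_past[OF X0_measurable])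

lemma xs_measurable [measurable]: "xs k \<in> borel_measurable M"
  using xs_measurable_past past_subalgebra measurable_from_subalg by blast

lemma X0_measurable_M [measurable]: "X0 \<in> borel_measurable M"
  using X0_measurable F0_subalgebra measurable_from_subalg by blast

lemma expectation_shift:
  fixes f :: "'a \<Rightarrow> real"
  assumes [measurable]: "f \<in> borel_measurable M"
  shows "expectation (\<lambda>\<omega>. f ((T ^^ k) \<omega>)) = expectation f"
proof -
  have "expectation f = integral\<^sup>L (distr M M (T ^^ k)) f" by (simp add: T_pow_distr)
  also have "\<dots> = expectation (\<lambda>\<omega>. f ((T ^^ k) \<omega>))" by (simp add: integral_distr)
  finally show ?thesis by simp
qed

lemma bmeas_shift: "bmeas M f \<Longrightarrow> bmeas M (\<lambda>\<omega>. f ((T ^^ k) \<omega>))"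
  unfolding bmeas_def using measurable_compose[OF T_pow_measurable] by blast

text \<open>Conditioning commutes with the shift. A set of \<open>past k\<close> is the inverse
  image of some \<open>A\<close> in \<open>F0\<close>, so both sides of the defining identity are
  integrals of functions of \<open>(T ^^ k) \<omega>\<close>, from which invariance removes the
  shift.\<close>

lemma cond_exp_shift:
  assumes f: "bmeas M f"
  shows "AE \<omega> in M. real_cond_exp M (past k) (\<lambda>\<omega>. f ((T ^^ k) \<omega>)) \<omega> = real_cond_exp M F0 f ((T ^^ k) \<omega>)"
proof -
  interpret P: finite_measure_subalgebra M "past k"
    by (simp add: past_subalgebra finite_measure_axioms finite_measure_subalgebra_axioms_def finite_measure_subalgebra_def)
  interpret F: finite_measure_subalgebra M F0
    by (simp add: F0_subalgebra finite_measure_axioms finite_measure_subalgebra_axioms_def finite_measure_subalgebra_def)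
  have int: "integrable M f" using f by (rule bmeas_integrable)
  have [measurable]: "real_cond_exp M F0 f \<in> borel_measurable M" "f \<in> borel_measurable M"
    using f by (auto intro: bmeas_measurable)
  have "integrable M (real_cond_exp M F0 f)" by (rule F.real_cond_exp_int(1)[OF int])
  then have "integrable (distr M M (T ^^ k)) (real_cond_exp M F0 f)" by (simp add: T_pow_distr)
  then have int2: "integrable M (\<lambda>\<omega>. real_cond_exp M F0 f ((T ^^ k) \<omega>))"
    by (subst (asm) integrable_distr_eq) auto
  show ?thesis
  proof (rule P.real_cond_exp_charact)
    fix B assume "B \<in> sets (past k)"
    then obtain A where A: "A \<in> sets F0" "B = (T ^^ k) -` A \<inter> space M" by (auto simp: sets_past)
    have [measurable]: "A \<in> sets M" using A(1) F0_subalgebra by (auto simp: subalgebra_def)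
    have ind: "indicator B \<omega> = (indicator A ((T ^^ k) \<omega>) :: real)" if "\<omega> \<in> space M" for \<omega>
      using that by (simp add: A(2) indicator_def)
    have "(\<integral>\<omega>\<in>B. f ((T ^^ k) \<omega>) \<partial>M) = expectation (\<lambda>\<omega>. indicator A ((T ^^ k) \<omega>) * f ((T ^^ k) \<omega>))"
      unfolding set_lebesgue_integral_def by (intro Bochner_Integration.integral_cong) (auto simp: ind)
    also have "\<dots> = expectation (\<lambda>\<omega>. indicator A \<omega> * f \<omega>)"
      by (rule expectation_shift) measurable
    also have "\<dots> = expectation (\<lambda>\<omega>. indicator A \<omega> * real_cond_exp M F0 f \<omega>)"
      using F.real_cond_exp_intA[OF int A(1)] by (simp add: set_lebesgue_integral_def)
    also have "\<dots> = expectation (\<lambda>\<omega>. indicator A ((T ^^ k) \<omega>) * real_cond_exp M F0 f ((T ^^ k) \<omega>))"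
      by (rule expectation_shift[symmetric]) measurable
    also have "\<dots> = (\<integral>\<omega>\<in>B. real_cond_exp M F0 f ((T ^^ k) \<omega>) \<partial>M)"
      unfolding set_lebesgue_integral_def by (intro Bochner_Integration.integral_cong) (auto simp: ind)
    finally show "(\<integral>\<omega>\<in>B. f ((T ^^ k) \<omega>) \<partial>M) = (\<integral>\<omega>\<in>B. real_cond_exp M F0 f ((T ^^ k) \<omega>) \<partial>M)" .
  next
    show "integrable M (\<lambda>\<omega>. f ((T ^^ k) \<omega>))" by (intro bmeas_integrable bmeas_shift f)
    show "(\<lambda>\<omega>. real_cond_exp M F0 f ((T ^^ k) \<omega>)) \<in> borel_measurable (past k)"
      by (rule measurable_past) simp
  qed (rule int2)
qed

text \<open>Duality between L1 and bounded test functions: the pairing is at most the L1 norm of the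
  conditional expectation given \<open>past k\<close>, and the shift carries this norm back to
  \<open>F0\<close>, where the coefficients are defined.\<close>

lemma expectation_past_le:
  assumes f: "bmeas M f" and Z: "bmeas (past k) Z" "\<And>\<omega>. \<bar>Z \<omega>\<bar> \<le> 1"
  shows "expectation (\<lambda>\<omega>. Z \<omega> * f ((T ^^ k) \<omega>)) \<le> expectation (\<lambda>\<omega>. \<bar>real_cond_exp M F0 f \<omega>\<bar>)"
proof -
  interpret P: finite_measure_subalgebra M "past k"
    by (simp add: past_subalgebra finite_measure_axioms finite_measure_subalgebra_axioms_def finite_measure_subalgebra_def)
  interpret F: finite_measure_subalgebra M F0
    by (simp add: F0_subalgebra finite_measure_axioms finite_measure_subalgebra_axioms_def finite_measure_subalgebra_def)
  let ?e = "real_cond_exp M (past k) (\<lambda>\<omega>. f ((T ^^ k) \<omega>))"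
  have ZM: "bmeas M Z" using Z(1) past_subalgebra bmeas_subalgebra by blast
  have [measurable]: "real_cond_exp M F0 f \<in> borel_measurable M" "?e \<in> borel_measurable M" "f \<in> borel_measurable M"
    "Z \<in> borel_measurable M" "Z \<in> borel_measurable (past k)"
    using f Z ZM by (auto intro: bmeas_measurable)
  have i: "integrable M (\<lambda>\<omega>. Z \<omega> * f ((T ^^ k) \<omega>))" by (intro bmeas_integrable bmeas_intros ZM bmeas_shift f)
  have "expectation (\<lambda>\<omega>. Z \<omega> * f ((T ^^ k) \<omega>)) = expectation (\<lambda>\<omega>. Z \<omega> * ?e \<omega>)"
    by (rule P.real_cond_exp_intg(2)[symmetric]) (use i in auto)
  also have "\<dots> \<le> expectation (\<lambda>\<omega>. \<bar>?e \<omega>\<bar>)"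
  proof (rule integral_mono)
    show "integrable M (\<lambda>\<omega>. Z \<omega> * ?e \<omega>)" by (rule P.real_cond_exp_intg(1)) (use i in auto)
    show "integrable M (\<lambda>\<omega>. \<bar>?e \<omega>\<bar>)"
      by (intro integrable_abs P.real_cond_exp_int(1) bmeas_integrable bmeas_shift f)
    fix \<omega>
    have "Z \<omega> * ?e \<omega> \<le> \<bar>Z \<omega>\<bar> * \<bar>?e \<omega>\<bar>" by (metis abs_ge_self abs_mult)
    also have "\<dots> \<le> 1 * \<bar>?e \<omega>\<bar>" by (intro mult_right_mono Z) simp
    finally show "Z \<omega> * ?e \<omega> \<le> \<bar>?e \<omega>\<bar>" by simp
  qed
  also have "\<dots> = expectation (\<lambda>\<omega>. \<bar>real_cond_exp M F0 f ((T ^^ k) \<omega>)\<bar>)"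
    by (rule integral_cong_AE) (use cond_exp_shift[OF f, of k] in auto)
  also have "\<dots> = expectation (\<lambda>\<omega>. \<bar>real_cond_exp M F0 f \<omega>\<bar>)"
    by (rule expectation_shift) measurable
  finally show ?thesis .
qed

abbreviation "\<alpha> \<equiv> alpha_coef M F0 (stat_seq M T X0)"

lemma stat_seq_measurable: "0 \<le> i \<Longrightarrow> stat_seq M T X0 i \<in> borel_measurable M"
  using stat_seq_eq[of "nat i"] xs_measurable[of "nat i"] by simp

lemma alpha_dep_seq_le:
  assumes "int n \<le> i 1" "mono_on {1..l} (i :: nat \<Rightarrow> int)" "l \<ge> 1"
  shows "j \<in> {1..l} \<Longrightarrow> stat_seq M T X0 (i j) \<in> borel_measurable M"
    and "alpha_dep M F0 l (\<lambda>j. stat_seq M T X0 (i j)) \<le> 2"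
proof -
  show m: "stat_seq M T X0 (i j) \<in> borel_measurable M" if "j \<in> {1..l}" for j
  proof -
    have "i 1 \<le> i j" using assms that by (intro mono_onD[OF assms(2)]) auto
    then show ?thesis using assms(1) by (intro stat_seq_measurable) simp
  qed
  show "alpha_dep M F0 l (\<lambda>j. stat_seq M T X0 (i j)) \<le> 2"
    by (rule alpha_dep_bounds(1)[OF F0_subalgebra m])
qed

lemma alpha_dep_le_coef:
  assumes "int n \<le> i 1" "mono_on {1..l} (i :: nat \<Rightarrow> int)" "l \<in> {1..k}"
  shows "alpha_dep M F0 l (\<lambda>j. stat_seq M T X0 (i j)) \<le> \<alpha> k n"
proof -
  let ?I = "\<lambda>l. {i :: nat \<Rightarrow> int. int n \<le> i 1 \<and> mono_on {1..l} i}"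
  let ?S = "\<lambda>l. SUP i\<in>?I l. alpha_dep M F0 l (\<lambda>j. stat_seq M T X0 (i j))"
  have "alpha_dep M F0 l (\<lambda>j. stat_seq M T X0 (i j)) \<le> ?S l"
    by (rule cSUP_upper) (use assms in \<open>auto intro!: bdd_aboveI[of _ 2] alpha_dep_seq_le(2)\<close>)
  also have "\<dots> \<le> \<alpha> k n" unfolding alpha_coef_def using assms(3) by (intro Max_ge) auto
  finally show ?thesis .
qed

lemma alpha_coef_le:
  assumes "k \<ge> 1" "\<And>l i. l \<in> {1..k} \<Longrightarrow> int n \<le> i 1 \<Longrightarrow> mono_on {1..l} (i :: nat \<Rightarrow> int) \<Longrightarrow>
      alpha_dep M F0 l (\<lambda>j. stat_seq M T X0 (i j)) \<le> c"
  shows "\<alpha> k n \<le> c"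
  unfolding alpha_coef_def
proof (rule Max.boundedI)
  fix s assume "s \<in> (\<lambda>l. SUP i\<in>{i :: nat \<Rightarrow> int. int n \<le> i 1 \<and> mono_on {1..l} i}. alpha_dep M F0 l (\<lambda>j. stat_seq M T X0 (i j))) ` {1..k}"
  then obtain l where l: "l \<in> {1..k}" "s = (SUP i\<in>{i :: nat \<Rightarrow> int. int n \<le> i 1 \<and> mono_on {1..l} i}. alpha_dep M F0 l (\<lambda>j. stat_seq M T X0 (i j)))"
    by auto
  show "s \<le> c" unfolding l(2)
  proof (rule cSUP_least)
    show "{i :: nat \<Rightarrow> int. int n \<le> i 1 \<and> mono_on {1..l} i} \<noteq> {}"
      using monotone_on_def by (auto intro!: exI[of _ "\<lambda>_. int n"] simp: mono_on_def)
  qed (use assms(2) l in auto)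
qed (use assms(1) in auto)

text \<open>A later starting time admits fewer index vectors.\<close>

lemma alpha_coef_antimono: "k \<ge> 1 \<Longrightarrow> n \<le> n' \<Longrightarrow> \<alpha> k n' \<le> \<alpha> k n"
  by (intro alpha_coef_le alpha_dep_le_coef) auto

end

lemma mult_le_abs: "\<bar>z\<bar> \<le> 1 \<Longrightarrow> z * y \<le> \<bar>y :: real\<bar>"
  using mult_right_mono[of "\<bar>z\<bar>" 1 "\<bar>y\<bar>"] abs_ge_self[of "z * y"] by (simp add: abs_mult)

section \<open>The centred indicators as a dependent sequence\<close>

context stationary_setting
begin

abbreviation (input) "F \<equiv> cdf (distr M borel X0)"

definition Yt :: "real \<Rightarrow> nat \<Rightarrow> 'a \<Rightarrow> real" where
  "Yt t k \<omega> = indicator {..t} (xs k \<omega>) - F t"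

lemma real_distribution_X0: "real_distribution (distr M borel X0)"
  by (rule real_distribution_distr) measurable

lemma F_bounds: "0 \<le> F t" "F t \<le> 1"
proof -
  interpret D: real_distribution "distr M borel X0" by (rule real_distribution_X0)
  show "0 \<le> F t" "F t \<le> 1" by (auto simp: D.cdf_nonneg D.cdf_bounded_prob)
qed

lemma F_meas [measurable]: "F \<in> borel_measurable borel"
proof -
  interpret D: cdf_distribution "distr M borel X0"
    unfolding cdf_distribution_def by (rule real_distribution_X0)
  show ?thesis by (rule D.measurable_C)
qed

lemma xs_shift: "xs (k + a) \<omega> = xs a ((T ^^ k) \<omega>)"
proof -
  have "(T ^^ (a + k)) \<omega> = (T ^^ a) ((T ^^ k) \<omega>)" by (simp add: funpow_add)
  then show ?thesis by (simp add: xs_def add.commute)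
qed

lemma F_eq: "F t = prob {\<omega> \<in> space M. X0 \<omega> \<le> t}"
  by (simp add: cdf_def measure_distr vimage_def Int_def conj_commute)

lemma indicator_xs_bmeas: "bmeas M (\<lambda>\<omega>. indicator {..t} (xs k \<omega>))"
proof (rule bmeasI[of _ _ 1])
  show "(\<lambda>\<omega>. indicator {..t} (xs k \<omega>) :: real) \<in> borel_measurable M"
    by (rule measurable_compose[OF xs_measurable borel_measurable_indicator]) simp
qed (simp add: indicator_def)

lemma expectation_indicator_xs: "expectation (\<lambda>\<omega>. indicator {..t} (xs k \<omega>)) = F t"
proof -
  have X0i: "(\<lambda>\<omega>. indicator {..t} (X0 \<omega>) :: real) \<in> borel_measurable M"
    by (rule measurable_compose[OF X0_measurable_M borel_measurable_indicator]) simp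
  have "expectation (\<lambda>\<omega>. indicat_real {..t} (xs k \<omega>)) = expectation (\<lambda>\<omega>. indicat_real {..t} (X0 \<omega>))"
    using expectation_shift[OF X0i, of k] by (simp add: xs_def)
  also have "\<dots> = expectation (indicator {\<omega> \<in> space M. X0 \<omega> \<le> t})"
    by (intro Bochner_Integration.integral_cong) (auto simp: indicator_def)
  also have "\<dots> = F t" unfolding F_eq by (subst Bochner_Integration.integral_indicator, rule arg_cong[where f = prob]) auto
  finally show ?thesis .
qed

lemma centered_eq: "centered M (\<lambda>\<omega>'. indicator {..t} (xs k \<omega>')) = Yt t k"
  by (simp add: fun_eq_iff centered_def Yt_def expectation_indicator_xs)

lemma Yt_bmeas_past: "bmeas (past k) (Yt t k)"
proof -
  have "bmeas (past k) (\<lambda>\<omega>. indicator {..t} (xs k \<omega>) :: real)"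
  proof (rule bmeasI[of _ _ 1])
    show "(\<lambda>\<omega>. indicator {..t} (xs k \<omega>) :: real) \<in> borel_measurable (past k)"
      by (rule measurable_compose[OF xs_measurable_past borel_measurable_indicator]) simp
  qed (simp add: indicator_def)
  then show ?thesis unfolding Yt_def[abs_def] by (intro bmeas_intros)
qed

lemma Yt_bmeas: "bmeas M (Yt t k)"
  using Yt_bmeas_past past_subalgebra bmeas_subalgebra by blast

lemma Yt_le: "\<bar>Yt t k \<omega>\<bar> \<le> 1"
  using F_bounds[of t] by (auto simp: Yt_def indicator_def)

lemma Yt_shift: "Yt t (k + a) \<omega> = Yt t a ((T ^^ k) \<omega>)"
  by (simp add: Yt_def xs_shift)

lemma expectation_Yt: "expectation (Yt t k) = 0"
proof -
  have "expectation (\<lambda>\<omega>. indicator {..t} (xs k \<omega>) - F t) = expectation (\<lambda>\<omega>. indicator {..t} (xs k \<omega>)) - F t"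
    by (subst Bochner_Integration.integral_diff) (auto intro: bmeas_integrable indicator_xs_bmeas simp: prob_space)
  then show ?thesis by (simp add: Yt_def[abs_def] expectation_indicator_xs)
qed

text \<open>The mean is exactly \<open>2 * F t * (1 - F t)\<close>, and each factor lies between 0
  and 1.\<close>

lemma expectation_abs_Yt: "expectation (\<lambda>\<omega>. \<bar>Yt t k \<omega>\<bar>) \<le> 2 * min (F t) (1 - F t)"
proof -
  have "expectation (\<lambda>\<omega>. \<bar>Yt t k \<omega>\<bar>) = expectation (\<lambda>\<omega>. (1 - 2 * F t) * indicator {..t} (xs k \<omega>) + F t)"
    by (intro Bochner_Integration.integral_cong) (use F_bounds[of t] in \<open>auto simp: Yt_def indicator_def\<close>)
  also have "\<dots> = (1 - 2 * F t) * F t + F t"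
    by (subst Bochner_Integration.integral_add)
       (auto intro!: bmeas_integrable bmeas_intros indicator_xs_bmeas simp: prob_space expectation_indicator_xs)
  also have "\<dots> = 2 * (F t * (1 - F t))" by (simp add: algebra_simps)
  also have "F t * (1 - F t) \<le> min (F t) (1 - F t)"
    using F_bounds[of t] by (auto intro: mult_left_le mult_left_le_one_le)
  finally show ?thesis by simp
qed

lemma expectation_abs_Yt_le:
  assumes "min (F t) (1 - F t) \<le> h" shows "expectation (\<lambda>\<omega>. \<bar>Yt t k \<omega>\<bar>) \<le> 2 * h"
  using expectation_abs_Yt by (rule order_trans) (use assms in simp)

text \<open>Vectors of length 1 are among those of length at most \<open>k\<close>, so one estimate
  serves both \<open>\<alpha> 1\<close> and \<open>\<alpha> 2\<close>.\<close>

lemma alpha1_le: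
  assumes "k \<ge> 1"
  shows "expectation (\<lambda>\<omega>. \<bar>real_cond_exp M F0 (Yt t a) \<omega>\<bar>) \<le> \<alpha> k a"
proof -
  let ?X = "\<lambda>j::nat. stat_seq M T X0 (int a)"
  have m: "?X j \<in> borel_measurable M" for j by (simp add: stat_seq_eq)
  have eq: "centered_ind_prod M 1 ?X (\<lambda>_. t) = Yt t a"
    by (simp add: centered_ind_prod_def fun_eq_iff stat_seq_eq centered_eq)
  have "expectation (\<lambda>\<omega>. \<bar>real_cond_exp M F0 (Yt t a) \<omega>\<bar>) \<le> alpha_dep M F0 1 ?X"
    using alpha_dep_bounds(2)[where k = 1 and x = "\<lambda>_. t" and Y = ?X, OF F0_subalgebra m] by (simp add: eq expectation_Yt del: One_nat_def)
  also have "\<dots> \<le> \<alpha> k a"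
    using assms by (intro alpha_dep_le_coef[where i = "\<lambda>_. int a"]) (auto simp: monotone_on_def)
  finally show ?thesis .
qed

text \<open>A vector of length 2 with the same threshold \<open>t\<close> in both coordinates. Only
  the starting time \<open>q\<close> has to precede \<open>a\<close> and \<open>b\<close>.\<close>

lemma alpha2_le:
  assumes "q \<le> a" "a \<le> b"
  shows "expectation (\<lambda>\<omega>. \<bar>real_cond_exp M F0 (\<lambda>\<omega>. Yt t a \<omega> * Yt t b \<omega>) \<omega>
      - expectation (\<lambda>\<omega>. Yt t a \<omega> * Yt t b \<omega>)\<bar>) \<le> \<alpha> 2 q"
proof -
  let ?i = "\<lambda>j::nat. if j = 1 then int a else int b"
  let ?X = "\<lambda>j::nat. stat_seq M T X0 (?i j)"
  have m: "?X j \<in> borel_measurable M" for j by (simp add: stat_seq_eq)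
  have two: "{1..2::nat} = {1, 2}" by auto
  have eq: "centered_ind_prod M 2 ?X (\<lambda>_. t) = (\<lambda>\<omega>. Yt t a \<omega> * Yt t b \<omega>)"
    unfolding centered_ind_prod_def two by (simp add: fun_eq_iff stat_seq_eq centered_eq)
  have "expectation (\<lambda>\<omega>. \<bar>real_cond_exp M F0 (\<lambda>\<omega>. Yt t a \<omega> * Yt t b \<omega>) \<omega>
      - expectation (\<lambda>\<omega>. Yt t a \<omega> * Yt t b \<omega>)\<bar>) \<le> alpha_dep M F0 2 ?X"
    using alpha_dep_bounds(2)[where k = 2 and x = "\<lambda>_. t" and Y = ?X, OF F0_subalgebra m] by (simp only: eq)
  also have "\<dots> \<le> \<alpha> 2 q"
    using assms by (intro alpha_dep_le_coef[where i = ?i]) (auto simp: monotone_on_def)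
  finally show ?thesis .
qed

lemma alpha_nonneg: "k \<ge> 1 \<Longrightarrow> 0 \<le> \<alpha> k n"
  by (rule order_trans[OF _ alpha1_le[of k t n]]) (auto intro: integral_nonneg_AE)

lemma expectation_past_Yt_le:
  assumes Z: "bmeas (past k) Z" "\<And>\<omega>. \<bar>Z \<omega>\<bar> \<le> 1" and h: "min (F t) (1 - F t) \<le> h" and i: "i \<ge> 1"
  shows "expectation (\<lambda>\<omega>. Z \<omega> * Yt t (k + a) \<omega>) \<le> 2 * min (\<alpha> i a) h"
proof -
  have ZM: "bmeas M Z" using Z(1) past_subalgebra bmeas_subalgebra by blast
  have "expectation (\<lambda>\<omega>. Z \<omega> * Yt t (k + a) \<omega>) \<le> expectation (\<lambda>\<omega>. \<bar>real_cond_exp M F0 (Yt t a) \<omega>\<bar>)"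
    unfolding Yt_shift by (rule expectation_past_le[OF Yt_bmeas Z])
  also have "\<dots> \<le> \<alpha> i a" by (rule alpha1_le[OF i])
  finally have 1: "expectation (\<lambda>\<omega>. Z \<omega> * Yt t (k + a) \<omega>) \<le> 2 * \<alpha> i a" using alpha_nonneg[OF i, of a] by simp
  have "expectation (\<lambda>\<omega>. Z \<omega> * Yt t (k + a) \<omega>) \<le> expectation (\<lambda>\<omega>. \<bar>Yt t (k + a) \<omega>\<bar>)"
  proof (intro integral_mono bmeas_integrable bmeas_intros ZM Yt_bmeas)
    show "Z \<omega> * Yt t (k + a) \<omega> \<le> \<bar>Yt t (k + a) \<omega>\<bar>" for \<omega> by (rule mult_le_abs[OF Z(2)])
  qed
  then have 2: "expectation (\<lambda>\<omega>. Z \<omega> * Yt t (k + a) \<omega>) \<le> 2 * h" using expectation_abs_Yt_le[OF h, of "k + a"] by linarith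
  show ?thesis using 1 2 by (simp add: min_def)
qed

lemma expectation_Yt_Yt_shift:
  "expectation (\<lambda>\<omega>. Yt t (k + a) \<omega> * Yt t (k + b) \<omega>) = expectation (\<lambda>\<omega>. Yt t a \<omega> * Yt t b \<omega>)"
  unfolding Yt_shift
  by (rule expectation_shift) (intro bmeas_measurable bmeas_intros Yt_bmeas)

text \<open>Dependence gives \<open>\<alpha> 2 q\<close> through the conditional expectation. Size
  alone gives \<open>2 * h\<close> for the product and another \<open>2 * h\<close> for its mean,
  which accounts for the factor 4.\<close>

lemma expectation_past_Yt_Yt_le:
  assumes Z: "bmeas (past k) Z" "\<And>\<omega>. \<bar>Z \<omega>\<bar> \<le> 1" and h: "min (F t) (1 - F t) \<le> h" and ab: "q \<le> a" "a \<le> b"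
  shows "expectation (\<lambda>\<omega>. Z \<omega> * (Yt t (k + a) \<omega> * Yt t (k + b) \<omega> - expectation (\<lambda>\<omega>. Yt t (k + a) \<omega> * Yt t (k + b) \<omega>)))
    \<le> 4 * min (\<alpha> 2 q) h"
proof -
  interpret F: finite_measure_subalgebra M F0
    by (simp add: F0_subalgebra finite_measure_axioms finite_measure_subalgebra_axioms_def finite_measure_subalgebra_def)
  let ?y = "\<lambda>\<omega>. Yt t a \<omega> * Yt t b \<omega>"
  let ?c = "expectation ?y"
  have y: "bmeas M ?y" by (intro bmeas_intros Yt_bmeas)
  have yc: "bmeas M (\<lambda>\<omega>. ?y \<omega> - ?c)" by (intro bmeas_intros y)
  have ZM: "bmeas M Z" using Z(1) past_subalgebra bmeas_subalgebra by blast
  have "expectation (\<lambda>\<omega>. Z \<omega> * (Yt t (k + a) \<omega> * Yt t (k + b) \<omega> - ?c))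
     \<le> expectation (\<lambda>\<omega>. \<bar>real_cond_exp M F0 (\<lambda>\<omega>. ?y \<omega> - ?c) \<omega>\<bar>)"
    unfolding Yt_shift by (rule expectation_past_le[OF yc Z])
  also have "\<dots> = expectation (\<lambda>\<omega>. \<bar>real_cond_exp M F0 ?y \<omega> - ?c\<bar>)"
  proof (rule integral_cong_AE)
    have "AE \<omega> in M. real_cond_exp M F0 (\<lambda>\<omega>. ?y \<omega> - ?c) \<omega> = real_cond_exp M F0 ?y \<omega> - real_cond_exp M F0 (\<lambda>_. ?c) \<omega>"
      by (rule F.real_cond_exp_diff) (auto intro: bmeas_integrable[OF y])
    moreover have "AE \<omega> in M. real_cond_exp M F0 (\<lambda>_. ?c) \<omega> = ?c"
      by (rule F.real_cond_exp_F_meas) auto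
    ultimately show "AE \<omega> in M. \<bar>real_cond_exp M F0 (\<lambda>\<omega>. ?y \<omega> - ?c) \<omega>\<bar> = \<bar>real_cond_exp M F0 ?y \<omega> - ?c\<bar>"
      by eventually_elim simp
  qed auto
  also have "\<dots> \<le> \<alpha> 2 q" by (rule alpha2_le[OF ab])
  finally have 1: "expectation (\<lambda>\<omega>. Z \<omega> * (Yt t (k + a) \<omega> * Yt t (k + b) \<omega> - ?c)) \<le> 4 * \<alpha> 2 q"
    using alpha_nonneg[of 2 q] by simp
  have ey: "expectation (\<lambda>\<omega>. \<bar>Yt t i \<omega> * Yt t j \<omega>\<bar>) \<le> 2 * h" for i j
  proof -
    have "expectation (\<lambda>\<omega>. \<bar>Yt t i \<omega> * Yt t j \<omega>\<bar>) \<le> expectation (\<lambda>\<omega>. \<bar>Yt t i \<omega>\<bar>)"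
    proof (intro integral_mono bmeas_integrable bmeas_intros Yt_bmeas)
      fix \<omega> show "\<bar>Yt t i \<omega> * Yt t j \<omega>\<bar> \<le> \<bar>Yt t i \<omega>\<bar>"
        unfolding abs_mult using Yt_le by (intro mult_left_le) auto
    qed
    then show ?thesis using expectation_abs_Yt_le[OF h, of i] by linarith
  qed
  have c: "\<bar>?c\<bar> \<le> 2 * h"
    using integral_abs_bound[of M ?y] ey[of a b] by linarith
  have "expectation (\<lambda>\<omega>. Z \<omega> * (Yt t (k + a) \<omega> * Yt t (k + b) \<omega> - ?c))
     \<le> expectation (\<lambda>\<omega>. \<bar>Yt t (k + a) \<omega> * Yt t (k + b) \<omega>\<bar> + \<bar>?c\<bar>)"
  proof (intro integral_mono bmeas_integrable bmeas_intros ZM Yt_bmeas)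
    fix \<omega>
    let ?z = "Yt t (k + a) \<omega> * Yt t (k + b) \<omega>"
    have "Z \<omega> * (?z - ?c) \<le> \<bar>?z - ?c\<bar>" by (rule mult_le_abs[OF Z(2)])
    also have "\<dots> \<le> \<bar>?z\<bar> + \<bar>?c\<bar>" by (rule abs_triangle_ineq4)
    finally show "Z \<omega> * (?z - ?c) \<le> \<bar>?z\<bar> + \<bar>?c\<bar>" .
  qed
  also have "\<dots> = expectation (\<lambda>\<omega>. \<bar>Yt t (k + a) \<omega> * Yt t (k + b) \<omega>\<bar>) + \<bar>?c\<bar>"
    by (subst Bochner_Integration.integral_add, (intro bmeas_integrable bmeas_intros Yt_bmeas)+) (simp add: prob_space)
  finally have 2: "expectation (\<lambda>\<omega>. Z \<omega> * (Yt t (k + a) \<omega> * Yt t (k + b) \<omega> - ?c)) \<le> 4 * h"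
    using ey[of "k + a" "k + b"] c by linarith
  show ?thesis unfolding expectation_Yt_Yt_shift using 1 2 by (simp add: min_def)
qed

text \<open>\<open>h\<close> is kept as a parameter, because the comparison of
  \<open>min (F t) (1 - F t)\<close> with the tail of \<open>X0\<close> will be used only for almost
  every \<open>t\<close>.\<close>

lemma dependent_sequence_Yt:
  assumes h: "min (F t) (1 - F t) \<le> h"
  shows "dependent_sequence M past (Yt t) (\<lambda>d. min (\<alpha> 1 d) h) (\<lambda>q. min (\<alpha> 2 q) h)"
proof
  have h0: "0 \<le> h" using h F_bounds[of t] by (auto simp: min_def split: if_splits)
  show "subalgebra M (past k)" for k by (rule past_subalgebra)
  show "subalgebra (past j) (past i)" if "i \<le> j" for i j by (rule past_mono[OF that])
  show "bmeas (past k) (Yt t k)" for k by (rule Yt_bmeas_past)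
  show "\<bar>Yt t k x\<bar> \<le> 1" for k x by (rule Yt_le)
  show "0 \<le> min (\<alpha> 1 k) h" "0 \<le> min (\<alpha> 2 k) h" for k
    using h0 alpha_nonneg[of 1 k] alpha_nonneg[of 2 k] by auto
  show "min (\<alpha> 2 j) h \<le> min (\<alpha> 2 i) h" if "i \<le> j" for i j
    using alpha_coef_antimono[of 2 i j] that by auto
  show "\<bar>expectation (\<lambda>x. Yt t k x * Yt t (k + d) x)\<bar> \<le> 2 * min (\<alpha> 1 d) h" for k d
  proof -
    \<comment> \<open>The covariance is covered by the estimate for test functions:
      \<open>Yt t k\<close> and its negative are admissible ones.\<close>
    have "expectation (\<lambda>x. Yt t k x * Yt t (k + d) x) \<le> 2 * min (\<alpha> 1 d) h"
      by (rule expectation_past_Yt_le[OF Yt_bmeas_past Yt_le h]) simp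
    moreover have "expectation (\<lambda>x. (- Yt t k x) * Yt t (k + d) x) \<le> 2 * min (\<alpha> 1 d) h"
      by (rule expectation_past_Yt_le[OF bmeas_uminus[OF Yt_bmeas_past] _ h]) (use Yt_le in auto)
    ultimately show ?thesis by (simp add: abs_le_iff)
  qed
  show "expectation (\<lambda>x. Z x * Yt t (k + a) x) \<le> 2 * min (\<alpha> 2 a) h"
    if "bmeas (past k) Z" "\<And>x. \<bar>Z x\<bar> \<le> 1" for k a Z
    by (rule expectation_past_Yt_le[OF that h]) simp
  show "expectation (\<lambda>x. Z x * (Yt t (k + a) x * Yt t (k + b) x - expectation (\<lambda>x. Yt t (k + a) x * Yt t (k + b) x))) \<le> 4 * min (\<alpha> 2 q) h"
    if "bmeas (past k) Z" "\<And>x. \<bar>Z x\<bar> \<le> 1" "q \<le> a" "a \<le> b" for k q a b Z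
    by (rule expectation_past_Yt_Yt_le[OF that(1,2) h that(3,4)])
  show "expectation (\<lambda>x. (\<Sum>k<l. Yt t (s + k) x) ^ r) = expectation (\<lambda>x. (\<Sum>k<l. Yt t k x) ^ r)" for s l r
    unfolding Yt_shift
    by (rule expectation_shift) (intro bmeas_measurable bmeas_intros Yt_bmeas)
qed

end

section \<open>From tail functions to the quantile function\<close>

lemma sum_powr_le:
  assumes p: "p \<ge> 2" shows "(\<Sum>k<c. (real k + 1) powr (p - 2)) \<le> real c powr (p - 1)"
proof (cases "c = 0")
  case False
  have "(\<Sum>k<c. (real k + 1) powr (p - 2)) \<le> (\<Sum>k<c. real c powr (p - 2))"
    using p by (intro sum_mono powr_mono2) auto
  also have "\<dots> = real c powr 1 * real c powr (p - 2)" using False by simp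
  also have "\<dots> = real c powr (1 + (p - 2))" by (rule powr_add[symmetric])
  also have "1 + (p - 2) = p - 1" by simp
  finally show ?thesis .
qed simp

lemma ennpowr_mono: "x \<le> y \<Longrightarrow> p \<ge> 0 \<Longrightarrow> ennpowr x p \<le> ennpowr y p"
  unfolding ennpowr_def by (cases x; cases y) (auto intro!: ennreal_leI powr_mono2 simp: top_unique)

lemma ennpowr_ennreal: "x \<ge> 0 \<Longrightarrow> ennpowr (ennreal x) p = ennreal (x powr p)"
  by (simp add: ennpowr_def)

text \<open>Only the indices \<open>k\<close> with \<open>u < a k\<close> count; as \<open>a\<close> is decreasing they form an initial segment.\<close>

lemma sum_powr_le_alpha_inv:
  fixes a :: "nat \<Rightarrow> real"
  assumes a: "\<And>i j. i \<le> j \<Longrightarrow> a j \<le> a i" and p: "p > 2"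
  shows "(\<Sum>k<n. ennreal ((real k + 1) powr (p - 2)) * (if u < a k then 1 else 0)) \<le> ennpowr (min (alpha_inv a u) (of_nat n)) (p - 1)"
proof -
  define A where "A = {k. k < n \<and> u < a k}"
  define c where "c = card A"
  have fin: "finite A" by (simp add: A_def)
  have down: "j \<in> A" if "k \<in> A" "j \<le> k" for j k
    using that a[of j k] by (auto simp: A_def)
  have k: "k < c" if "k \<in> A" for k
  proof -
    have "{..k} \<subseteq> A" using down[OF that] by auto
    then have "card {..k} \<le> c" unfolding c_def using fin by (rule card_mono[rotated])
    then show ?thesis by simp
  qed
  have "c \<le> card {..<n}" unfolding c_def by (rule card_mono) (auto simp: A_def)
  then have cn: "c \<le> n" by simp
  have "(\<Sum>k<n. ennreal ((real k + 1) powr (p - 2)) * (if u < a k then 1 else 0)) = (\<Sum>k\<in>A. ennreal ((real k + 1) powr (p - 2)))"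
    by (rule sum.mono_neutral_cong_left[symmetric]) (auto simp: A_def)
  also have "\<dots> = ennreal (\<Sum>k\<in>A. (real k + 1) powr (p - 2))" by (rule sum_ennreal) simp
  also have "\<dots> \<le> ennreal (real c powr (p - 1))"
  proof (rule ennreal_leI)
    have "(\<Sum>k\<in>A. (real k + 1) powr (p - 2)) \<le> (\<Sum>k<c. (real k + 1) powr (p - 2))"
      using k by (intro sum_mono2) auto
    also have "\<dots> \<le> real c powr (p - 1)" using p by (intro sum_powr_le) simp
    finally show "(\<Sum>k\<in>A. (real k + 1) powr (p - 2)) \<le> real c powr (p - 1)" .
  qed
  also have "\<dots> = ennpowr (of_nat c) (p - 1)"
    by (simp add: ennpowr_ennreal ennreal_of_nat_eq_real_of_nat)
  also have "\<dots> \<le> ennpowr (min (alpha_inv a u) (of_nat n)) (p - 1)"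
  proof (intro ennpowr_mono min.boundedI)
    show "of_nat c \<le> (of_nat n :: ennreal)" using cn by simp
    have "(of_nat c :: ennreal) = (\<Sum>k\<in>A. 1)" by (simp add: c_def)
    also have "\<dots> = (\<Sum>k\<in>A. if u \<le> a k then 1 else 0)" by (intro sum.cong) (auto simp: A_def)
    also have "\<dots> \<le> alpha_inv a u" unfolding alpha_inv_def by (rule sum_le_suminf) (use fin in auto)
    finally show "of_nat c \<le> alpha_inv a u" .
  qed (use p in auto)
  finally show ?thesis .
qed

context prob_space
begin

lemma tail_fun_antimono:
  assumes [measurable]: "X \<in> borel_measurable M" and "s \<le> t"
  shows "tail_fun M X t \<le> tail_fun M X s"
  unfolding tail_fun_def by (rule finite_measure_mono) (use assms(2) in auto)

lemma tail_fun_measurable: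
  assumes "X \<in> borel_measurable M" shows "tail_fun M X \<in> borel_measurable borel"
proof -
  have "mono (\<lambda>t. - tail_fun M X t)" using tail_fun_antimono[OF assms] by (auto simp: mono_def)
  then have "(\<lambda>t. - (- tail_fun M X t)) \<in> borel_measurable borel"
    by (intro borel_measurable_uminus borel_measurable_mono)
  then show ?thesis by simp
qed

text \<open>\<open>u < tail_fun M X t\<close> forces \<open>t\<close> to be at most the quantile at
  \<open>u\<close>, and the integral of \<open>t powr (p - 1)\<close> up to that point is its
  \<open>p\<close>-th power divided by \<open>p\<close>.\<close>

lemma nn_integral_tail_le_quantile:
  assumes X: "X \<in> borel_measurable M" and p: "p > 1"
  shows "(\<integral>\<^sup>+t. ennreal (t powr (p - 1)) * (if 0 < t \<and> u < tail_fun M X t then 1 else 0) \<partial>lborel) \<le> ennpowr (quantile_fun M X u) p"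
proof (cases "quantile_fun M X u")
  case top
  then show ?thesis by (simp add: ennpowr_def)
next
  case (real r)
  have le: "t \<le> r" if t: "0 < t" "u < tail_fun M X t" for t
  proof -
    have "ennreal t \<le> quantile_fun M X u"
      unfolding quantile_fun_def
    proof (rule INF_greatest)
      fix s assume "s \<in> {t. 0 \<le> t \<and> tail_fun M X t \<le> u}"
      then have "tail_fun M X s \<le> u" by simp
      then have "t \<le> s" using tail_fun_antimono[OF X, of s t] t by (cases "s \<le> t") auto
      then show "ennreal t \<le> ennreal s" by (rule ennreal_leI)
    qed
    then show ?thesis using real t by simp
  qed
  have "(\<integral>\<^sup>+t. ennreal (t powr (p - 1)) * (if 0 < t \<and> u < tail_fun M X t then 1 else 0) \<partial>lborel)
      \<le> (\<integral>\<^sup>+t. ennreal (t powr (p - 1)) * indicator {0..r} t \<partial>lborel)"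
    by (intro nn_integral_mono) (auto simp: indicator_def dest: le)
  also have "\<dots> = ennreal (r powr (p - 1 + 1) / (p - 1 + 1))"
    using p real by (intro nn_integral_powr_from_0) auto
  also have "\<dots> \<le> ennreal (r powr p)"
  proof (rule ennreal_leI)
    have "r powr p / p \<le> r powr p / 1" using p by (intro divide_left_mono) auto
    then show "r powr (p - 1 + 1) / (p - 1 + 1) \<le> r powr p" by simp
  qed
  also have "\<dots> = ennpowr (quantile_fun M X u) p" using real by (simp add: ennpowr_def)
  finally show ?thesis .
qed

text \<open>\<open>min (a k) (tail_fun M X t)\<close> is the length of the set of \<open>u\<close>
  in \<open>(0, 1)\<close> that lie below both numbers. After Fubini's theorem the sum over
  \<open>k\<close> and the integral over \<open>t\<close> decouple for each fixed
  \<open>u\<close>.\<close>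

theorem tail_sum_le_quantile_integral:
  fixes a :: "nat \<Rightarrow> real"
  assumes X: "X \<in> borel_measurable M" and p: "p > 2"
    and a: "\<And>i j. i \<le> j \<Longrightarrow> a j \<le> a i" "\<And>i. 0 \<le> a i"
  shows "(\<Sum>k<n. ennreal ((real k + 1) powr (p - 2)) *
      (\<integral>\<^sup>+t. ennreal (t powr (p - 1) * min (a k) (tail_fun M X t)) * indicator {0<..} t \<partial>lborel))
    \<le> (\<integral>\<^sup>+u\<in>{0..1}. ennpowr (min (alpha_inv a u) (of_nat n)) (p - 1) * ennpowr (quantile_fun M X u) p \<partial>lborel)"
proof -
  let ?H = "tail_fun M X"
  have [measurable]: "?H \<in> borel_measurable borel" by (rule tail_fun_measurable[OF X])
  have H: "0 \<le> ?H t" "?H t \<le> 1" for t by (simp_all add: tail_fun_def)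
  let ?T = "\<lambda>u t. ennreal (t powr (p - 1)) * (if 0 < t \<and> u < ?H t then 1 else 0)"
  \<comment> \<open>Restricting \<open>u\<close> to \<open>(0, 1)\<close> costs nothing, because the
    tail is at most 1.\<close>
  let ?A = "\<lambda>k u. (if 0 < u \<and> u < 1 then 1 else 0) * (if u < a k then 1 else 0 :: ennreal)"
  have "(\<integral>\<^sup>+t. ennreal (t powr (p - 1) * min (a k) (?H t)) * indicator {0<..} t \<partial>lborel)
      = (\<integral>\<^sup>+u. ?A k u * (\<integral>\<^sup>+t. ?T u t \<partial>lborel) \<partial>lborel)" for k
  proof -
    have "(\<integral>\<^sup>+t. ennreal (t powr (p - 1) * min (a k) (?H t)) * indicator {0<..} t \<partial>lborel)
       = (\<integral>\<^sup>+t. (\<integral>\<^sup>+u. ?A k u * ?T u t \<partial>lborel) \<partial>lborel)"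
    proof (rule nn_integral_cong)
      fix t :: real
      have "(\<integral>\<^sup>+u. ?A k u * ?T u t \<partial>lborel)
          = (\<integral>\<^sup>+u. (ennreal (t powr (p - 1)) * indicator {0<..} t) * indicator {0<..<min (a k) (?H t)} u \<partial>lborel)"
        by (intro nn_integral_cong) (use H[of t] in \<open>auto simp: indicator_def\<close>)
      also have "\<dots> = (ennreal (t powr (p - 1)) * indicator {0<..} t) * ennreal (min (a k) (?H t))"
        using a(2)[of k] H[of t] by (subst nn_integral_cmult_indicator) auto
      also have "\<dots> = ennreal (t powr (p - 1) * min (a k) (?H t)) * indicator {0<..} t"
        using a(2)[of k] H[of t] by (simp add: ennreal_mult mult_ac)
      finally show "ennreal (t powr (p - 1) * min (a k) (?H t)) * indicator {0<..} t = (\<integral>\<^sup>+u. ?A k u * ?T u t \<partial>lborel)" ..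
    qed
    also have "\<dots> = (\<integral>\<^sup>+u. (\<integral>\<^sup>+t. ?A k u * ?T u t \<partial>lborel) \<partial>lborel)"
    proof -
      have "(\<lambda>(t, u). ?A k u * ?T u t) \<in> borel_measurable (lborel \<Otimes>\<^sub>M lborel)" by measurable
      from lborel_pair.Fubini[OF this] show ?thesis by simp
    qed
    also have "\<dots> = (\<integral>\<^sup>+u. ?A k u * (\<integral>\<^sup>+t. ?T u t \<partial>lborel) \<partial>lborel)"
      by (intro nn_integral_cong nn_integral_cmult) measurable
    finally show ?thesis .
  qed
  then have "(\<Sum>k<n. ennreal ((real k + 1) powr (p - 2)) *
      (\<integral>\<^sup>+t. ennreal (t powr (p - 1) * min (a k) (?H t)) * indicator {0<..} t \<partial>lborel))
    = (\<Sum>k<n. \<integral>\<^sup>+u. ennreal ((real k + 1) powr (p - 2)) * (?A k u * (\<integral>\<^sup>+t. ?T u t \<partial>lborel)) \<partial>lborel)"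
    by (simp only:) (rule sum.cong[OF refl], rule nn_integral_cmult[symmetric], measurable)
  also have "\<dots> = (\<integral>\<^sup>+u. (\<Sum>k<n. ennreal ((real k + 1) powr (p - 2)) * (?A k u * (\<integral>\<^sup>+t. ?T u t \<partial>lborel))) \<partial>lborel)"
    by (rule nn_integral_sum[symmetric]) measurable
  also have "\<dots> \<le> (\<integral>\<^sup>+u\<in>{0..1}. ennpowr (min (alpha_inv a u) (of_nat n)) (p - 1) * ennpowr (quantile_fun M X u) p \<partial>lborel)"
  proof (rule nn_integral_mono)
    fix u :: real
    let ?I = "\<integral>\<^sup>+t. ?T u t \<partial>lborel"
    show "(\<Sum>k<n. ennreal ((real k + 1) powr (p - 2)) * (?A k u * ?I))
       \<le> ennpowr (min (alpha_inv a u) (of_nat n)) (p - 1) * ennpowr (quantile_fun M X u) p * indicator {0..1} u"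
    proof (cases "0 < u \<and> u < 1")
      case True
      have "(\<Sum>k<n. ennreal ((real k + 1) powr (p - 2)) * (?A k u * ?I))
          = (\<Sum>k<n. ennreal ((real k + 1) powr (p - 2)) * (if u < a k then 1 else 0)) * ?I"
        unfolding sum_distrib_right using True by (intro sum.cong) auto
      also have "\<dots> \<le> ennpowr (min (alpha_inv a u) (of_nat n)) (p - 1) * ennpowr (quantile_fun M X u) p"
        using p by (intro mult_mono sum_powr_le_alpha_inv nn_integral_tail_le_quantile a X) auto
      finally show ?thesis using True by simp
    next
      case False
      then have "?A k u = 0" for k by auto
      then show ?thesis by (simp only: mult_zero_left mult_zero_right sum.neutral_const) simp
    qed
  qed
  finally show ?thesis .
qed

end

section \<open>The empirical process\<close>

lemma ennpowr_add_le:
  assumes "p \<ge> 0" shows "ennpowr (a + b) p \<le> ennreal (2 powr p) * (ennpowr a p + ennpowr b p)"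
proof (cases "a = top \<or> b = top")
  case True
  then show ?thesis by (auto simp: ennpowr_def ennreal_mult_top)
next
  case False
  then obtain x y where xy: "a = ennreal x" "x \<ge> 0" "b = ennreal y" "y \<ge> 0" by (cases a; cases b) auto
  have "(x + y) powr p \<le> (2 * max x y) powr p" using xy assms by (intro powr_mono2) auto
  also have "\<dots> = 2 powr p * max x y powr p" using xy by (intro powr_mult)
  also have "\<dots> \<le> 2 powr p * (x powr p + y powr p)"
    by (intro mult_left_mono) (auto simp: max_def)
  finally have "ennreal ((x + y) powr p) \<le> ennreal (2 powr p * (x powr p + y powr p))" by (rule ennreal_leI)
  then show ?thesis using xy by (simp add: ennpowr_ennreal ennreal_mult' flip: ennreal_plus)
qed

lemma ennpowr_mult:
  assumes "c > 0" shows "ennpowr (ennreal c * x) p = ennreal (c powr p) * ennpowr x p"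
proof (cases x)
  case (real r)
  then show ?thesis using assms by (simp add: ennpowr_ennreal powr_mult flip: ennreal_mult)
next
  case top
  then show ?thesis using assms by (simp add: ennpowr_def ennreal_mult_top)
qed

lemma ennpowr_inverse:
  assumes "p > 0" shows "ennpowr (ennpowr x (1 / p)) p = x"
  using assms by (cases x) (auto simp: ennpowr_def powr_powr)

lemma ennpowr_measurable [measurable]: "(\<lambda>x. ennpowr x p) \<in> borel_measurable borel"
  unfolding ennpowr_def by measurable

lemma nn_integral_two_sided:
  fixes f :: "real \<Rightarrow> ennreal"
  assumes [measurable]: "f \<in> borel_measurable borel"
  shows "(\<integral>\<^sup>+t. f t \<partial>lborel) = (\<integral>\<^sup>+t. f t * indicator {0<..} t \<partial>lborel) + (\<integral>\<^sup>+t. f (- t) * indicator {0<..} t \<partial>lborel)"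
proof -
  have "(\<integral>\<^sup>+t. f t \<partial>lborel) = (\<integral>\<^sup>+t. f t * indicator {0<..} t + f t * indicator {..<0::real} t \<partial>lborel)"
  proof (rule nn_integral_cong_AE)
    have "AE t in lborel. t \<noteq> (0::real)" by (rule AE_lborel_singleton)
    then show "AE t in lborel. f t = f t * indicator {0<..} t + f t * indicator {..<0::real} t"
      by eventually_elim (auto simp: indicator_def)
  qed
  also have "\<dots> = (\<integral>\<^sup>+t. f t * indicator {0<..} t \<partial>lborel) + (\<integral>\<^sup>+t. f t * indicator {..<0::real} t \<partial>lborel)"
    by (rule nn_integral_add) measurable
  also have "(\<integral>\<^sup>+t. f t * indicator {..<0::real} t \<partial>lborel) = (\<integral>\<^sup>+t. f (- t) * indicator {0<..} t \<partial>lborel)"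
    by (subst nn_integral_real_affine[where c = "-1" and t = 0]) (auto simp: indicator_def)
  finally show ?thesis .
qed

context stationary_setting
begin

abbreviation (input) "H \<equiv> tail_fun M X0"

lemma H_meas [measurable]: "H \<in> borel_measurable borel"
  by (rule tail_fun_measurable) measurable

text \<open>For negative \<open>t\<close> the event \<open>X0 \<le> t\<close> contains a possible
  atom at \<open>t\<close>, which the strict inequality in the tail does not count. The hypothesis
  rules this atom out.\<close>

lemma F_le_tail:
  assumes "prob {\<omega> \<in> space M. \<bar>X0 \<omega>\<bar> = \<bar>t\<bar>} = 0"
  shows "min (F t) (1 - F t) \<le> H \<bar>t\<bar>"
proof (cases "t \<ge> 0")
  case True
  have "1 - F t = prob {\<omega> \<in> space M. \<not> X0 \<omega> \<le> t}"
    unfolding F_eq by (rule prob_neg[symmetric]) measurable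
  also have "\<dots> \<le> H \<bar>t\<bar>"
    unfolding tail_fun_def using True by (intro finite_measure_mono) auto
  finally show ?thesis by simp
next
  case False
  have "F t \<le> prob ({\<omega> \<in> space M. \<bar>X0 \<omega>\<bar> > \<bar>t\<bar>} \<union> {\<omega> \<in> space M. \<bar>X0 \<omega>\<bar> = \<bar>t\<bar>})"
    unfolding F_eq using False by (intro finite_measure_mono) auto
  also have "\<dots> \<le> prob {\<omega> \<in> space M. \<bar>X0 \<omega>\<bar> > \<bar>t\<bar>} + prob {\<omega> \<in> space M. \<bar>X0 \<omega>\<bar> = \<bar>t\<bar>}"
    by (rule measure_Un_le) measurable
  also have "\<dots> = H \<bar>t\<bar>" using assms by (simp add: tail_fun_def)
  finally show ?thesis by simp
qed

text \<open>The distribution of \<open>\<bar>X0\<bar>\<close> has at most countably many atoms, and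
  these form a Lebesgue null set.\<close>

lemma AE_F_le_tail: "AE t in lborel. 0 < t \<longrightarrow> min (F t) (1 - F t) \<le> H t \<and> min (F (- t)) (1 - F (- t)) \<le> H t"
proof -
  interpret D: real_distribution "distr M borel (\<lambda>\<omega>. \<bar>X0 \<omega>\<bar>)"
    by (rule real_distribution_distr) measurable
  have eq: "measure (distr M borel (\<lambda>\<omega>. \<bar>X0 \<omega>\<bar>)) {t} = prob {\<omega> \<in> space M. \<bar>X0 \<omega>\<bar> = t}" for t
    by (subst measure_distr) (auto intro!: arg_cong[where f = prob])
  have "countable {t. measure (distr M borel (\<lambda>\<omega>. \<bar>X0 \<omega>\<bar>)) {t} \<noteq> 0}" by (rule D.countable_support)
  then have "{t. prob {\<omega> \<in> space M. \<bar>X0 \<omega>\<bar> = t} \<noteq> 0} \<in> null_sets lborel"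
    unfolding eq by (rule countable_imp_null_set_lborel)
  from AE_not_in[OF this] show ?thesis
  proof eventually_elim
    case (elim t)
    then show ?case using F_le_tail[of t] F_le_tail[of "- t"] by auto
  qed
qed

lemma H_lim: "e > 0 \<Longrightarrow> \<exists>t>0. H t < e"
proof -
  assume e: "e > 0"
  interpret D: real_distribution "distr M borel (\<lambda>\<omega>. \<bar>X0 \<omega>\<bar>)"
    by (rule real_distribution_distr) measurable
  let ?G = "cdf (distr M borel (\<lambda>\<omega>. \<bar>X0 \<omega>\<bar>))"
  have "(?G \<longlongrightarrow> 1) at_top" by (rule D.cdf_lim_at_top_prob)
  then have "eventually (\<lambda>t. 1 - e < ?G t) at_top" using e by (intro order_tendstoD) auto
  then have "eventually (\<lambda>t. 1 - e < ?G t \<and> 0 < t) at_top"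
    using eventually_gt_at_top[of 0] by (rule eventually_conj)
  then obtain t where t: "1 - e < ?G t" "0 < t" using eventually_happens'[OF trivial_limit_at_top_linorder] by blast
  have "?G t = prob {\<omega> \<in> space M. \<bar>X0 \<omega>\<bar> \<le> t}"
    by (simp add: cdf_def measure_distr vimage_def Int_def conj_commute)
  moreover have "H t = prob {\<omega> \<in> space M. \<not> \<bar>X0 \<omega>\<bar> \<le> t}"
    by (simp add: tail_fun_def not_le)
  moreover have "prob {\<omega> \<in> space M. \<not> \<bar>X0 \<omega>\<bar> \<le> t} = 1 - prob {\<omega> \<in> space M. \<bar>X0 \<omega>\<bar> \<le> t}"
    by (rule prob_neg) measurable
  ultimately show ?thesis using t by (intro exI[of _ t]) auto
qed

definition Zs :: "nat \<Rightarrow> real \<Rightarrow> 'a \<Rightarrow> real" where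
  "Zs n t \<omega> = (\<Sum>k<n. Yt t (n + k) \<omega>)"

lemma Yt_joint_measurable: "(\<lambda>(t, \<omega>). Yt t k \<omega>) \<in> borel_measurable (borel \<Otimes>\<^sub>M M)"
proof -
  have "(\<lambda>(t, \<omega>). (if xs k \<omega> \<le> t then 1 else 0) - F t) \<in> borel_measurable (borel \<Otimes>\<^sub>M M)"
    by measurable
  then show ?thesis by (simp add: Yt_def[abs_def] indicator_def of_bool_def)
qed

lemma Zs_joint_measurable [measurable]: "(\<lambda>(t, \<omega>). Zs n t \<omega>) \<in> borel_measurable (borel \<Otimes>\<^sub>M M)"
  unfolding Zs_def case_prod_beta' using Yt_joint_measurable[unfolded case_prod_beta'] by (intro borel_measurable_sum)

text \<open>The sign \<open>\<epsilon>\<close> selects the half-line of thresholds. Both choices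
  share the same coefficients and the same tail, so the resulting bounds coincide.\<close>

lemma truncated_family_Zs:
  assumes n: "n \<ge> 1" and m: "m \<ge> 2" and \<epsilon>: "\<epsilon> = 1 \<or> \<epsilon> = -1"
  shows "truncated_family M (\<lambda>t. Zs n (\<epsilon> * t)) (\<alpha> 2) H (\<lambda>t. \<Sum>d<n. min (\<alpha> 1 d) (H t)) n m (truncation_const m)"
proof
  have ae: "AE t in lborel. 0 < t \<longrightarrow> min (F (\<epsilon> * t)) (1 - F (\<epsilon> * t)) \<le> H t"
    using AE_F_le_tail by eventually_elim (use \<epsilon> in auto)
  have H0: "0 \<le> H t" for t by (simp add: tail_fun_def)
  show "n \<ge> 1" "m \<ge> 2" by (fact n, fact m)
  show "0 \<le> truncation_const m" by (rule less_imp_le[OF truncation_const_pos])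
  show "(\<lambda>(t, \<omega>). Zs n (\<epsilon> * t) \<omega>) \<in> borel_measurable (lborel \<Otimes>\<^sub>M M)"
    using measurable_compose[OF _ Zs_joint_measurable[of n], of "\<lambda>(t, \<omega>). (\<epsilon> * t, \<omega>)" "lborel \<Otimes>\<^sub>M M"]
    by (simp add: case_prod_beta')
  show "\<alpha> 2 j \<le> \<alpha> 2 i" if "i \<le> j" for i j using that by (intro alpha_coef_antimono) auto
  show "0 \<le> \<alpha> 2 i" for i by (rule alpha_nonneg) simp
  show "H t \<le> H s" if "s \<le> t" for s t by (rule tail_fun_antimono[OF X0_measurable_M that])
  show "0 \<le> H t" for t by (rule H0)
  show "\<exists>t>0. H t < e" if "e > 0" for e by (rule H_lim[OF that])
  show "H \<in> borel_measurable borel" by (rule H_meas)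
  show "(\<lambda>t. \<Sum>d<n. min (\<alpha> 1 d) (H t)) \<in> borel_measurable borel" by measurable
  show "0 \<le> (\<Sum>d<n. min (\<alpha> 1 d) (H t))" for t
    by (intro sum_nonneg) (auto simp: H0 alpha_nonneg)
  show "AE t in lborel. 0 < t \<longrightarrow> (\<integral>\<^sup>+x. ennreal \<bar>Zs n (\<epsilon> * t) x\<bar> \<partial>M) \<le> ennreal (truncation_const m * (real n * min (\<alpha> 2 0) (H t)))"
    using ae
  proof eventually_elim
    case (elim t)
    show ?case
    proof
      assume "0 < t"
      then have h: "min (F (\<epsilon> * t)) (1 - F (\<epsilon> * t)) \<le> H t" using elim by simp
      interpret D: dependent_sequence M past "Yt (\<epsilon> * t)" "\<lambda>d. min (\<alpha> 1 d) (H t)" "\<lambda>q. min (\<alpha> 2 q) (H t)"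
        by (rule dependent_sequence_Yt[OF h])
      have Z: "D.psums n n = Zs n (\<epsilon> * t)" by (simp add: fun_eq_iff D.psums_def Zs_def)
      have "bmeas M (\<lambda>x. \<bar>Zs n (\<epsilon> * t) x\<bar>)" using D.psums_bmeas_M[of n n] unfolding Z by (rule bmeas_abs)
      then have "(\<integral>\<^sup>+x. ennreal \<bar>Zs n (\<epsilon> * t) x\<bar> \<partial>M) = ennreal (expectation (\<lambda>x. \<bar>Zs n (\<epsilon> * t) x\<bar>))"
        by (intro nn_integral_eq_integral bmeas_integrable) auto
      also have "\<dots> \<le> ennreal (truncation_const m * (real n * min (\<alpha> 2 0) (H t)))"
      proof (rule ennreal_leI)
        have "expectation (\<lambda>x. \<bar>Zs n (\<epsilon> * t) x\<bar>) \<le> 2 * real n * min (\<alpha> 2 0) (H t)"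
          using D.abs_expectation_psums_le[of n n] unfolding Z .
        also have "\<dots> = 2 * (real n * min (\<alpha> 2 0) (H t))" by simp
        also have "\<dots> \<le> truncation_const m * (real n * min (\<alpha> 2 0) (H t))"
        proof (rule mult_right_mono)
          show "2 \<le> truncation_const m"
            unfolding truncation_const_def using decomposition_const_pos[of m] by (intro order_trans[OF _ add_increasing[OF _ order_refl]]) auto
        qed (simp add: H0 alpha_nonneg)
        finally show "expectation (\<lambda>x. \<bar>Zs n (\<epsilon> * t) x\<bar>) \<le> truncation_const m * (real n * min (\<alpha> 2 0) (H t))" .
      qed
      finally show "(\<integral>\<^sup>+x. ennreal \<bar>Zs n (\<epsilon> * t) x\<bar> \<partial>M) \<le> ennreal (truncation_const m * (real n * min (\<alpha> 2 0) (H t)))" .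
    qed
  qed
  show "AE t in lborel. 0 < t \<longrightarrow> (\<forall>q\<le>n.
       let a = (real n * (\<Sum>d<n. min (\<alpha> 1 d) (H t))) ^ m + real n * real q * (\<Sum>k<q. (real k + 1) ^ (2*m-3) * min (\<alpha> 2 k) (H t));
           b = real n * (if q < n then min (\<alpha> 2 q) (H t) else 0);
           c = truncation_level m n a b
       in (\<integral>\<^sup>+x. ennreal (min \<bar>Zs n (\<epsilon> * t) x\<bar> c ^ (2*m)) \<partial>M) \<le> ennreal (truncation_const m * a) \<and>
          (\<integral>\<^sup>+x. ennreal (max 0 (\<bar>Zs n (\<epsilon> * t) x\<bar> - c)) \<partial>M) \<le> ennreal (truncation_const m * b))"
    using ae
  proof eventually_elim
    case (elim t)
    show ?case
    proof (intro impI allI)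
      fix q assume "0 < t" and q: "q \<le> n"
      then have h: "min (F (\<epsilon> * t)) (1 - F (\<epsilon> * t)) \<le> H t" using elim by simp
      interpret D: dependent_sequence M past "Yt (\<epsilon> * t)" "\<lambda>d. min (\<alpha> 1 d) (H t)" "\<lambda>q. min (\<alpha> 2 q) (H t)"
        by (rule dependent_sequence_Yt[OF h])
      have Z: "D.psums n n = Zs n (\<epsilon> * t)" by (simp add: fun_eq_iff D.psums_def Zs_def)
      define a where "a = D.gauss_jump m n q"
      define b where "b = D.tail_cost n q"
      define c where "c = truncation_level m n a b"
      have a: "(real n * (\<Sum>d<n. min (\<alpha> 1 d) (H t))) ^ m + real n * real q * (\<Sum>k<q. (real k + 1) ^ (2*m-3) * min (\<alpha> 2 k) (H t)) = a"
        by (simp only: a_def D.gauss_jump_def D.g1_sum_def D.weighted_sum_def)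
      have b: "real n * (if q < n then min (\<alpha> 2 q) (H t) else 0) = b"
        by (simp only: b_def D.tail_cost_def)
      have zb: "bmeas M (Zs n (\<epsilon> * t))" using D.psums_bmeas_M[of n n] unfolding Z .
      have c0: "0 \<le> c" unfolding c_def a_def b_def
        by (rule truncation_level_nonneg[OF D.gauss_jump_nonneg D.tail_cost_nonneg])
      have T: "expectation (\<lambda>x. min \<bar>Zs n (\<epsilon> * t) x\<bar> c ^ (2*m)) \<le> truncation_const m * a"
        "expectation (\<lambda>x. max 0 (\<bar>Zs n (\<epsilon> * t) x\<bar> - c)) \<le> truncation_const m * b"
        using D.truncation[OF m q] unfolding Z c_def a_def b_def .
      have 1: "(\<integral>\<^sup>+x. ennreal (min \<bar>Zs n (\<epsilon> * t) x\<bar> c ^ (2*m)) \<partial>M) = ennreal (expectation (\<lambda>x. min \<bar>Zs n (\<epsilon> * t) x\<bar> c ^ (2*m)))"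
        using c0 by (intro nn_integral_eq_integral bmeas_integrable bmeas_intros zb AE_I2) auto
      have 2: "(\<integral>\<^sup>+x. ennreal (max 0 (\<bar>Zs n (\<epsilon> * t) x\<bar> - c)) \<partial>M) = ennreal (expectation (\<lambda>x. max 0 (\<bar>Zs n (\<epsilon> * t) x\<bar> - c)))"
        by (intro nn_integral_eq_integral bmeas_integrable bmeas_intros zb AE_I2) auto
      have "(\<integral>\<^sup>+x. ennreal (min \<bar>Zs n (\<epsilon> * t) x\<bar> c ^ (2*m)) \<partial>M) \<le> ennreal (truncation_const m * a) \<and>
          (\<integral>\<^sup>+x. ennreal (max 0 (\<bar>Zs n (\<epsilon> * t) x\<bar> - c)) \<partial>M) \<le> ennreal (truncation_const m * b)"
        unfolding 1 2 using T by (auto intro: ennreal_leI)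
      then show "let a = (real n * (\<Sum>d<n. min (\<alpha> 1 d) (H t))) ^ m + real n * real q * (\<Sum>k<q. (real k + 1) ^ (2*m-3) * min (\<alpha> 2 k) (H t));
           b = real n * (if q < n then min (\<alpha> 2 q) (H t) else 0);
           c = truncation_level m n a b
       in (\<integral>\<^sup>+x. ennreal (min \<bar>Zs n (\<epsilon> * t) x\<bar> c ^ (2*m)) \<partial>M) \<le> ennreal (truncation_const m * a) \<and>
          (\<integral>\<^sup>+x. ennreal (max 0 (\<bar>Zs n (\<epsilon> * t) x\<bar> - c)) \<partial>M) \<le> ennreal (truncation_const m * b)"
        unfolding Let_def a b c_def .
    qed
  qed
qed

end

section \<open>Stationarity, reflection and the final bound\<close>

context stationary_setting
begin

lemma nn_integral_shift:
  fixes f :: "'a \<Rightarrow> ennreal"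
  assumes "f \<in> borel_measurable M"
  shows "(\<integral>\<^sup>+\<omega>. f ((T ^^ k) \<omega>) \<partial>M) = (\<integral>\<^sup>+\<omega>. f \<omega> \<partial>M)"
proof -
  have "(\<integral>\<^sup>+\<omega>. f \<omega> \<partial>M) = (\<integral>\<^sup>+\<omega>. f \<omega> \<partial>distr M M (T ^^ k))" by (simp add: T_pow_distr)
  also have "\<dots> = (\<integral>\<^sup>+\<omega>. f ((T ^^ k) \<omega>) \<partial>M)"
    by (rule nn_integral_distr) (use assms in \<open>simp_all add: T_pow_measurable\<close>)
  finally show ?thesis by simp
qed

definition total_deviation :: "nat \<Rightarrow> 'a \<Rightarrow> ennreal" where
  "total_deviation n \<omega> = (\<integral>\<^sup>+t. ennreal \<bar>\<Sum>k=1..n. Yt t k \<omega>\<bar> \<partial>lborel)"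

lemma total_deviation_measurable [measurable]: "total_deviation n \<in> borel_measurable M"
proof -
  have "(\<lambda>(t, \<omega>). \<Sum>k=1..n. Yt t k \<omega>) \<in> borel_measurable (lborel \<Otimes>\<^sub>M M)"
    using Yt_joint_measurable[unfolded case_prod_beta'] unfolding case_prod_beta'
    by (intro borel_measurable_sum) simp
  note [measurable] = this
  show ?thesis unfolding total_deviation_def[abs_def] by measurable
qed

lemma W1_le_total_deviation:
  assumes n: "n \<ge> 1"
  shows "W1 (empirical_measure (stat_seq M T X0) n \<omega>) (distr M borel X0) \<le> ennreal (1 / real n) * total_deviation n \<omega>"
proof -
  have "W1 (empirical_measure (stat_seq M T X0) n \<omega>) (distr M borel X0)
     \<le> (\<integral>\<^sup>+t. ennreal \<bar>cdf (empirical_measure (stat_seq M T X0) n \<omega>) t - F t\<bar> \<partial>lborel)"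
    by (rule W1_le_nn_integral_cdf_diff[OF real_distribution_empirical_measure[OF n] real_distribution_X0])
  also have "\<dots> = (\<integral>\<^sup>+t. ennreal (1 / real n) * ennreal \<bar>\<Sum>k=1..n. Yt t k \<omega>\<bar> \<partial>lborel)"
  proof (rule nn_integral_cong)
    fix t
    have "cdf (empirical_measure (stat_seq M T X0) n \<omega>) t - F t = (1 / real n) * (\<Sum>k=1..n. Yt t k \<omega>)"
      using n by (simp add: cdf_empirical_measure stat_seq_eq Yt_def sum_subtractf field_simps)
    then show "ennreal \<bar>cdf (empirical_measure (stat_seq M T X0) n \<omega>) t - F t\<bar> = ennreal (1 / real n) * ennreal \<bar>\<Sum>k=1..n. Yt t k \<omega>\<bar>"
      by (simp add: abs_mult flip: ennreal_mult)
  qed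
  also have "\<dots> = ennreal (1 / real n) * total_deviation n \<omega>"
    unfolding total_deviation_def
  proof (rule nn_integral_cmult)
    have "(\<lambda>t. Yt t k \<omega>) \<in> borel_measurable lborel" for k
      unfolding Yt_def indicator_def atMost_iff of_bool_def by measurable
    then show "(\<lambda>t. ennreal \<bar>\<Sum>k=1..n. Yt t k \<omega>\<bar>) \<in> borel_measurable lborel" by measurable
  qed
  finally show ?thesis .
qed

text \<open>\<open>Zs\<close> runs over the times \<open>n\<close> to \<open>2 * n - 1\<close> and
  the empirical measure over \<open>1\<close> to \<open>n\<close>; hence the shift by
  \<open>n - 1\<close>.\<close>

lemma Zs_eq_shift:
  assumes "n \<ge> 1" shows "Zs n t \<omega> = (\<Sum>k=1..n. Yt t k ((T ^^ (n - 1)) \<omega>))"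
proof -
  have "Zs n t \<omega> = (\<Sum>k<n. Yt t ((n - 1) + Suc k) \<omega>)"
    unfolding Zs_def using assms by (intro sum.cong refl arg_cong[where f = "\<lambda>j. Yt t j \<omega>"]) simp
  then show ?thesis by (simp only: Yt_shift One_nat_def sum.atLeast1_atMost_eq)
qed

text \<open>Invariance of the measure exchanges the times \<open>1\<close> to \<open>n\<close> for
  those used in \<open>Zs\<close>. The integral over all thresholds is split at 0, each half is an
  instance of \<open>moment_of_integral\<close>, and the additional power of 2 comes from adding the
  halves.\<close>

theorem total_deviation_moment:
  assumes p: "p > 2" "p + 2 \<le> 2 * real m" and n: "n \<ge> 1"
  shows "(\<integral>\<^sup>+\<omega>. ennpowr (total_deviation n \<omega>) p \<partial>M) \<le> ennreal (2 powr (p + 1) * integral_const m (truncation_const m) p) *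
    (ennreal (real n powr (p / 2)) * ennpowr (s_alpha M F0 (stat_seq M T X0) n) p +
     ennreal (real n) * (\<integral>\<^sup>+u\<in>{0..1}. ennpowr (min (alpha_inv (\<alpha> 2) u) (of_nat n)) (p - 1) * ennpowr (quantile_fun M X0 u) p \<partial>lborel))"
    (is "_ \<le> _ * ?R")
proof -
  have m: "m \<ge> 2" using p by linarith
  interpret P: truncated_family M "\<lambda>t. Zs n (1 * t)" "\<alpha> 2" H "\<lambda>t. \<Sum>d<n. min (\<alpha> 1 d) (H t)" n m "truncation_const m"
    by (rule truncated_family_Zs[OF n m]) simp
  interpret N: truncated_family M "\<lambda>t. Zs n (-1 * t)" "\<alpha> 2" H "\<lambda>t. \<Sum>d<n. min (\<alpha> 1 d) (H t)" n m "truncation_const m"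
    by (rule truncated_family_Zs[OF n m]) simp
  let ?c = "integral_const m (truncation_const m) p"
  let ?Gp = "\<lambda>\<omega>. \<integral>\<^sup>+t. ennreal \<bar>Zs n (1 * t) \<omega>\<bar> * indicator {0<..} t \<partial>lborel"
  let ?Gn = "\<lambda>\<omega>. \<integral>\<^sup>+t. ennreal \<bar>Zs n (-1 * t) \<omega>\<bar> * indicator {0<..} t \<partial>lborel"
  have c0: "?c > 0" using p by (intro integral_const_pos less_imp_le[OF truncation_const_pos]) auto
  \<comment> \<open>The sum in the Gaussian scale stops at index \<open>n - 1\<close>, the one in
    \<open>S_alpha\<close> at \<open>n\<close>; the additional term only enlarges the bound.\<close>
  have gs: "P.gauss_scale \<le> s_alpha M F0 (stat_seq M T X0) n"
    unfolding P.gauss_scale_def s_alpha_def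
  proof (rule nn_integral_mono)
    fix t :: real
    have H0: "0 \<le> H t" by (simp add: tail_fun_def)
    have X: "stat_seq M T X0 0 = X0" using stat_seq_eq[of 0] by (simp add: xs_def fun_eq_iff)
    have "(\<Sum>d<n. min (\<alpha> 1 d) (H t)) \<le> S_alpha M F0 (stat_seq M T X0) n t"
      unfolding S_alpha_def X using H0 by (intro sum_mono2) (auto simp: alpha_nonneg)
    then show "ennreal (sqrt (\<Sum>d<n. min (\<alpha> 1 d) (H t))) * indicator {0<..} t
       \<le> ennreal (sqrt (S_alpha M F0 (stat_seq M T X0) n t)) * indicator {0..} t"
      by (auto simp: indicator_def intro!: ennreal_leI)
  qed
  have js: "P.jump_scale p \<le> (\<integral>\<^sup>+u\<in>{0..1}. ennpowr (min (alpha_inv (\<alpha> 2) u) (of_nat n)) (p - 1) * ennpowr (quantile_fun M X0 u) p \<partial>lborel)"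
    unfolding P.jump_scale_def P.\<gamma>_def
    by (rule tail_sum_le_quantile_integral[OF X0_measurable_M p(1) P.al_antimono P.al_nonneg])
  have R: "ennreal (real n powr (p / 2)) * ennpowr P.gauss_scale p + ennreal (real n) * P.jump_scale p \<le> ?R"
    using p by (intro add_mono mult_left_mono ennpowr_mono gs js) auto
  have mp: "(\<integral>\<^sup>+\<omega>. ennpowr (?Gp \<omega>) p \<partial>M) \<le> ennreal ?c * ?R"
    using P.moment_of_integral[OF p] mult_left_mono[OF R, of "ennreal ?c"] by (rule order_trans) simp
  have mn: "(\<integral>\<^sup>+\<omega>. ennpowr (?Gn \<omega>) p \<partial>M) \<le> ennreal ?c * ?R"
    using N.moment_of_integral[OF p] mult_left_mono[OF R, of "ennreal ?c"]
    unfolding N.gauss_scale_def N.jump_scale_def N.\<gamma>_def P.gauss_scale_def P.jump_scale_def P.\<gamma>_def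
    by (rule order_trans) simp
  have Zj: "case_prod (\<lambda>t. Zs n (1 * t)) \<in> borel_measurable (lborel \<Otimes>\<^sub>M M)" "case_prod (\<lambda>t. Zs n (-1 * t)) \<in> borel_measurable (lborel \<Otimes>\<^sub>M M)"
    by (rule P.Z_meas, rule N.Z_meas)
  note [measurable] = Zj
  have [measurable]: "?Gp \<in> borel_measurable M" "?Gn \<in> borel_measurable M"
    by measurable
  have "(\<integral>\<^sup>+\<omega>. ennpowr (total_deviation n \<omega>) p \<partial>M) = (\<integral>\<^sup>+\<omega>. ennpowr (total_deviation n ((T ^^ (n - 1)) \<omega>)) p \<partial>M)"
    by (rule nn_integral_shift[symmetric]) measurable
  also have "\<dots> \<le> (\<integral>\<^sup>+\<omega>. ennreal (2 powr p) * (ennpowr (?Gp \<omega>) p + ennpowr (?Gn \<omega>) p) \<partial>M)"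
  proof (rule nn_integral_mono)
    fix \<omega> assume "\<omega> \<in> space M"
    have "(\<lambda>t. Zs n t \<omega>) \<in> borel_measurable borel"
      using measurable_compose[OF _ Zs_joint_measurable[of n], of "\<lambda>t. (t, \<omega>)" borel] \<open>\<omega> \<in> space M\<close> by simp
    then have m: "(\<lambda>t. ennreal \<bar>Zs n t \<omega>\<bar>) \<in> borel_measurable borel" by measurable
    have "total_deviation n ((T ^^ (n - 1)) \<omega>) = (\<integral>\<^sup>+t. ennreal \<bar>Zs n t \<omega>\<bar> \<partial>lborel)"
      unfolding total_deviation_def Zs_eq_shift[OF n] ..
    also have "\<dots> = ?Gp \<omega> + ?Gn \<omega>" using nn_integral_two_sided[OF m] by simp
    finally show "ennpowr (total_deviation n ((T ^^ (n - 1)) \<omega>)) p \<le> ennreal (2 powr p) * (ennpowr (?Gp \<omega>) p + ennpowr (?Gn \<omega>) p)"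
      using ennpowr_add_le[of p "?Gp \<omega>" "?Gn \<omega>"] p by simp
  qed
  also have "\<dots> = ennreal (2 powr p) * ((\<integral>\<^sup>+\<omega>. ennpowr (?Gp \<omega>) p \<partial>M) + (\<integral>\<^sup>+\<omega>. ennpowr (?Gn \<omega>) p \<partial>M))"
  proof -
    have "(\<integral>\<^sup>+\<omega>. ennpowr (?Gp \<omega>) p + ennpowr (?Gn \<omega>) p \<partial>M) = (\<integral>\<^sup>+\<omega>. ennpowr (?Gp \<omega>) p \<partial>M) + (\<integral>\<^sup>+\<omega>. ennpowr (?Gn \<omega>) p \<partial>M)"
      by (rule nn_integral_add) measurable
    moreover have "(\<integral>\<^sup>+\<omega>. ennreal (2 powr p) * (ennpowr (?Gp \<omega>) p + ennpowr (?Gn \<omega>) p) \<partial>M)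
       = ennreal (2 powr p) * (\<integral>\<^sup>+\<omega>. ennpowr (?Gp \<omega>) p + ennpowr (?Gn \<omega>) p \<partial>M)"
      by (rule nn_integral_cmult) measurable
    ultimately show ?thesis by (simp only:)
  qed
  also have "\<dots> \<le> ennreal (2 powr p) * (ennreal ?c * ?R + ennreal ?c * ?R)"
    by (intro mult_left_mono add_mono mp mn) auto
  also have "\<dots> = ennreal (2 powr (p + 1) * ?c) * ?R"
  proof -
    have "ennreal (2 powr (p + 1) * ?c) = ennreal (2 powr p) * (ennreal ?c + ennreal ?c)"
      using c0 by (simp add: powr_add mult.assoc flip: ennreal_mult ennreal_plus)
    then show ?thesis by (simp only: distrib_right mult.assoc)
  qed
  finally show ?thesis .
qed

end

theorem proposition3p5:
  fixes p :: real
  assumes "p > 2"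
  shows "\<exists>C::real. C > 0 \<and>
    (\<forall>(M :: 'a measure) T F0 X0. stationary_setting M T F0 X0 \<longrightarrow>
      (let X = stat_seq M T X0; \<mu> = distr M borel X0 in
       \<forall>n::nat. n \<ge> 1 \<longrightarrow>
        ennpowr (Lp_norm M p (\<lambda>\<omega>. W1 (empirical_measure X n \<omega>) \<mu>)) p
          \<le> ennreal C *
             (ennpowr (s_alpha M F0 X n) p / ennreal (real n powr (p / 2))
              + 1 / ennreal (real n powr (p - 1)) *
                (\<integral>\<^sup>+u\<in>{0..1}. ennpowr (min (alpha_inv (alpha_coef M F0 X 2) u) (of_nat n)) (p - 1)
                   * ennpowr (quantile_fun M X0 u) p \<partial>lborel))))"
proof -
  \<comment> \<open>Any \<open>m\<close> with \<open>p + 2 \<le> 2 * real m\<close> will do. It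
    depends on \<open>p\<close> alone, so the constant \<open>C\<close> does not depend on the
    process or on \<open>n\<close>.\<close>
  define m where "m = nat \<lceil>p\<rceil> + 2"
  have m: "p + 2 \<le> 2 * real m" 
  proof -
    have "real m = real (nat \<lceil>p\<rceil>) + 2" by (simp only: m_def of_nat_add of_nat_numeral)
    then show ?thesis using real_nat_ceiling_ge[of p] assms by linarith
  qed
  define C where "C = 2 powr (p + 1) * integral_const m (truncation_const m) p"
  have C: "C > 0" unfolding C_def using assms
    by (intro mult_pos_pos integral_const_pos less_imp_le[OF truncation_const_pos]) auto
  have main: "ennpowr (Lp_norm M p (\<lambda>\<omega>. W1 (empirical_measure (stat_seq M T X0) n \<omega>) (distr M borel X0))) p
          \<le> ennreal C *
             (ennpowr (s_alpha M F0 (stat_seq M T X0) n) p / ennreal (real n powr (p / 2))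
              + 1 / ennreal (real n powr (p - 1)) *
                (\<integral>\<^sup>+u\<in>{0..1}. ennpowr (min (alpha_inv (alpha_coef M F0 (stat_seq M T X0) 2) u) (of_nat n)) (p - 1)
                   * ennpowr (quantile_fun M X0 u) p \<partial>lborel))"
    if st: "stationary_setting M T F0 X0" and n: "n \<ge> 1" for M :: "'a measure" and T F0 X0 and n :: nat
  proof -
    interpret stationary_setting M T F0 X0 by fact
    let ?s = "ennpowr (s_alpha M F0 (stat_seq M T X0) n) p"
    let ?I = "\<integral>\<^sup>+u\<in>{0..1}. ennpowr (min (alpha_inv (alpha_coef M F0 (stat_seq M T X0) 2) u) (of_nat n)) (p - 1)
                   * ennpowr (quantile_fun M X0 u) p \<partial>lborel"
    have n0: "real n > 0" using n by simp
    have npow: "(1 / real n) powr p = real n powr (- p)" by (simp add: powr_minus powr_divide inverse_eq_divide)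
    have "ennpowr (Lp_norm M p (\<lambda>\<omega>. W1 (empirical_measure (stat_seq M T X0) n \<omega>) (distr M borel X0))) p
       = (\<integral>\<^sup>+\<omega>. ennpowr (W1 (empirical_measure (stat_seq M T X0) n \<omega>) (distr M borel X0)) p \<partial>M)"
      unfolding Lp_norm_def using assms by (intro ennpowr_inverse) simp
    also have "\<dots> \<le> (\<integral>\<^sup>+\<omega>. ennpowr (ennreal (1 / real n) * total_deviation n \<omega>) p \<partial>M)"
      using assms by (intro nn_integral_mono ennpowr_mono W1_le_total_deviation n) simp
    also have "\<dots> = (\<integral>\<^sup>+\<omega>. ennreal ((1 / real n) powr p) * ennpowr (total_deviation n \<omega>) p \<partial>M)"
      using n0 by (intro nn_integral_cong ennpowr_mult) simp
    also have "\<dots> = ennreal ((1 / real n) powr p) * (\<integral>\<^sup>+\<omega>. ennpowr (total_deviation n \<omega>) p \<partial>M)"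
      by (rule nn_integral_cmult) measurable
    also have "\<dots> \<le> ennreal ((1 / real n) powr p) * (ennreal C * (ennreal (real n powr (p / 2)) * ?s + ennreal (real n) * ?I))"
      unfolding C_def by (intro mult_left_mono total_deviation_moment assms m n) simp
    also have "\<dots> = ennreal C * ((ennreal ((1 / real n) powr p) * ennreal (real n powr (p / 2))) * ?s + (ennreal ((1 / real n) powr p) * ennreal (real n)) * ?I)"
      by (simp only: distrib_left mult_ac)
    \<comment> \<open>The normalisation of the empirical measure contributes
      \<open>n powr (- p)\<close>, which combines with \<open>n powr (p / 2)\<close> and with
      \<open>n\<close> to the two denominators of the claim.\<close>
    also have "ennreal ((1 / real n) powr p) * ennreal (real n powr (p / 2)) = inverse (ennreal (real n powr (p / 2)))"
    proof -
      have "(1 / real n) powr p * real n powr (p / 2) = inverse (real n powr (p / 2))"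
        unfolding npow powr_minus[of "real n" "p / 2", symmetric] by (simp flip: powr_add)
      then show ?thesis using n0 by (simp add: inverse_ennreal flip: ennreal_mult)
    qed
    also have "ennreal ((1 / real n) powr p) * ennreal (real n) = inverse (ennreal (real n powr (p - 1)))"
    proof -
      have "(1 / real n) powr p * real n = inverse (real n powr (p - 1))"
        unfolding npow powr_minus[of "real n" "p - 1", symmetric]
        using n0 powr_add[of "real n" "- p" 1] by simp
      then show ?thesis using n0 by (simp add: inverse_ennreal flip: ennreal_mult)
    qed
    finally show ?thesis by (simp add: divide_ennreal_def mult.commute)
  qed
  show ?thesis
    unfolding Let_def
    by (intro exI[of _ C] conjI allI impI) (rule C, (rule main; assumption))
qed

end
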